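(* Let $D=(0,\infty)$ and let $m$ be a measure on $\mathbb{R}^\circ:=\mathbb{R}\setminus\{0\}$ such that $(1\vee|u|)\,m(du)$ is a finite measure on $\mathbb{R}^\circ$. Let $N(ds,du)$ be a Poisson random measure on $[0,\infty)\times\mathbb{R}^\circ$ with intensity $ds\,m(du)$, defined on a complete probability space, and set $\tilde N(ds,du)=N(ds,du)-ds\,m(du)$. Then for each $t\ge0$ the function $$Z^0_t(y):=\int_0^t\int_{\mathbb{R}^\circ}u\,k_{t-s}(y)\,\tilde N(ds,du)$$ belongs to $L^2(D,\lambda)$ a.s., and $\{Z^0_t:t\ge0\}$ is a Markov process with state space $L^2(D,\lambda)$, initial value zero and transition semigroup $(R'_t)_{t\ge0}$ given by $$\int_{L^2(D,\lambda)}e^{i\langle h,f\rangle}R'_t(g,dh)=\exp\Big\{i\langle g,P_tf\rangle+\int_0^t\varphi(\langle k_s,f\rangle)\,ds\Big\},\qquad f\in L^2(D,\lambda),$$ where $$\varphi(z)=\int_{\mathbb{R}^\circ}\big(e^{iuz}-1-iuz\big)\,m(du),\qquad z\in\mathbb{R}.$$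
   Context: $\lambda$ denotes Lebesgue measure; $\langle\cdot,\cdot\rangle$ is the inner product of the real Hilbert space $L^2(D,\lambda)$. Let $g_t(x)=(2\pi t)^{-1/2}\exp\{-x^2/2t\}$ for $t>0$, $x\in\mathbb{R}$; $p_t(x,y)=g_t(x-y)-g_t(x+y)$ and $k_t(y)=y\,g_t(y)/t$ for $t>0$, $x,y\in D$. $(P_t)_{t\ge0}$ is the transition semigroup of the absorbing barrier Brownian motion in $D$: $P_0f=f$ and $P_tf(x)=\int_0^\infty p_t(x,y)f(y)\,dy$ for $t>0$. The integral with respect to $\tilde N$ is understood as the integral with respect to $N$ minus the integral with respect to $ds\,m(du)$. *)

theory Defs
  imports "HOL-Probability.Probability"
begin

section \<open>The real Hilbert space $L^2(D,\lambda)$ with $D = (0,\infty)$\<close>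

definition leb_D :: "real measure" where
  "leb_D = restrict_space lborel {0<..}"

definition square_integrable_D :: "(real \<Rightarrow> real) \<Rightarrow> bool" where
  "square_integrable_D f \<longleftrightarrow>
     f \<in> borel_measurable leb_D \<and> integrable leb_D (\<lambda>x. (f x)\<^sup>2)"

definition L2_rel :: "(real \<Rightarrow> real) \<Rightarrow> (real \<Rightarrow> real) \<Rightarrow> bool" where
  "L2_rel f g \<longleftrightarrow>
     square_integrable_D f \<and> square_integrable_D g \<and> (AE x in leb_D. f x = g x)"

lemma square_integrable_D_zero: "square_integrable_D (\<lambda>_. 0)"
  by (simp add: square_integrable_D_def)

lemma integrable_mult_D:
  assumes "square_integrable_D f" "square_integrable_D g"
  shows "integrable leb_D (\<lambda>x. f x * g x)"
proof (rule Bochner_Integration.integrable_bound)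
  show "integrable leb_D (\<lambda>x. (f x)\<^sup>2 + (g x)\<^sup>2)"
    using assms by (simp add: square_integrable_D_def)
  show "(\<lambda>x. f x * g x) \<in> borel_measurable leb_D"
    using assms by (auto simp: square_integrable_D_def)
  have "\<bar>a * b\<bar> \<le> a\<^sup>2 + b\<^sup>2" for a b :: real
  proof -
    have "0 \<le> (\<bar>a\<bar> - \<bar>b\<bar>)\<^sup>2" by simp
    then have "2 * \<bar>a * b\<bar> \<le> a\<^sup>2 + b\<^sup>2"
      by (simp add: power2_diff abs_mult)
    then show ?thesis
      using abs_ge_zero[of "a * b"] by linarith
  qed
  then show "AE x in leb_D. norm (f x * g x) \<le> norm ((f x)\<^sup>2 + (g x)\<^sup>2)"
    by (intro AE_I2) simp
qed

lemma square_integrable_D_add: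
  assumes "square_integrable_D f" "square_integrable_D g"
  shows "square_integrable_D (\<lambda>x. f x + g x)"
  using assms integrable_mult_D[OF assms]
  by (auto simp: square_integrable_D_def power2_sum mult.assoc)

lemma square_integrable_D_scale:
  assumes "square_integrable_D f"
  shows "square_integrable_D (\<lambda>x. r * f x)"
  using assms by (auto simp: square_integrable_D_def power_mult_distrib)

lemma part_equivp_L2_rel: "part_equivp L2_rel"
proof (rule part_equivpI)
  show "\<exists>f. L2_rel f f"
    using square_integrable_D_zero by (auto simp: L2_rel_def)
  show "symp L2_rel"
    by (auto simp: symp_def L2_rel_def)
  show "transp L2_rel"
  proof (rule transpI)
    fix f g h
    assume fg: "L2_rel f g" and gh: "L2_rel g h"
    have "AE x in leb_D. f x = g x" "AE x in leb_D. g x = h x"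
      using fg gh by (auto simp: L2_rel_def)
    then have "AE x in leb_D. f x = h x" by eventually_elim simp
    then show "L2_rel f h" using fg gh by (simp add: L2_rel_def)
  qed
qed

quotient_type L2D = "real \<Rightarrow> real" / partial: L2_rel
  by (rule part_equivp_L2_rel)

instantiation L2D :: real_vector
begin

lift_definition zero_L2D :: L2D is "\<lambda>_. 0"
  by (simp add: L2_rel_def square_integrable_D_zero)

lift_definition plus_L2D :: "L2D \<Rightarrow> L2D \<Rightarrow> L2D" is "\<lambda>f g x. f x + g x"
  by (auto simp: L2_rel_def square_integrable_D_add)

lift_definition scaleR_L2D :: "real \<Rightarrow> L2D \<Rightarrow> L2D" is "\<lambda>r f x. r * f x"
  by (auto simp: L2_rel_def square_integrable_D_scale)

definition uminus_L2D :: "L2D \<Rightarrow> L2D" where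
  "uminus_L2D f = (-1) *\<^sub>R f"

definition minus_L2D :: "L2D \<Rightarrow> L2D \<Rightarrow> L2D" where
  "minus_L2D f g = f + - (g :: L2D)"

instance
proof
  fix a b c :: L2D and r s :: real
  show "a + b + c = a + (b + c)"
    by transfer (auto simp: L2_rel_def add.assoc intro!: square_integrable_D_add)
  show "a + b = b + a"
    by transfer (auto simp: L2_rel_def add.commute intro!: square_integrable_D_add)
  show "0 + a = a"
    by transfer (auto simp: L2_rel_def)
  show "- a + a = 0"
    unfolding uminus_L2D_def
    by transfer (auto simp: L2_rel_def square_integrable_D_zero)
  show "a - b = a + - b"
    by (fact minus_L2D_def)
  show "r *\<^sub>R (a + b) = r *\<^sub>R a + r *\<^sub>R b"
    by transfer (auto simp: L2_rel_def algebra_simps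
        intro!: square_integrable_D_add square_integrable_D_scale)
  show "(r + s) *\<^sub>R a = r *\<^sub>R a + s *\<^sub>R a"
    by transfer (auto simp: L2_rel_def distrib_right
        intro!: square_integrable_D_add square_integrable_D_scale)
  show "r *\<^sub>R s *\<^sub>R a = (r * s) *\<^sub>R a"
    by transfer (auto simp: L2_rel_def mult.assoc
        intro!: square_integrable_D_scale)
  show "1 *\<^sub>R a = a"
    by transfer (auto simp: L2_rel_def)
qed

end

instantiation L2D :: real_inner
begin

lift_definition inner_L2D :: "L2D \<Rightarrow> L2D \<Rightarrow> real" is
  "\<lambda>f g. \<integral>x. f x * g x \<partial>leb_D"
proof -
  fix f f' g g'
  assume f: "L2_rel f f'" and g: "L2_rel g g'"
  have "AE x in leb_D. f x = f' x" "AE x in leb_D. g x = g' x"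
    using f g by (auto simp: L2_rel_def)
  then have "AE x in leb_D. f x * g x = f' x * g' x" by eventually_elim simp
  then show "(\<integral>x. f x * g x \<partial>leb_D) = (\<integral>x. f' x * g' x \<partial>leb_D)"
    using f g by (intro integral_cong_AE) (auto simp: L2_rel_def square_integrable_D_def)
qed

definition norm_L2D :: "L2D \<Rightarrow> real" where
  "norm_L2D f = sqrt (inner f f)"

definition dist_L2D :: "L2D \<Rightarrow> L2D \<Rightarrow> real" where
  "dist_L2D f g = norm (f - g)"

definition sgn_L2D :: "L2D \<Rightarrow> L2D" where
  "sgn_L2D f = f /\<^sub>R norm f"

definition uniformity_L2D :: "(L2D \<times> L2D) filter" where
  "uniformity_L2D = (INF e\<in>{0 <..}. principal {(x, y). dist x y < e})"

definition open_L2D :: "L2D set \<Rightarrow> bool" where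
  "open_L2D U \<longleftrightarrow> (\<forall>x\<in>U. eventually (\<lambda>(x', y). x' = x \<longrightarrow> y \<in> U) uniformity)"

instance
proof
  fix a b c :: L2D and r :: real
  show "sgn a = a /\<^sub>R norm a"
    by (fact sgn_L2D_def)
  show "dist a b = norm (a - b)"
    by (fact dist_L2D_def)
  show "inner a b = inner b a"
    by transfer (simp add: mult.commute)
  show "inner (a + b) c = inner a c + inner b c"
    by transfer (simp add: distrib_right L2_rel_def integrable_mult_D)
  show "inner (r *\<^sub>R a) b = r * inner a b"
    by transfer (simp add: mult.assoc)
  show "0 \<le> inner a a"
    by transfer simp
  show "inner a a = 0 \<longleftrightarrow> a = 0"
  proof transfer
    fix f assume f: "L2_rel f f"
    then have int: "integrable leb_D (\<lambda>x. f x * f x)"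
      by (simp add: L2_rel_def integrable_mult_D)
    have "(\<integral>x. f x * f x \<partial>leb_D) = 0 \<longleftrightarrow> (AE x in leb_D. f x * f x = 0)"
      by (rule integral_nonneg_eq_0_iff_AE[OF int]) simp
    then show "(\<integral>x. f x * f x \<partial>leb_D) = 0 \<longleftrightarrow> L2_rel f (\<lambda>_. 0)"
      using f by (simp add: L2_rel_def square_integrable_D_zero)
  qed
  show "norm a = sqrt (inner a a)"
    by (fact norm_L2D_def)
  show "uniformity = (INF e\<in>{0 <..}. principal {(x, y::L2D). dist x y < e})"
    by (fact uniformity_L2D_def)
  fix U :: "L2D set"
  show "open U \<longleftrightarrow> (\<forall>x\<in>U. eventually (\<lambda>(x', y). x' = x \<longrightarrow> y \<in> U) uniformity)"
    by (fact open_L2D_def)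
qed

end

text \<open>The class of a function in \<open>L2D\<close>; the value \<open>0\<close> for functions that are not
  square integrable is only there to make the map total.\<close>

definition L2_of :: "(real \<Rightarrow> real) \<Rightarrow> L2D" where
  "L2_of f = (if square_integrable_D f then abs_L2D f else 0)"


section \<open>Kernels and the absorbing barrier Brownian semigroup\<close>

definition gauss :: "real \<Rightarrow> real \<Rightarrow> real" where
  "gauss t x = (2 * pi * t) powr (- 1 / 2) * exp (- x\<^sup>2 / (2 * t))"

definition abs_kernel :: "real \<Rightarrow> real \<Rightarrow> real \<Rightarrow> real" where
  "abs_kernel t x y = gauss t (x - y) - gauss t (x + y)"

text \<open>Only used for \<open>t \<ge> 0\<close>; division by zero gives \<open>k_0 = 0\<close>, which extends \<open>k\<close> to the
  endpoint \<open>s = t\<close> of the integrals below.\<close>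

definition kfun :: "real \<Rightarrow> real \<Rightarrow> real" where
  "kfun t y = y * gauss t y / t"

definition abs_semigroup :: "real \<Rightarrow> (real \<Rightarrow> real) \<Rightarrow> real \<Rightarrow> real" where
  "abs_semigroup t f x = (if t = 0 then f x else \<integral>y. abs_kernel t x y * f y \<partial>leb_D)"


section \<open>Poisson random measures\<close>

text \<open>The Poisson law is spelled out because \<open>poisson_pmf\<close> excludes the rate \<open>0\<close>.\<close>

definition poisson_random_measure ::
  "'w measure \<Rightarrow> 'a measure \<Rightarrow> ('w \<Rightarrow> 'a measure) \<Rightarrow> bool" where
  "poisson_random_measure M \<mu> N \<longleftrightarrow>
     (\<forall>\<omega>\<in>space M. sets (N \<omega>) = sets \<mu>) \<and>
     (\<forall>A\<in>sets \<mu>. (\<lambda>\<omega>. emeasure (N \<omega>) A) \<in> borel_measurable M) \<and>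
     (\<forall>A\<in>sets \<mu>. emeasure \<mu> A < \<infinity> \<longrightarrow>
        (\<forall>n::nat. measure M {\<omega>\<in>space M. emeasure (N \<omega>) A = of_nat n}
                = measure \<mu> A ^ n / fact n * exp (- measure \<mu> A))) \<and>
     (\<forall>A\<in>sets \<mu>. emeasure \<mu> A = \<infinity> \<longrightarrow> (AE \<omega> in M. emeasure (N \<omega>) A = \<infinity>)) \<and>
     (\<forall>(n::nat) (A :: nat \<Rightarrow> 'a set). A ` {..<n} \<subseteq> sets \<mu> \<and> disjoint_family_on A {..<n} \<longrightarrow>
        prob_space.indep_vars M (\<lambda>_. borel) (\<lambda>i \<omega>. emeasure (N \<omega>) (A i)) {..<n})"

text \<open>A measure \<open>m\<close> on \<open>\<real> \<setminus> {0}\<close> is a \<^typ>\<open>real measure\<close> with space \<open>- {0}\<close>.\<close>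

definition intensity :: "real measure \<Rightarrow> (real \<times> real) measure" where
  "intensity m = restrict_space lborel {0..} \<Otimes>\<^sub>M m"


section \<open>The process\<close>

definition Z0_integrand :: "real \<Rightarrow> real \<Rightarrow> real \<times> real \<Rightarrow> real" where
  "Z0_integrand t y = (\<lambda>(s, u). u * kfun (t - s) y)"

definition Z0 :: "real measure \<Rightarrow> ('w \<Rightarrow> (real \<times> real) measure) \<Rightarrow> real \<Rightarrow> 'w \<Rightarrow> real \<Rightarrow> real" where
  "Z0 m N t \<omega> y =
     (LINT p : {0..t} \<times> (- {0}) | N \<omega>. Z0_integrand t y p)
     - (LINT p : {0..t} \<times> (- {0}) | intensity m. Z0_integrand t y p)"

definition phi :: "real measure \<Rightarrow> real \<Rightarrow> complex" where
  "phi m z = (\<integral>u. exp (\<i> * of_real (u * z)) - 1 - \<i> * of_real (u * z) \<partial>m)"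


section \<open>Transition semigroups and Markov processes\<close>

definition transition_semigroup ::
  "(real \<Rightarrow> 'e::topological_space \<Rightarrow> 'e measure) \<Rightarrow> bool" where
  "transition_semigroup R \<longleftrightarrow>
     (\<forall>t\<ge>0. R t \<in> borel \<rightarrow>\<^sub>M prob_algebra borel) \<and>
     (\<forall>x. R 0 x = return borel x) \<and>
     (\<forall>s\<ge>0. \<forall>t\<ge>0. \<forall>x. R (s + t) x = R s x \<bind> R t)"

definition natural_filtration ::
  "'w measure \<Rightarrow> (real \<Rightarrow> 'w \<Rightarrow> 'e::topological_space) \<Rightarrow> real \<Rightarrow> 'w measure" where
  "natural_filtration M X s =
     sigma (space M) {X r -` B \<inter> space M | r B. 0 \<le> r \<and> r \<le> s \<and> B \<in> sets borel}"

definition markov_process ::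
  "'w measure \<Rightarrow> (real \<Rightarrow> 'w \<Rightarrow> 'e::topological_space) \<Rightarrow>
     (real \<Rightarrow> 'e \<Rightarrow> 'e measure) \<Rightarrow> bool" where
  "markov_process M X R \<longleftrightarrow>
     (\<forall>t\<ge>0. X t \<in> M \<rightarrow>\<^sub>M borel) \<and>
     transition_semigroup R \<and>
     (\<forall>s\<ge>0. \<forall>t\<ge>0. \<forall>B\<in>sets borel.
        AE \<omega> in M. real_cond_exp M (natural_filtration M X s) (indicator (X (s + t) -` B)) \<omega>
                 = measure (R t (X s \<omega>)) B)"

end

theory Submission
  imports Defs
begin

text \<open>
  Testing the process against \<open>F \<in> L\<^sup>2(D)\<close> turns it into the compensated Poisson integral of
  \<open>u \<langle>k\<^bsub>t-s\<^esub>, F\<rangle>\<close>, so that its characteristic functional comes from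
  \<open>E exp(i \<integral>f dN) = exp(\<integral>(exp(i f) - 1) d\<mu>)\<close>.  The semigroup \<open>P\<close> is symmetric and
  \<open>P\<^bsub>t\<^esub> k\<^bsub>r\<^esub> = k\<^bsub>t+r\<^esub>\<close>; hence, tested against \<open>F\<close>, the innovation
  \<open>Y = Z\<^bsub>s+t\<^esub> - P\<^bsub>t\<^esub> Z\<^bsub>s\<^esub>\<close> only involves jumps in \<open>(s, s + t]\<close>.  Comparing characteristic
  functionals shows that \<open>Y\<close> is independent of the past up to \<open>s\<close> and has the law of \<open>Z\<^bsub>t\<^esub>\<close>,
  and the transition kernel is the law of \<open>P\<^bsub>t\<^esub> g + Z\<^bsub>t\<^esub>\<close>.  That characteristic functionals
  determine laws on \<open>L\<^sup>2(D)\<close> uses separability and is reduced to Levy's theorem on the line.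
\<close>

section \<open>Uniqueness of characteristic functionals\<close>

text \<open>Kernel and jumps both force an L1 argument. The norm of k_r in L2(D) is of order
  r^(-3/4), which is integrable at 0 but not square integrable, and m has only a first absolute
  moment; so no Ito isometry is at hand. Instead the single function \<open>jump_bound\<close>,
  which is max 1 |u| times 1 + (t-s)^(-3/4) on [0,t], is integrable for the intensity, hence almost
  surely for N by Campbell's formula. It controls everything pathwise: the compensated integral is a
  difference of two absolutely convergent integrals, and for each t one null set serves all y > 0
  and all test functions. The identity P_t k_r = k_(t+r) breaks down at r = 0, where the convention
  k_0 = 0 gives P_t k_0 = 0 and not k_t; jumps exactly at time s must therefore be discarded as a
  null set. Independence is needed relative to the natural filtration of the process itself. For
  this reason the joint law of the sample point and the innovation is identified on the product of
  that sigma-algebra with the Borel sets, the test functions for the past being those that are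
  almost surely compensated integrals.\<close>

lemma weighted_char_eqD:
  fixes h v :: "'a \<Rightarrow> real"
  assumes P: "prob_space P" and Q: "prob_space Q" and sets_eq: "sets P = sets Q"
    and v: "v \<in> borel_measurable P" and h: "h \<in> borel_measurable P"
    and h0: "\<And>x. 0 \<le> h x" and hC: "\<And>x. h x \<le> C"
    and eq: "\<And>t. (CLINT x|P. of_real (h x) * iexp (t * v x)) = (CLINT x|Q. of_real (h x) * iexp (t * v x))"
    and B: "B \<in> sets borel"
  shows "(LINT x|P. h x * indicator B (v x)) = (LINT x|Q. h x * indicator B (v x))"
proof -
  have v': "v \<in> borel_measurable Q" and h': "h \<in> borel_measurable Q"
    using v h sets_eq measurable_cong_sets by blast+
  have int: "integrable S h" if S: "prob_space S" "h \<in> borel_measurable S" for S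
  proof -
    interpret prob_space S by fact
    show ?thesis by (rule integrable_const_bound[where B=C]) (use S h0 hC in auto)
  qed
  \<comment> \<open>The case t = 0 of the hypothesis says that h has the same mass c under both
    measures. Divided by c it is a probability density, and the law of v under this density has the
    weighted integral over c as its characteristic function, so that Levy's theorem applies. If c =
    0, then h vanishes almost everywhere for both measures.\<close>
  define c where "c = (LINT x|P. h x)"
  have c: "c = (LINT x|Q. h x)"
  proof -
    have "complex_of_real (LINT x|P. h x) = of_real (LINT x|Q. h x)"
      using eq[of 0] int[OF P h] int[OF Q h'] by simp
    then show ?thesis by (simp only: of_real_eq_iff c_def)
  qed
  have c0: "0 \<le> c" unfolding c_def by (simp add: h0)
  have dist: "real_distribution (distr (density S (\<lambda>x. ennreal (h x / c))) borel v) \<and>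
     char (distr (density S (\<lambda>x. ennreal (h x / c))) borel v) =
       (\<lambda>t. (CLINT x|S. of_real (h x) * iexp (t * v x)) / of_real c) \<and>
     measure (distr (density S (\<lambda>x. ennreal (h x / c))) borel v) B
       = (LINT x|S. h x * indicator B (v x)) / c"
    if S: "prob_space S" "h \<in> borel_measurable S" "v \<in> borel_measurable S"
      and cS: "c = (LINT x|S. h x)" and "c \<noteq> 0" for S
  proof -
    interpret prob_space S by fact
    note [measurable] = S(2,3) B
    have cpos: "0 < c" using c0 \<open>c \<noteq> 0\<close> by simp
    have "emeasure (density S (\<lambda>x. ennreal (h x / c))) (space S) = (\<integral>\<^sup>+x. ennreal (h x / c) \<partial>S)"
      by (subst emeasure_density) (auto intro!: nn_integral_cong)
    also have "\<dots> = ennreal (LINT x|S. h x / c)"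
      using int[OF S(1,2)] cpos h0 by (intro nn_integral_eq_integral) auto
    also have "\<dots> = 1" using cpos cS by simp
    finally have pd: "prob_space (density S (\<lambda>x. ennreal (h x / c)))"
      by (intro prob_spaceI) simp
    then have pr: "prob_space (distr (density S (\<lambda>x. ennreal (h x / c))) borel v)"
      by (rule prob_space.prob_space_distr) simp
    have 1: "real_distribution (distr (density S (\<lambda>x. ennreal (h x / c))) borel v)"
      using pr by (simp add: real_distribution_def real_distribution_axioms_def)
    have 2: "char (distr (density S (\<lambda>x. ennreal (h x / c))) borel v) t =
       (CLINT x|S. of_real (h x) * iexp (t * v x)) / of_real c" for t
    proof -
      have "char (distr (density S (\<lambda>x. ennreal (h x / c))) borel v) t
        = (CLINT x|S. (h x / c) *\<^sub>R iexp (t * v x))"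
        unfolding char_def using cpos h0
        by (simp add: integral_distr integral_density)
      also have "\<dots> = (CLINT x|S. (of_real (h x) * iexp (t * v x)) / of_real c)"
        by (simp add: scaleR_conv_of_real)
      finally show ?thesis by simp
    qed
    have 3: "measure (distr (density S (\<lambda>x. ennreal (h x / c))) borel v) B
       = (LINT x|S. h x * indicator B (v x)) / c"
    proof -
      have "measure (distr (density S (\<lambda>x. ennreal (h x / c))) borel v) B
        = (LINT x|distr (density S (\<lambda>x. ennreal (h x / c))) borel v. indicator B x)"
        by simp
      also have "\<dots> = (LINT x|S. (h x / c) * indicator B (v x))"
        using cpos h0 by (subst integral_distr, simp, simp, subst integral_density) auto
      finally show ?thesis by simp
    qed
    show ?thesis using 1 2 3 by blast
  qed
  show ?thesis
  proof (cases "c = 0")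
    case True
    have "AE x in P. h x = 0"
      using integral_nonneg_eq_0_iff_AE[OF int[OF P h]] h0 True c_def by simp
    moreover have "AE x in Q. h x = 0"
      using integral_nonneg_eq_0_iff_AE[OF int[OF Q h']] h0 True c by simp
    ultimately have "(LINT x|P. h x * indicator B (v x)) = 0" "(LINT x|Q. h x * indicator B (v x)) = 0"
      by (auto intro!: integral_eq_zero_AE elim: AE_mp)
    then show ?thesis by simp
  next
    case False
    note d1 = dist[OF P h v c_def False] and d2 = dist[OF Q h' v' c False]
    have "distr (density P (\<lambda>x. ennreal (h x / c))) borel v = distr (density Q (\<lambda>x. ennreal (h x / c))) borel v"
      using d1 d2 eq by (intro Levy_uniqueness) auto
    then show ?thesis using d1 d2 False by (metis div_by_0 divide_cancel_right)
  qed
qed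

text \<open>A cylinder set is reached one coordinate at a time: an exponential iexp(t v) is traded
  for the indicator of a Borel condition on v, while another exponential iexp(w) is kept for the
  coordinates still to come. This works because V is a linear space, so that t v + w and t v - w are
  again admissible. Setting w = 0 at the end leaves the measures of cylinder sets, an
  intersection-stable generator.\<close>

lemma measure_eqI_char_functional:
  fixes V :: "('a \<Rightarrow> real) set"
  assumes P: "prob_space P" and Q: "prob_space Q" and sets_eq: "sets P = sets Q"
    and meas: "\<And>v. v \<in> V \<Longrightarrow> v \<in> borel_measurable P"
    and add: "\<And>v w. v \<in> V \<Longrightarrow> w \<in> V \<Longrightarrow> (\<lambda>x. v x + w x) \<in> V"
    and scale: "\<And>c v. v \<in> V \<Longrightarrow> (\<lambda>x. c * v x) \<in> V"
    and "V \<noteq> {}"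
    and gen: "sets P = sigma_sets (space P) {v -` B \<inter> space P | v B. v \<in> V \<and> B \<in> sets borel}"
    and char: "\<And>v. v \<in> V \<Longrightarrow> (CLINT x|P. iexp (v x)) = (CLINT x|Q. iexp (v x))"
  shows "P = Q"
proof -
  interpret P: prob_space P by fact
  interpret Q: prob_space Q by fact
  have space_eq: "space Q = space P" using sets_eq_imp_space_eq[OF sets_eq] by simp
  have meas': "v \<in> borel_measurable Q" if "v \<in> V" for v
    using meas[OF that] sets_eq measurable_cong_sets by blast
  have zero: "(\<lambda>x. 0) \<in> V"
    using \<open>V \<noteq> {}\<close> scale[of _ 0] by auto
  define I where "I S A w = (CLINT x|S. of_real (indicator A x) * iexp (w x))" for S :: "'a measure" and A w
  have bnd: "integrable P f" "integrable Q f"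
    if "f \<in> borel_measurable P" "\<And>x. norm (f x) \<le> K" for f :: "'a \<Rightarrow> complex" and K
  proof -
    show "integrable P f" using that by (intro P.integrable_const_bound[where B=K]) auto
    have "f \<in> borel_measurable Q" using that(1) sets_eq measurable_cong_sets by blast
    then show "integrable Q f" using that by (intro Q.integrable_const_bound[where B=K]) auto
  qed
  have bndr: "integrable P f" "integrable Q f"
    if "f \<in> borel_measurable P" "\<And>x. norm (f x) \<le> K" for f :: "'a \<Rightarrow> real" and K
  proof -
    show "integrable P f" using that by (intro P.integrable_const_bound[where B=K]) auto
    have "f \<in> borel_measurable Q" using that(1) sets_eq measurable_cong_sets by blast
    then show "integrable Q f" using that by (intro Q.integrable_const_bound[where B=K]) auto
  qed
  \<comment> \<open>One coordinate \<open>v\<close> is turned from an exponential into an indicator by applying the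
    one-dimensional uniqueness theorem to the nonnegative weights \<open>1\<^sub>A (1 + cos w)\<close> and \<open>1\<^sub>A (1 + sin w)\<close>.\<close>
  have step: "\<forall>w\<in>V. I P (A \<inter> (v -` B \<inter> space P)) w = I Q (A \<inter> (v -` B \<inter> space P)) w"
    if A: "A \<in> sets P" and IH: "\<And>w. w \<in> V \<Longrightarrow> I P A w = I Q A w"
      and v: "v \<in> V" and B: "B \<in> sets borel" for A v B
  proof
    fix w assume w: "w \<in> V"
    note [measurable] = A meas[OF v] meas[OF w] B
    have tv: "(\<lambda>x. t * v x) \<in> V" for t using scale[OF v] .
    have tp: "(\<lambda>x. t * v x + w x) \<in> V" for t using add[OF tv w] .
    have tm: "(\<lambda>x. t * v x - w x) \<in> V" for t using add[OF tv scale[OF w, of "-1"]] by simp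
    define Z where "Z S f = (LINT x|S. (indicator A x * f x) * indicator B (v x))" for S :: "'a measure" and f :: "'a \<Rightarrow> real"
    have 0: "Z P (\<lambda>x. 1) = Z Q (\<lambda>x. 1)"
      unfolding Z_def
    proof (rule weighted_char_eqD[OF P Q sets_eq meas[OF v] _ _ _ _ B, where C=1])
      fix t
      show "(CLINT x|P. of_real (indicator A x * 1) * iexp (t * v x)) = (CLINT x|Q. of_real (indicator A x * 1) * iexp (t * v x))"
        using IH[OF tv[of t]] by (simp add: I_def)
    qed (auto simp: indicator_def)
    \<comment> \<open>The function f will be cos w or sin w, with a and b from Euler's formula.
      Multiplication by iexp(t v) spreads 1 + f over the exponentials of t v, t v + w and t v - w,
      whose integrals over A are already known to agree.\<close>
    have split: "(CLINT x|S. of_real (indicator A x * (1 + f x)) * iexp (t * v x)) =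
         I S A (\<lambda>x. t * v x) + a * I S A (\<lambda>x. t * v x + w x) + b * I S A (\<lambda>x. t * v x - w x)"
      if S: "S = P \<or> S = Q" and f: "\<And>x. of_real (f x) = a * iexp (w x) + b * iexp (- w x)" for S t f a b
    proof -
      have i: "integrable S (\<lambda>x. of_real (indicator A x) * iexp (u x))" if "u \<in> V" for u
        using S bnd[of "\<lambda>x. of_real (indicator A x) * iexp (u x)" 1] meas[OF that] by (auto simp: norm_mult indicator_def)
      have "(CLINT x|S. of_real (indicator A x * (1 + f x)) * iexp (t * v x)) =
        (CLINT x|S. of_real (indicator A x) * iexp (t * v x) + a * (of_real (indicator A x) * iexp (t * v x + w x))
            + b * (of_real (indicator A x) * iexp (t * v x - w x)))"
      proof (intro Bochner_Integration.integral_cong refl)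
        fix x
        have e1: "iexp (t * v x + w x) = iexp (t * v x) * iexp (w x)"
          and e2: "iexp (t * v x - w x) = iexp (t * v x) * iexp (- w x)"
          by (simp_all add: distrib_left right_diff_distrib flip: exp_add)
        show "of_real (indicator A x * (1 + f x)) * iexp (t * v x) =
          of_real (indicator A x) * iexp (t * v x) + a * (of_real (indicator A x) * iexp (t * v x + w x))
            + b * (of_real (indicator A x) * iexp (t * v x - w x))"
        proof -
          have e3: "complex_of_real (indicator A x * (1 + f x))
              = of_real (indicator A x) * (1 + (a * iexp (w x) + b * iexp (- w x)))"
            by (simp add: f)
          have *: "i * (1 + (a * p + b * q)) * r = i * r + a * (i * (r * p)) + b * (i * (r * q))"
            for i p q r :: complex by (simp add: algebra_simps)
          show ?thesis unfolding e1 e2 e3 by (rule *)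
        qed
      qed
      also have "\<dots> = I S A (\<lambda>x. t * v x) + a * I S A (\<lambda>x. t * v x + w x) + b * I S A (\<lambda>x. t * v x - w x)"
        unfolding I_def using i[OF tv[of t]] i[OF tp[of t]] i[OF tm[of t]] by simp
      finally show ?thesis .
    qed
    have trig: "Z P (\<lambda>x. 1 + f x) = Z Q (\<lambda>x. 1 + f x)"
      if f: "\<And>x. of_real (f x) = a * iexp (w x) + b * iexp (- w x)" and f1: "\<And>x. \<bar>f x\<bar> \<le> 1"
        and fm: "f \<in> borel_measurable P" for f a b
      unfolding Z_def
    proof (rule weighted_char_eqD[OF P Q sets_eq meas[OF v] _ _ _ _ B, where C=2])
      fix x
      have "-1 \<le> f x" "f x \<le> 1" using f1[of x] by auto
      then show "0 \<le> indicator A x * (1 + f x)" "indicator A x * (1 + f x) \<le> 2"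
        by (auto simp: indicator_def)
    next
      fix t
      show "(CLINT x|P. of_real (indicator A x * (1 + f x)) * iexp (t * v x)) = (CLINT x|Q. of_real (indicator A x * (1 + f x)) * iexp (t * v x))"
        using split[OF _ f, of P t] split[OF _ f, of Q t] IH[OF tv[of t]] IH[OF tp[of t]] IH[OF tm[of t]] by simp
    qed (use fm in measurable)
    \<comment> \<open>Weights have to be nonnegative, hence 1 + f instead of f; the surplus weight 1
      is subtracted again by the fact labelled \<open>0\<close>.\<close>
    have sub: "Z P f = Z Q f" if "Z P (\<lambda>x. 1 + f x) = Z Q (\<lambda>x. 1 + f x)"
      and f1: "\<And>x. \<bar>f x\<bar> \<le> 1" and fm[measurable]: "f \<in> borel_measurable P" for f
    proof -
      have fq[measurable]: "f \<in> borel_measurable Q" using fm sets_eq measurable_cong_sets by blast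
      have "Z S (\<lambda>x. 1 + f x) = Z S (\<lambda>x. 1) + Z S f" if S: "S = P \<or> S = Q" for S
      proof -
        have "integrable S (\<lambda>x. indicator A x * f x * indicator B (v x))"
          using S bndr[of "\<lambda>x. indicator A x * f x * indicator B (v x)" 1] f1 by (auto simp: abs_mult indicator_def)
        moreover have "integrable S (\<lambda>x. indicator A x * indicator B (v x) :: real)"
          using S bndr[of "\<lambda>x. indicator A x * indicator B (v x) :: real" 1] by (auto simp: abs_mult indicator_def)
        ultimately show ?thesis unfolding Z_def by (simp add: algebra_simps)
      qed
      then show ?thesis using that(1) 0 by simp
    qed
    have cos: "Z P (\<lambda>x. cos (w x)) = Z Q (\<lambda>x. cos (w x))"
    proof (rule sub, rule trig[of "\<lambda>x. cos (w x)" "1/2" "1/2"])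
      fix x show "complex_of_real (cos (w x)) = 1 / 2 * iexp (w x) + 1 / 2 * iexp (- w x)"
        by (simp add: complex_eq_iff Re_exp Im_exp)
    qed auto
    have sin: "Z P (\<lambda>x. sin (w x)) = Z Q (\<lambda>x. sin (w x))"
    proof (rule sub, rule trig[of "\<lambda>x. sin (w x)" "-\<i>/2" "\<i>/2"])
      fix x show "complex_of_real (sin (w x)) = -\<i>/2 * iexp (w x) + \<i>/2 * iexp (- w x)"
        by (simp add: complex_eq_iff Re_exp Im_exp)
    qed auto
    have Z: "I S (A \<inter> (v -` B \<inter> space P)) w = of_real (Z S (\<lambda>x. cos (w x))) + \<i> * of_real (Z S (\<lambda>x. sin (w x)))"
      if S: "S = P \<or> S = Q" for S
    proof -
      have i: "integrable S (\<lambda>x. indicator A x * f (w x) * indicator B (v x))" if "f = cos \<or> f = sin" for f :: "real \<Rightarrow> real"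
      proof -
        have fm: "f \<in> borel_measurable borel"
          using that by auto
        have fmw: "(\<lambda>x. f (w x)) \<in> borel_measurable P"
          using measurable_compose[OF meas[OF w] fm] .
        have "\<bar>f y\<bar> \<le> 1" for y using that by auto
        then have "norm (indicator A x * f (w x) * indicator B (v x) :: real) \<le> 1" for x
          by (simp add: abs_mult indicator_def)
        then show ?thesis
          using S bndr[of "\<lambda>x. indicator A x * f (w x) * indicator B (v x)" 1] fmw by fastforce
      qed
      have "I S (A \<inter> (v -` B \<inter> space P)) w = (CLINT x|S. of_real (indicator A x * cos (w x) * indicator B (v x))
            + \<i> * of_real (indicator A x * sin (w x) * indicator B (v x)))"
        unfolding I_def
      proof (intro Bochner_Integration.integral_cong refl)
        fix x assume "x \<in> space S"
        then have x: "x \<in> space P" using S space_eq by auto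
        have e: "iexp (w x) = of_real (cos (w x)) + \<i> * of_real (sin (w x))"
          by (simp add: complex_eq_iff Re_exp Im_exp)
        show "of_real (indicator (A \<inter> (v -` B \<inter> space P)) x) * iexp (w x) =
            of_real (indicator A x * cos (w x) * indicator B (v x))
            + \<i> * of_real (indicator A x * sin (w x) * indicator B (v x))"
          unfolding e using x by (simp add: indicator_def)
      qed
      also have "\<dots> = of_real (Z S (\<lambda>x. cos (w x))) + \<i> * of_real (Z S (\<lambda>x. sin (w x)))"
        unfolding Z_def using i[of cos] i[of sin] by (subst Bochner_Integration.integral_add) (auto simp del: of_real_mult)
      finally show ?thesis .
    qed
    show "I P (A \<inter> (v -` B \<inter> space P)) w = I Q (A \<inter> (v -` B \<inter> space P)) w"
      using Z[of P] Z[of Q] cos sin by simp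
  qed
  \<comment> \<open>Lists encode the finitely many conditions of a cylinder set. The cut with
    \<open>space P\<close> matters for the empty list, whose intersection is the whole type; it
    makes \<open>space P\<close> itself a member of E.\<close>
  define E where "E = {A \<inter> space P | A. \<exists>xs. A = \<Inter>((\<lambda>(v, B). v -` B \<inter> space P) ` set xs) \<and> set xs \<subseteq> V \<times> sets borel}"
  have claim: "A \<inter> space P \<in> sets P \<and> (\<forall>w\<in>V. I P (A \<inter> space P) w = I Q (A \<inter> space P) w)"
    if "A = \<Inter>((\<lambda>(v, B). v -` B \<inter> space P) ` set xs)" "set xs \<subseteq> V \<times> sets borel" for A xs
    using that
  proof (induction xs arbitrary: A)
    case Nil
    have "I P (space P) w = I Q (space P) w" if "w \<in> V" for w
    proof -
      have "I P (space P) w = (CLINT x|P. iexp (w x))" "I Q (space P) w = (CLINT x|Q. iexp (w x))"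
        unfolding I_def by (auto intro!: Bochner_Integration.integral_cong simp: space_eq)
      then show ?thesis using char[OF that] by simp
    qed
    then show ?case using Nil by simp
  next
    case (Cons a xs)
    obtain v B where a: "a = (v, B)" by (cases a)
    have vB: "v \<in> V" "B \<in> sets borel" using Cons(3) a by auto
    define A' where "A' = \<Inter>((\<lambda>(v, B). v -` B \<inter> space P) ` set xs)"
    have IH: "A' \<inter> space P \<in> sets P" "\<And>w. w \<in> V \<Longrightarrow> I P (A' \<inter> space P) w = I Q (A' \<inter> space P) w"
      using Cons(1)[OF A'_def] Cons(3) by auto
    have eq: "A \<inter> space P = (A' \<inter> space P) \<inter> (v -` B \<inter> space P)"
      using Cons(2) by (auto simp: a A'_def)
    have "v -` B \<inter> space P \<in> sets P" using meas[OF vB(1)] vB(2) by (rule measurable_sets)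
    then show ?case unfolding eq using step[OF IH vB] IH(1) by blast
  qed
  have em: "emeasure P X = emeasure Q X" if XE: "X \<in> E" for X
  proof -
    obtain A xs where X: "X = A \<inter> space P" "A = \<Inter>((\<lambda>(v, B). v -` B \<inter> space P) ` set xs)" "set xs \<subseteq> V \<times> sets borel"
      using XE unfolding E_def by blast
    note cl = claim[OF X(2,3), folded X(1)]
    have XP: "X \<in> sets P" and eq: "I P X (\<lambda>_. 0) = I Q X (\<lambda>_. 0)"
      using cl by (blast, blast intro: zero bspec)
    have XQ: "X \<in> sets Q" using XP sets_eq by simp
    have "complex_of_real (measure P X) = of_real (measure Q X)"
    proof -
      have "I S X (\<lambda>_. 0) = of_real (measure S X)" if "X \<in> sets S" for S
        unfolding I_def using sets.sets_into_space[OF that] by (simp add: Int_absorb2)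
      from this[OF XP] this[OF XQ] eq show ?thesis by (simp only:)
    qed
    then have "measure P X = measure Q X" by (simp only: of_real_eq_iff)
    then show ?thesis by (simp add: P.emeasure_eq_measure Q.emeasure_eq_measure)
  qed
  show "P = Q"
  proof (rule measure_eqI_generator_eq[where E=E and \<Omega>="space P" and A="\<lambda>_. space P"])
    show "Int_stable E"
    proof (rule Int_stableI)
      fix a b assume "a \<in> E" "b \<in> E"
      then obtain xs ys where "a = \<Inter>((\<lambda>(v, B). v -` B \<inter> space P) ` set xs) \<inter> space P" "set xs \<subseteq> V \<times> sets borel"
        "b = \<Inter>((\<lambda>(v, B). v -` B \<inter> space P) ` set ys) \<inter> space P" "set ys \<subseteq> V \<times> sets borel"
        unfolding E_def by blast
      then have "a \<inter> b = \<Inter>((\<lambda>(v, B). v -` B \<inter> space P) ` set (xs @ ys)) \<inter> space P \<and> set (xs @ ys) \<subseteq> V \<times> sets borel"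
        by auto
      then show "a \<inter> b \<in> E" unfolding E_def by blast
    qed
    show "E \<subseteq> Pow (space P)" by (auto simp: E_def)
    have Esets: "E \<subseteq> sets P" using claim unfolding E_def by blast
    have "{v -` B \<inter> space P | v B. v \<in> V \<and> B \<in> sets borel} \<subseteq> E"
    proof clarify
      fix v and B :: "real set" assume "v \<in> V" "B \<in> sets borel"
      then have "v -` B \<inter> space P = \<Inter>((\<lambda>(v, B). v -` B \<inter> space P) ` set [(v, B)]) \<inter> space P"
        "set [(v, B)] \<subseteq> V \<times> sets borel" by auto
      then show "v -` B \<inter> space P \<in> E" unfolding E_def by blast
    qed
    then have "sets P \<subseteq> sigma_sets (space P) E" by (subst gen) (rule sigma_sets_mono')
    moreover have "sigma_sets (space P) E \<subseteq> sets P" using Esets by (rule sets.sigma_sets_subset)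
    ultimately show "sets P = sigma_sets (space P) E" by blast
    then show "sets Q = sigma_sets (space P) E" using sets_eq by simp
    show "emeasure P X = emeasure Q X" if "X \<in> E" for X using that by (rule em)
    have "space P = \<Inter>((\<lambda>(v, B). v -` B \<inter> space P) ` set []) \<inter> space P" "set [] \<subseteq> V \<times> sets borel" by auto
    then have "space P \<in> E" unfolding E_def by blast
    then show "range (\<lambda>_. space P) \<subseteq> E" by auto
  qed auto
qed

section \<open>Separability of the space $L^2(D,\lambda)$\<close>

lemma L2_rel_refl_iff: "L2_rel f f \<longleftrightarrow> square_integrable_D f"
  by (auto simp: L2_rel_def)

lemma L2_of_cases: obtains f where "square_integrable_D f" "F = L2_of f"
proof (induct F rule: L2D.abs_induct)
  case (1 y)
  from 1(1)[unfolded L2_rel_refl_iff] 1(2)[of y] show ?case by (simp add: L2_of_def)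
qed

lemma L2_of_eqI:
  assumes "square_integrable_D f" "square_integrable_D g" "AE x in leb_D. f x = g x"
  shows "L2_of f = L2_of g"
  using Quotient_rel_abs[OF Quotient_L2D] assms by (simp add: L2_of_def L2_rel_def)

lemma inner_L2_of:
  assumes "square_integrable_D f" "square_integrable_D g"
  shows "inner (L2_of f) (L2_of g) = (LINT x|leb_D. f x * g x)"
  using assms by (simp add: L2_of_def inner_L2D.abs_eq L2_rel_refl_iff)

lemma L2_of_add:
  assumes "square_integrable_D f" "square_integrable_D g"
  shows "L2_of (\<lambda>x. f x + g x) = L2_of f + L2_of g"
  using assms square_integrable_D_add[OF assms] by (simp add: L2_of_def plus_L2D.abs_eq L2_rel_refl_iff)

lemma L2_of_scale:
  assumes "square_integrable_D f"
  shows "L2_of (\<lambda>x. r * f x) = r *\<^sub>R L2_of f"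
  using assms square_integrable_D_scale[OF assms] by (simp add: L2_of_def scaleR_L2D.abs_eq L2_rel_refl_iff)

lemma L2_of_zero: "L2_of (\<lambda>_. 0) = 0"
  by (simp add: L2_of_def zero_L2D.abs_eq square_integrable_D_zero)

lemma square_integrable_D_diff:
  assumes "square_integrable_D f" "square_integrable_D g"
  shows "square_integrable_D (\<lambda>x. f x - g x)"
  using square_integrable_D_add[OF assms(1) square_integrable_D_scale[OF assms(2), of "-1"]] by simp

lemma L2_of_diff:
  assumes "square_integrable_D f" "square_integrable_D g"
  shows "L2_of (\<lambda>x. f x - g x) = L2_of f - L2_of g"
  using L2_of_add[OF assms(1) square_integrable_D_scale[OF assms(2), of "-1"]]
    L2_of_scale[OF assms(2), of "-1"] by simp

lemma norm_L2_of: "square_integrable_D f \<Longrightarrow> (norm (L2_of f))\<^sup>2 = (LINT x|leb_D. (f x)\<^sup>2)"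
  by (simp only: power2_norm_eq_inner inner_L2_of) (simp add: power2_eq_square)

lemma square_integrable_D_sum:
  "finite I \<Longrightarrow> (\<And>i. i \<in> I \<Longrightarrow> square_integrable_D (f i)) \<Longrightarrow>
    square_integrable_D (\<lambda>x. \<Sum>i\<in>I. f i x) \<and> L2_of (\<lambda>x. \<Sum>i\<in>I. f i x) = (\<Sum>i\<in>I. L2_of (f i))"
  by (induct I rule: finite_induct)
    (auto simp: square_integrable_D_zero L2_of_zero square_integrable_D_add L2_of_add)

lemma square_integrable_D_bound:
  assumes g: "square_integrable_D g" and f: "f \<in> borel_measurable leb_D"
    and le: "AE x in leb_D. \<bar>f x\<bar> \<le> \<bar>g x\<bar>"
  shows "square_integrable_D f"
  unfolding square_integrable_D_def
proof
  show "integrable leb_D (\<lambda>x. (f x)\<^sup>2)"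
  proof (rule Bochner_Integration.integrable_bound)
    show "integrable leb_D (\<lambda>x. (g x)\<^sup>2)" using g by (simp add: square_integrable_D_def)
    show "AE x in leb_D. norm ((f x)\<^sup>2) \<le> norm ((g x)\<^sup>2)"
      using le by eventually_elim (simp add: abs_le_square_iff)
  qed (use f in measurable)
qed fact

lemma space_leb_D [simp]: "space leb_D = {0<..}"
  by (simp add: leb_D_def space_restrict_space)

lemma measurable_leb_D: "f \<in> borel_measurable borel \<Longrightarrow> f \<in> borel_measurable leb_D"
  by (simp add: leb_D_def measurable_restrict_space1)

lemma borel_measurable_extend_leb_D:
  assumes "f \<in> borel_measurable leb_D"
  shows "(\<lambda>x. indicator {0<..} x * f x :: real) \<in> borel_measurable borel"
  using assms borel_measurable_restrict_space_iff[of "{0<..}" lborel f] by (simp add: leb_D_def)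

text \<open>Since s_i and f are both bounded by |g| almost everywhere, (s_i - f)^2 is dominated by 4
  g^2. Every passage from pointwise to norm convergence in the density proof is an instance of
  this.\<close>

lemma tendsto_L2_of_dominated:
  assumes g: "square_integrable_D g" and s: "\<And>i. s i \<in> borel_measurable leb_D"
    and f: "f \<in> borel_measurable leb_D"
    and lim: "AE x in leb_D. (\<lambda>i. s i x) \<longlonglongrightarrow> f x"
    and bound: "\<And>i. AE x in leb_D. \<bar>s i x\<bar> \<le> \<bar>g x\<bar>"
  shows "(\<lambda>i. L2_of (s i)) \<longlonglongrightarrow> L2_of f" and "square_integrable_D f"
proof -
  have sq_s: "square_integrable_D (s i)" for i
    using square_integrable_D_bound[OF g s bound] .
  have "AE x in leb_D. \<forall>i. \<bar>s i x\<bar> \<le> \<bar>g x\<bar>" using bound by (simp add: AE_all_countable)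
  with lim have "AE x in leb_D. \<bar>f x\<bar> \<le> \<bar>g x\<bar>"
  proof eventually_elim
    case (elim x)
    have "(\<lambda>i. \<bar>s i x\<bar>) \<longlonglongrightarrow> \<bar>f x\<bar>" using elim(1) by (rule tendsto_rabs)
    then show ?case using elim(2) by (intro LIMSEQ_le_const2) auto
  qed
  then show sq_f: "square_integrable_D f"
    using square_integrable_D_bound[OF g f] by blast
  have [measurable]: "g \<in> borel_measurable leb_D" using g by (simp add: square_integrable_D_def)
  note [measurable] = s f
  have "(\<lambda>i. LINT x|leb_D. (s i x - f x)\<^sup>2) \<longlonglongrightarrow> (LINT x|leb_D. (0::real))"
  proof (rule integral_dominated_convergence[where w="\<lambda>x. 4 * (g x)\<^sup>2"])
    show "integrable leb_D (\<lambda>x. 4 * (g x)\<^sup>2)" using g by (simp add: square_integrable_D_def)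
    show "AE x in leb_D. (\<lambda>i. (s i x - f x)\<^sup>2) \<longlonglongrightarrow> 0"
      using lim
    proof eventually_elim
      case (elim x)
      have "(\<lambda>i. (s i x - f x)\<^sup>2) \<longlonglongrightarrow> (f x - f x)\<^sup>2"
        by (intro tendsto_intros elim)
      then show ?case by simp
    qed
    show "AE x in leb_D. norm ((s i x - f x)\<^sup>2) \<le> 4 * (g x)\<^sup>2" for i
      using bound[of i] \<open>AE x in leb_D. \<bar>f x\<bar> \<le> \<bar>g x\<bar>\<close>
    proof eventually_elim
      case (elim x)
      have "\<bar>s i x - f x\<bar> \<le> 2 * \<bar>g x\<bar>" using elim by linarith
      then have "\<bar>s i x - f x\<bar>\<^sup>2 \<le> (2 * \<bar>g x\<bar>)\<^sup>2" by (intro power_mono) auto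
      then show ?case by (simp add: power_mult_distrib)
    qed
  qed auto
  then have "(\<lambda>i. (norm (L2_of (s i) - L2_of f))\<^sup>2) \<longlonglongrightarrow> 0"
    by (simp add: norm_L2_of[OF square_integrable_D_diff[OF sq_s sq_f], symmetric] L2_of_diff[OF sq_s sq_f])
  then have "(\<lambda>i. sqrt ((norm (L2_of (s i) - L2_of f))\<^sup>2)) \<longlonglongrightarrow> sqrt 0"
    by (rule tendsto_real_sqrt)
  then show "(\<lambda>i. L2_of (s i)) \<longlonglongrightarrow> L2_of f"
    by (simp add: LIM_zero_iff tendsto_norm_zero_iff)
qed

section \<open>Density of rational step functions\<close>

text \<open>As the range of a map on lists of pairs of rationals, the set is countable by the type
  of its index alone, and addition becomes appending of lists. Intervals may all start at 0 because
  differences of such indicators produce the other bounded half-open intervals; a negative endpoint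
  contributes the zero class.\<close>

definition rat_steps :: "L2D set" where
  "rat_steps = range (\<lambda>xs. \<Sum>(q, b)\<leftarrow>xs. of_rat q *\<^sub>R L2_of (indicator {0..of_rat b}))"

lemma countable_rat_steps: "countable rat_steps"
  unfolding rat_steps_def by simp

lemma square_integrable_D_indicator:
  assumes "A \<in> sets borel" "emeasure lborel A < \<infinity>"
  shows "square_integrable_D (indicator A)"
proof -
  have "integrable lborel (indicator A :: real \<Rightarrow> real)"
    using assms by (intro integrable_real_indicator) auto
  then have "integrable leb_D (indicator A :: real \<Rightarrow> real)"
    unfolding leb_D_def by (subst integrable_restrict_space) (auto dest: integrable_mult_indicator[of "{0<..}", rotated])
  moreover have "(\<lambda>x. (indicator A x)\<^sup>2) = (indicator A :: real \<Rightarrow> real)"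
    by (auto simp: indicator_def fun_eq_iff)
  ultimately show ?thesis
    using assms by (simp add: square_integrable_D_def measurable_leb_D)
qed

lemma closure_rat_steps_add:
  assumes "a \<in> closure rat_steps" "b \<in> closure rat_steps"
  shows "a + b \<in> closure rat_steps"
proof -
  have C: "x + y \<in> rat_steps" if xy: "x \<in> rat_steps" "y \<in> rat_steps" for x y
  proof -
    let ?g = "\<lambda>xs. \<Sum>(q, b)\<leftarrow>xs. of_rat q *\<^sub>R L2_of (indicator {0..of_rat b})"
    obtain xs ys where "x = ?g xs" "y = ?g ys"
      using xy unfolding rat_steps_def by blast
    then have "x + y = ?g (xs @ ys)" by simp
    then show ?thesis unfolding rat_steps_def by blast
  qed
  obtain u v where u: "\<And>n. u n \<in> rat_steps" "u \<longlonglongrightarrow> a" and v: "\<And>n. v n \<in> rat_steps" "v \<longlonglongrightarrow> b"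
    using assms unfolding closure_sequential by blast
  have "(\<lambda>n. u n + v n) \<longlonglongrightarrow> a + b" using u v by (intro tendsto_add)
  then show ?thesis unfolding closure_sequential
    using C[OF u(1) v(1)] by (intro exI[of _ "\<lambda>n. u n + v n"]) auto
qed

text \<open>\<open>rat_steps\<close> itself is stable under rational scalars only. A real r is the
  limit of rationals squeezed between r and r + 1/(n+1), and scalar multiplication is jointly
  continuous.\<close>

lemma closure_rat_steps_scale:
  assumes "a \<in> closure rat_steps"
  shows "r *\<^sub>R a \<in> closure rat_steps"
proof -
  have C: "of_rat q *\<^sub>R x \<in> rat_steps" if x: "x \<in> rat_steps" for x q
  proof -
    let ?g = "\<lambda>xs. \<Sum>(q, b)\<leftarrow>xs. of_rat q *\<^sub>R L2_of (indicator {0..of_rat b})"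
    obtain xs where "x = ?g xs"
      using x unfolding rat_steps_def by blast
    moreover have "of_rat q *\<^sub>R ?g xs = ?g (map (\<lambda>(p, b). (q * p, b)) xs)" for xs
      by (induct xs) (auto simp: scaleR_add_right of_rat_mult)
    ultimately have "of_rat q *\<^sub>R x = ?g (map (\<lambda>(p, b). (q * p, b)) xs)" by simp
    then show ?thesis unfolding rat_steps_def by blast
  qed
  obtain u where u: "\<And>n. u n \<in> rat_steps" "u \<longlonglongrightarrow> a"
    using assms unfolding closure_sequential by blast
  have "\<exists>q. r < of_rat q \<and> of_rat q < r + 1 / real (Suc n)" for n
    using of_rat_dense[of r "r + 1 / real (Suc n)"] by simp
  then obtain q where q: "\<And>n. r < of_rat (q n)" "\<And>n. of_rat (q n) < r + 1 / real (Suc n)"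
    by metis
  have "(\<lambda>n. of_rat (q n)) \<longlonglongrightarrow> r"
  proof (rule tendsto_sandwich[OF _ _ tendsto_const])
    show "(\<lambda>n. r + 1 / real (Suc n)) \<longlonglongrightarrow> r"
      using tendsto_add[OF tendsto_const LIMSEQ_inverse_real_of_nat, of r] by (simp add: divide_inverse)
  qed (use q in \<open>auto intro!: always_eventually less_imp_le\<close>)
  then have "(\<lambda>n. of_rat (q n) *\<^sub>R u n) \<longlonglongrightarrow> r *\<^sub>R a" using u by (intro tendsto_scaleR)
  then show ?thesis unfolding closure_sequential
    using C[OF u(1)] by (intro exI[of _ "\<lambda>n. of_rat (q n) *\<^sub>R u n"]) auto
qed

lemma closure_rat_steps_lim:
  assumes "\<And>i::nat. s i \<in> closure rat_steps" "s \<longlonglongrightarrow> a"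
  shows "a \<in> closure rat_steps"
  using closed_sequentially[OF closed_closure assms] .

lemma closure_rat_steps_zero: "0 \<in> closure rat_steps"
proof -
  have "0 \<in> rat_steps" unfolding rat_steps_def by (rule image_eqI[of _ _ "[]"]) auto
  then show ?thesis using closure_subset by blast
qed

lemma closure_rat_steps_sum:
  "finite I \<Longrightarrow> (\<And>i. i \<in> I \<Longrightarrow> s i \<in> closure rat_steps) \<Longrightarrow> (\<Sum>i\<in>I. s i) \<in> closure rat_steps"
  by (induct I rule: finite_induct) (auto intro: closure_rat_steps_zero closure_rat_steps_add)

text \<open>Rational endpoints approach r strictly from above, so that the indicators converge at x
  = r as well; staying below r + 1, they are all dominated by the indicator of [0, r+1].\<close>

lemma closure_rat_steps_indicator_atMost: "L2_of (indicator {0..r}) \<in> closure rat_steps"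
proof -
  have "\<exists>q. r < of_rat q \<and> of_rat q < r + 1 / real (Suc n)" for n
    using of_rat_dense[of r "r + 1 / real (Suc n)"] by simp
  then obtain q where q: "\<And>n. r < of_rat (q n)" "\<And>n. of_rat (q n) < r + 1 / real (Suc n)"
    by metis
  have "(\<lambda>n. L2_of (indicator {0..of_rat (q n)})) \<longlonglongrightarrow> L2_of (indicator {0..r})"
  proof (rule tendsto_L2_of_dominated(1)[where g="indicator {0..r+1}"])
    show "square_integrable_D (indicator {0..r+1})"
      by (rule square_integrable_D_indicator) (auto simp: emeasure_lborel_Icc_eq)
    show "AE x in leb_D. (\<lambda>n. indicator {0..of_rat (q n)} x :: real) \<longlonglongrightarrow> indicator {0..r} x"
    proof (rule AE_I2)
      fix x
      show "(\<lambda>n. indicator {0..of_rat (q n)} x :: real) \<longlonglongrightarrow> indicator {0..r} x"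
      proof (cases "x \<le> r")
        case True
        then have "x \<le> of_rat (q n)" for n using q(1)[of n] by simp
        then show ?thesis using True by (simp add: indicator_def)
      next
        case False
        then have "eventually (\<lambda>n. 1 / real (Suc n) < x - r) sequentially"
          using order_tendstoD(2)[OF LIMSEQ_inverse_real_of_nat, of "x - r"] by (simp add: divide_inverse)
        then have "eventually (\<lambda>n. indicator {0..of_rat (q n)} x = (0::real)) sequentially"
        proof eventually_elim
          case (elim n)
          then show ?case using q(2)[of n] by (simp add: indicator_def)
        qed
        then have "(\<lambda>n. indicator {0..of_rat (q n)} x :: real) \<longlonglongrightarrow> 0" by (rule tendsto_eventually)
        then show ?thesis using False by simp
      qed
    qed
    show "AE x in leb_D. \<bar>indicator {0..of_rat (q n)} x\<bar> \<le> \<bar>indicator {0..r+1} x :: real\<bar>" for n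
    proof (rule AE_I2)
      fix x
      have "1 / real (Suc n) \<le> 1" by simp
      then have "of_rat (q n) \<le> r + 1" using q(2)[of n] by linarith
      then show "\<bar>indicator {0..of_rat (q n)} x\<bar> \<le> \<bar>indicator {0..r+1} x :: real\<bar>"
        by (auto simp: indicator_def)
    qed
  qed (auto intro!: measurable_leb_D)
  moreover have "L2_of (indicator {0..of_rat q}) \<in> closure rat_steps" for q
  proof -
    have "L2_of (indicator {0..of_rat q}) \<in> rat_steps"
      unfolding rat_steps_def by (rule image_eqI[of _ _ "[(1, q)]"]) auto
    then show ?thesis using closure_subset by blast
  qed
  then have "\<And>n. L2_of (indicator {0..of_rat (q n)}) \<in> closure rat_steps" .
  ultimately show ?thesis using closure_rat_steps_lim[of "\<lambda>n. L2_of (indicator {0..of_rat (q n)})"] by simp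
qed

lemma square_integrable_D_indicator_bounded:
  assumes "A \<in> sets borel"
  shows "square_integrable_D (indicator (A \<inter> {0..r}))"
proof (rule square_integrable_D_indicator)
  have "emeasure lborel (A \<inter> {0..r}) \<le> emeasure lborel {0..r}" by (rule emeasure_mono) auto
  also have "\<dots> < \<infinity>" by (simp add: emeasure_lborel_Icc_eq)
  finally show "emeasure lborel (A \<inter> {0..r}) < \<infinity>" .
qed (use assms in auto)

text \<open>Dynkin's argument, started from the intersection-stable half-lines. The cut with [0, r]
  keeps every set at finite measure, so that complements turn into differences inside L2 and
  disjoint unions into dominated limits.\<close>

lemma closure_rat_steps_indicator:
  assumes "A \<in> sets borel"
  shows "L2_of (indicator (A \<inter> {0..r})) \<in> closure rat_steps"
proof -
  have "A \<in> sigma_sets UNIV (range (\<lambda>a::real. {..a}))"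
    using assms by (subst (asm) borel_eq_atMost) simp
  with _ _ show ?thesis
  proof (induct rule: sigma_sets_induct_disjoint)
    show "Int_stable (range (\<lambda>a::real. {..a}))"
      by (auto intro!: Int_stableI exI[of _ "min _ _"] simp: min_def)
    show "L2_of (indicator (A \<inter> {0..r})) \<in> closure rat_steps" if AG: "A \<in> range (\<lambda>a::real. {..a})" for A
    proof -
      obtain a where "A = {..a}" using AG by auto
      then have "A \<inter> {0..r} = {0..min a r}" by auto
      then show ?thesis using closure_rat_steps_indicator_atMost by simp
    qed
    show "L2_of (indicator ({} \<inter> {0..r})) \<in> closure rat_steps"
    proof -
      have "indicator ({} \<inter> {0..r}) = (\<lambda>_. 0 :: real)" by (simp add: fun_eq_iff)
      then show ?thesis using closure_rat_steps_zero by (simp add: L2_of_zero)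
    qed
  next
    fix A assume A: "A \<in> sigma_sets UNIV (range (\<lambda>a::real. {..a}))" "L2_of (indicator (A \<inter> {0..r})) \<in> closure rat_steps"
    then have "A \<in> sets borel" by (subst borel_eq_atMost) simp
    note sq = square_integrable_D_indicator_bounded[OF this] square_integrable_D_indicator_bounded[of UNIV r]
    have "L2_of (indicator ((UNIV - A) \<inter> {0..r})) = L2_of (\<lambda>x. indicator (UNIV \<inter> {0..r}) x + (-1) * indicator (A \<inter> {0..r}) x)"
      by (rule arg_cong[of _ _ L2_of]) (auto simp: indicator_def fun_eq_iff)
    also have "\<dots> = L2_of (indicator {0..r}) + (-1) *\<^sub>R L2_of (indicator (A \<inter> {0..r}))"
      using sq(2) L2_of_scale[OF sq(1), of "-1"] L2_of_add[OF sq(2) square_integrable_D_scale[OF sq(1), of "-1" r]] by simp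
    also have "\<dots> \<in> closure rat_steps"
      by (intro closure_rat_steps_add closure_rat_steps_scale closure_rat_steps_indicator_atMost A)
    finally show "L2_of (indicator ((UNIV - A) \<inter> {0..r})) \<in> closure rat_steps" .
  next
    fix A :: "nat \<Rightarrow> real set"
    assume A: "disjoint_family A" "range A \<subseteq> sigma_sets UNIV (range (\<lambda>a::real. {..a}))"
      "\<And>i. L2_of (indicator (A i \<inter> {0..r})) \<in> closure rat_steps"
    have Ab: "A i \<in> sets borel" for i
      using A(2) by (subst borel_eq_atMost) auto
    have "(\<lambda>k. L2_of (\<lambda>x. \<Sum>i<k. indicator (A i \<inter> {0..r}) x)) \<longlonglongrightarrow> L2_of (indicator (\<Union>(range A) \<inter> {0..r}))"
    proof (rule tendsto_L2_of_dominated(1)[where g="indicator (UNIV \<inter> {0..r})"])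
      have disj: "disjoint_family (\<lambda>i. A i \<inter> {0..r})" using A(1) by (auto simp: disjoint_family_on_def)
      have sum: "(\<Sum>i<k. indicator (A i \<inter> {0..r}) x :: real) = indicator (\<Union>i<k. A i \<inter> {0..r}) x" for k x
        using disj by (subst indicator_UN_disjoint) (auto simp: disjoint_family_on_def)
      show "AE x in leb_D. (\<lambda>k. \<Sum>i<k. indicator (A i \<inter> {0..r}) x :: real) \<longlonglongrightarrow> indicator (\<Union>(range A) \<inter> {0..r}) x"
      proof (rule AE_I2)
        fix x
        have "(\<lambda>k. indicator (\<Union>i<k. A i \<inter> {0..r}) x :: real) \<longlonglongrightarrow> indicator (\<Union>i. A i \<inter> {0..r}) x"
          by (rule LIMSEQ_indicator_UN)
        then show "(\<lambda>k. \<Sum>i<k. indicator (A i \<inter> {0..r}) x :: real) \<longlonglongrightarrow> indicator (\<Union>(range A) \<inter> {0..r}) x"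
          by (simp add: sum)
      qed
      show "AE x in leb_D. \<bar>\<Sum>i<k. indicator (A i \<inter> {0..r}) x\<bar> \<le> \<bar>indicator (UNIV \<inter> {0..r}) x :: real\<bar>" for k
        unfolding sum by (rule AE_I2) (auto simp: indicator_def)
    qed (use Ab square_integrable_D_indicator_bounded[of UNIV r] in \<open>auto intro!: measurable_leb_D\<close>)
    moreover have "L2_of (\<lambda>x. \<Sum>i<k. indicator (A i \<inter> {0..r}) x) \<in> closure rat_steps" for k
      using square_integrable_D_sum[of "{..<k}" "\<lambda>i. indicator (A i \<inter> {0..r})"] A(3) Ab
      by (simp add: square_integrable_D_indicator_bounded closure_rat_steps_sum)
    ultimately show "L2_of (indicator (\<Union>(range A) \<inter> {0..r})) \<in> closure rat_steps"
      by (rule closure_rat_steps_lim[rotated])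
  qed auto
qed

lemma closure_rat_steps: "closure rat_steps = UNIV"
proof -
  have "F \<in> closure rat_steps" for F
  proof -
    obtain f where f: "square_integrable_D f" and F: "F = L2_of f" by (rule L2_of_cases)
    define f' where "f' = (\<lambda>x. indicator {0<..} x * f x)"
    have fm: "f \<in> borel_measurable leb_D" using f by (simp add: square_integrable_D_def)
    have f'[measurable]: "f' \<in> borel_measurable borel"
      unfolding f'_def using borel_measurable_extend_leb_D[OF fm] .
    have ff': "f' x = f x" if "0 < x" for x using that by (simp add: f'_def)
    obtain s where s: "\<And>i. simple_function borel (s i)" "\<And>x. (\<lambda>i. s i x) \<longlonglongrightarrow> f' x"
      "\<And>i x. dist (s i x) 0 \<le> 2 * dist (f' x) 0"
      using borel_measurable_implies_sequence_metric[OF f', of 0] by auto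
    have sm[measurable]: "s i \<in> borel_measurable borel" for i
      using s(1) by (rule borel_measurable_simple_function)
    \<comment> \<open>A level set of s_i can have infinite measure, for instance that of the value
      0. The cut-off at i puts each indicator into L2; it disappears in the limit, and the bound by
      2 |f| survives it.\<close>
    define g where "g i x = indicator {0..real i} x * s i x" for i x
    have gm: "g i \<in> borel_measurable leb_D" for i
      unfolding g_def by (rule measurable_leb_D) measurable
    have "(\<lambda>i. L2_of (g i)) \<longlonglongrightarrow> L2_of f"
    proof (rule tendsto_L2_of_dominated(1)[where g="\<lambda>x. 2 * f x"])
      show "AE x in leb_D. (\<lambda>i. g i x) \<longlonglongrightarrow> f x"
      proof (rule AE_I2)
        fix x assume "x \<in> space leb_D"
        then have x: "0 < x" by simp
        have "eventually (\<lambda>i. x \<le> real i) sequentially"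
          using filterlim_real_sequentially by (simp add: filterlim_at_top)
        then have "eventually (\<lambda>i. s i x = g i x) sequentially"
          by eventually_elim (use x in \<open>simp add: g_def\<close>)
        from tendsto_cong[THEN iffD1, OF this] s(2)[of x] ff'[OF x] show "(\<lambda>i. g i x) \<longlonglongrightarrow> f x" by simp
      qed
      show "AE x in leb_D. \<bar>g i x\<bar> \<le> \<bar>2 * f x\<bar>" for i
      proof (rule AE_I2)
        fix x assume "x \<in> space leb_D"
        then have "f' x = f x" using ff' by simp
        then show "\<bar>g i x\<bar> \<le> \<bar>2 * f x\<bar>" using s(3)[of i x] by (simp add: g_def abs_mult indicator_def)
      qed
    qed (use f gm fm square_integrable_D_scale in auto)
    moreover have "L2_of (g i) \<in> closure rat_steps" for i
    proof -
      let ?T = "s i ` UNIV"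
      let ?A = "\<lambda>c. s i -` {c} \<inter> {0..real i}"
      have fin: "finite ?T" using s(1)[of i] by (simp add: simple_function_def)
      have Ab: "s i -` {c} \<in> sets borel" for c
        using measurable_sets[OF sm[of i], of "{c}"] by simp
      note sq = square_integrable_D_indicator_bounded[OF Ab, of _ "real i"]
      have "g i x = (\<Sum>c\<in>?T. c * indicator (?A c) x)" for x
      proof -
        have "(\<Sum>c\<in>?T. c * indicator (?A c) x) = (\<Sum>c\<in>?T. if s i x = c then c * indicator {0..real i} x else 0)"
          by (intro sum.cong refl) (auto simp: indicator_def)
        also have "\<dots> = s i x * indicator {0..real i} x"
          using fin by (simp add: sum.delta)
        finally show ?thesis by (simp add: g_def)
      qed
      then have "L2_of (g i) = L2_of (\<lambda>x. \<Sum>c\<in>?T. c * indicator (?A c) x)" by (intro arg_cong[of _ _ L2_of] ext)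
      also have "\<dots> = (\<Sum>c\<in>?T. L2_of (\<lambda>x. c * indicator (?A c) x))"
        using square_integrable_D_sum[of ?T "\<lambda>c x. c * indicator (?A c) x"] fin square_integrable_D_scale[OF sq] by simp
      also have "\<dots> \<in> closure rat_steps"
        using fin by (intro closure_rat_steps_sum)
          (auto simp: L2_of_scale[OF sq] intro!: closure_rat_steps_scale closure_rat_steps_indicator[OF Ab])
      finally show ?thesis .
    qed
    ultimately show ?thesis unfolding F by (rule closure_rat_steps_lim[rotated])
  qed
  then show ?thesis by auto
qed

text \<open>Balls of radius 1/(n+1) around points of the countable dense set form a base. The
  instance is what makes sums and inner products of measurable maps into the Hilbert space
  measurable.\<close>

instance L2D :: second_countable_topology
proof
  define B where "B = (\<lambda>(c, n). ball c (1 / real (Suc n))) ` (rat_steps \<times> (UNIV :: nat set))"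
  have "countable B" unfolding B_def using countable_rat_steps by auto
  moreover have "topological_basis B"
  proof (rule topological_basisI)
    show "open b" if "b \<in> B" for b using that by (auto simp: B_def)
    fix U :: "L2D set" and x assume "open U" "x \<in> U"
    then obtain e where e: "0 < e" "ball x e \<subseteq> U" using open_contains_ball by blast
    obtain n where n: "1 / real (Suc n) < e / 2" using e(1) nat_approx_posE[of "e/2"] by auto
    have "x \<in> closure rat_steps" by (simp add: closure_rat_steps)
    then obtain c where c: "c \<in> rat_steps" "dist c x < 1 / real (Suc n)"
      unfolding closure_approachable by (meson of_nat_0_less_iff zero_less_Suc zero_less_divide_1_iff)
    have "ball c (1 / real (Suc n)) \<subseteq> ball x e"
    proof
      fix y assume "y \<in> ball c (1 / real (Suc n))"
      then have "dist c y < 1 / real (Suc n)" by simp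
      moreover have "dist x y \<le> dist c x + dist c y" by (metis dist_commute dist_triangle)
      ultimately show "y \<in> ball x e" using c n by simp
    qed
    then show "\<exists>b\<in>B. x \<in> b \<and> b \<subseteq> U"
      using c e by (intro bexI[of _ "ball c (1 / real (Suc n))"]) (auto simp: B_def)
  qed
  ultimately show "\<exists>B::L2D set set. countable B \<and> open = generate_topology B"
    using topological_basis_imp_subbasis by blast
qed

section \<open>Borel measurability tested by inner products\<close>

text \<open>Cauchy-Schwarz in one direction; in the other, a sequence of D tending to y turns the
  inequalities into |y|^2 \<le> r |y|. With a countable D, membership in a closed ball becomes
  countably many scalar conditions.\<close>

lemma norm_le_iff_inner_le:
  fixes y :: "'a :: real_inner"
  assumes D: "closure D = UNIV"
  shows "norm y \<le> r \<longleftrightarrow> (0 \<le> r \<and> (\<forall>d\<in>D. inner y d \<le> r * norm d))"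
proof safe
  assume n: "norm y \<le> r"
  then show "0 \<le> r" using norm_ge_zero order_trans by blast
  fix d
  have "inner y d \<le> norm y * norm d" by (rule norm_cauchy_schwarz)
  also have "\<dots> \<le> r * norm d" using n by (intro mult_right_mono) auto
  finally show "inner y d \<le> r * norm d" .
next
  assume r: "0 \<le> r" and le: "\<forall>d\<in>D. inner y d \<le> r * norm d"
  have "y \<in> closure D" using D by simp
  then obtain u where u: "\<And>n. u n \<in> D" "u \<longlonglongrightarrow> y" unfolding closure_sequential by blast
  have "(\<lambda>n. inner y (u n)) \<longlonglongrightarrow> inner y y" "(\<lambda>n. r * norm (u n)) \<longlonglongrightarrow> r * norm y"
    by (intro tendsto_intros u)+
  then have "inner y y \<le> r * norm y"
    by (rule LIMSEQ_le) (use le u in auto)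
  then have "norm y * norm y \<le> r * norm y" by (simp only: norm_eq_sqrt_inner real_sqrt_mult_self abs_of_nonneg inner_ge_zero)
  then show "norm y \<le> r" using r by (cases "norm y = 0") (auto simp: mult_le_cancel_right)
qed

text \<open>Pettis' theorem for this space: weak measurability implies Borel measurability. An open
  set is a countable union of closed balls with centres in \<open>rat_steps\<close> and rational
  radii, and the preimage of such a ball is described by countably many inner products.\<close>

lemma borel_measurable_L2D:
  fixes X :: "'w \<Rightarrow> L2D"
  assumes X: "\<And>f. (\<lambda>\<omega>. inner (X \<omega>) f) \<in> borel_measurable M"
  shows "X \<in> M \<rightarrow>\<^sub>M borel"
proof (rule borel_measurableI)
  fix U :: "L2D set" assume U: "open U"
  define J where "J = {(c, q). c \<in> rat_steps \<and> q \<in> \<rat> \<and> cball c q \<subseteq> U}"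
  have cJ: "countable J"
    by (rule countable_subset[of _ "rat_steps \<times> \<rat>"]) (auto simp: J_def countable_rat_steps countable_rat)
  have Ueq: "U = (\<Union>(c, q)\<in>J. cball c q)"
  proof safe
    fix x assume "x \<in> U"
    then obtain e where e: "0 < e" "ball x e \<subseteq> U" using U open_contains_ball by blast
    obtain q where q: "q \<in> \<rat>" "0 < q" "q < e / 2" using e Rats_dense_in_real[of 0 "e/2"] by auto
    have "x \<in> closure rat_steps" by (simp add: closure_rat_steps)
    then obtain c where c: "c \<in> rat_steps" "dist c x < q"
      unfolding closure_approachable using q(2) by blast
    have "cball c q \<subseteq> ball x e"
    proof
      fix y assume "y \<in> cball c q"
      then have "dist c y \<le> q" by simp
      moreover have "dist x y \<le> dist c x + dist c y" by (metis dist_commute dist_triangle)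
      ultimately show "y \<in> ball x e" using c q by simp
    qed
    then have "(c, q) \<in> J" using c q e by (auto simp: J_def)
    then show "x \<in> (\<Union>(c, q)\<in>J. cball c q)" using c by (intro UN_I) auto
  next
    fix x c q assume "(c, q) \<in> J" "x \<in> cball c q"
    then show "x \<in> U" by (auto simp: J_def)
  qed
  have ball: "X -` cball c q \<inter> space M \<in> sets M" for c q
  proof -
    have "X -` cball c q \<inter> space M = {\<omega>\<in>space M. norm (X \<omega> - c) \<le> q}"
      by (auto simp: dist_norm norm_minus_commute)
    \<comment> \<open>The conjunct 0 \<le> q covers the negative radii, which J does not exclude:
      for them both sets are empty.\<close>
    also have "\<dots> = {\<omega>\<in>space M. 0 \<le> q \<and> (\<forall>d\<in>rat_steps. inner (X \<omega>) d - inner c d \<le> q * norm d)}"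
      using norm_le_iff_inner_le[OF closure_rat_steps] by (simp add: inner_diff_left)
    also have "\<dots> \<in> sets M"
    proof -
      note [measurable] = X
      show ?thesis using countable_rat_steps by measurable
    qed
    finally show ?thesis .
  qed
  have "X -` (\<Union>(c, q)\<in>J. cball c q) \<inter> space M = (\<Union>p\<in>J. X -` cball (fst p) (snd p) \<inter> space M)"
    by (simp add: vimage_UN Int_UN_distrib2 case_prod_unfold)
  also have "\<dots> \<in> sets M"
  proof (rule sets.countable_UN'[OF cJ])
    show "(\<lambda>p. X -` cball (fst p) (snd p) \<inter> space M) ` J \<subseteq> sets M" using ball by (intro image_subsetI)
  qed
  finally have "X -` (\<Union>(c, q)\<in>J. cball c q) \<inter> space M \<in> sets M" .
  then show "X -` U \<inter> space M \<in> sets M" unfolding Ueq[symmetric] .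
qed

section \<open>Gaussian kernels and the absorbed semigroup\<close>

lemma sigma_finite_leb_D: "sigma_finite_measure leb_D"
  unfolding leb_D_def by (rule sigma_finite_measure_restrict_space) (auto intro: sigma_finite_lborel)

interpretation leb_D: sigma_finite_measure leb_D
  by (rule sigma_finite_leb_D)

interpretation leb_DD: pair_sigma_finite leb_D leb_D ..

lemma measurable_ident_leb_D: "(\<lambda>x. x) \<in> leb_D \<rightarrow>\<^sub>M borel"
  unfolding leb_D_def by (rule measurable_restrict_space1) simp

lemma measurable_pair_leb_D:
  assumes "f \<in> borel_measurable (borel \<Otimes>\<^sub>M borel)"
  shows "f \<in> borel_measurable (leb_D \<Otimes>\<^sub>M leb_D)"
proof -
  have "(\<lambda>p. (fst p, snd p)) \<in> leb_D \<Otimes>\<^sub>M leb_D \<rightarrow>\<^sub>M borel \<Otimes>\<^sub>M borel"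
    by (intro measurable_Pair measurable_compose[OF measurable_fst measurable_ident_leb_D]
        measurable_compose[OF measurable_snd measurable_ident_leb_D])
  from measurable_compose[OF this assms] show ?thesis by simp
qed

lemma nn_integral_leb_D: "(\<integral>\<^sup>+x. f x \<partial>leb_D) = (\<integral>\<^sup>+x. f x * indicator {0<..} x \<partial>lborel)"
  unfolding leb_D_def by (rule nn_integral_restrict_space) simp

lemma nn_integral_leb_D_le: "(\<integral>\<^sup>+x. f x \<partial>leb_D) \<le> (\<integral>\<^sup>+x. f x \<partial>lborel)"
  unfolding nn_integral_leb_D by (rule nn_integral_mono) (simp add: indicator_def)

text \<open>The reflection principle in integral form. The absorbed kernel is a Gaussian at y minus
  a Gaussian at -y, so against an odd function the half-line integral unfolds to a Gaussian integral
  over the whole line, where convolution formulas are available. Only the null point 0 is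
  lost.\<close>

lemma integral_leb_D_fold:
  fixes F :: "real \<Rightarrow> real"
  assumes F: "integrable lborel F"
  shows "(LINT y|leb_D. F y + F (- y)) = (LINT y|lborel. F y)"
proof -
  have [measurable]: "F \<in> borel_measurable borel" using F by auto
  have F': "integrable lborel (\<lambda>y. F (- y))"
    using lborel_integrable_real_affine[OF F, of "-1" 0] by simp
  have i1: "integrable lborel (\<lambda>y. indicator {0<..} y * F y)"
    and i2: "integrable lborel (\<lambda>y. indicator {0<..} y * F (- y))"
    and i3: "integrable lborel (\<lambda>y. indicator {..<0} y * F y)"
    using integrable_mult_indicator[OF _ F] integrable_mult_indicator[OF _ F'] by auto
  have "(LINT y|leb_D. F y + F (- y)) = (LINT y|lborel. indicator {0<..} y * F y + indicator {0<..} y * F (- y))"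
    unfolding leb_D_def by (subst integral_restrict_space) (auto simp: distrib_left)
  also have "\<dots> = (LINT y|lborel. indicator {0<..} y * F y) + (LINT y|lborel. indicator {0<..} y * F (- y))"
    using i1 i2 by simp
  also have "(LINT y|lborel. indicator {0<..} y * F (- y)) = (LINT y|lborel. indicator {..<0} y * F y)"
    using lborel_integral_real_affine[of "-1" "\<lambda>y. indicator {..<0} y * F y" 0]
    by (simp add: indicator_def)
  also have "(LINT y|lborel. indicator {0<..} y * F y) + (LINT y|lborel. indicator {..<0} y * F y)
      = (LINT y|lborel. indicator {0<..} y * F y + indicator {..<0} y * F y)"
    using i1 i3 by simp
  also have "\<dots> = (LINT y|lborel. F y)"
  proof (rule integral_cong_AE)
    have "AE y in lborel. y \<noteq> (0::real)" by (rule AE_lborel_singleton)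
    then show "AE y in lborel. indicator {0<..} y * F y + indicator {..<0} y * F y = F y"
      by eventually_elim (auto simp: indicator_def)
  qed auto
  finally show ?thesis .
qed

lemma gauss_eq_normal_density: "0 < t \<Longrightarrow> gauss t x = normal_density 0 (sqrt t) x"
  by (simp add: gauss_def normal_density_def powr_minus_divide powr_half_sqrt)

lemma gauss_diff_eq_normal_density: "0 < t \<Longrightarrow> gauss t (x - y) = normal_density x (sqrt t) y"
  by (simp add: gauss_eq_normal_density normal_density_def power2_commute)

lemma gauss_minus: "gauss t (- x) = gauss t x"
  by (simp add: gauss_def)

lemma gauss_nonneg: "0 \<le> gauss t x"
  by (simp add: gauss_def)

lemma gauss_le: "0 < t \<Longrightarrow> gauss t x \<le> 1 / sqrt t"
proof -
  assume t: "0 < t"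
  have "gauss t x \<le> (2 * pi * t) powr (- 1 / 2)"
    unfolding gauss_def using t by (intro mult_left_le) auto
  also have "\<dots> = 1 / sqrt (2 * pi * t)"
    using t by (simp add: powr_minus_divide powr_half_sqrt)
  also have "\<dots> \<le> 1 / sqrt t"
    using t pi_ge_two by (intro divide_left_mono real_sqrt_le_mono) auto
  finally show ?thesis .
qed

lemma borel_measurable_gauss [measurable (raw)]:
  assumes [measurable]: "f \<in> borel_measurable M" "g \<in> borel_measurable M"
  shows "(\<lambda>x. gauss (f x) (g x)) \<in> borel_measurable M"
  unfolding gauss_def by measurable

lemma borel_measurable_kfun [measurable (raw)]:
  assumes [measurable]: "f \<in> borel_measurable M" "g \<in> borel_measurable M"
  shows "(\<lambda>x. kfun (f x) (g x)) \<in> borel_measurable M"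
  unfolding kfun_def by measurable

lemma borel_measurable_abs_kernel [measurable (raw)]:
  assumes [measurable]: "f \<in> borel_measurable M" "g \<in> borel_measurable M"
  shows "(\<lambda>x. abs_kernel t (f x) (g x)) \<in> borel_measurable M"
  unfolding abs_kernel_def by measurable

text \<open>Completing the square in y. As a function of y the product is a normal density with mean
  x r/(t+r) and variance t r/(t+r), times a factor free of y; its moments then give the convolution
  of g_t with g_r and with k_r at once.\<close>

lemma gauss_mult_gauss:
  assumes t: "0 < t" and r: "0 < r"
  shows "gauss t (x - y) * gauss r y =
    gauss (t + r) x * normal_density (x * r / (t + r)) (sqrt (t * r / (t + r))) y"
proof -
  have e: "- (x - y)\<^sup>2 / (2 * t) + - y\<^sup>2 / (2 * r) =
      - x\<^sup>2 / (2 * (t + r)) + - (y - x * r / (t + r))\<^sup>2 / (2 * (t * r / (t + r)))"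
  proof -
    have s: "t + r \<noteq> 0" "t \<noteq> 0" "r \<noteq> 0" using t r by auto
    then have *: "(y - x * r / (t + r)) = (y * (t + r) - x * r) / (t + r)" by (simp add: field_simps)
    show ?thesis unfolding * using s by (simp add: divide_simps) (simp add: power2_eq_square algebra_simps)
  qed
  have c: "sqrt (2 * pi * t) * sqrt (2 * pi * r) = sqrt (2 * pi * (t + r)) * sqrt (2 * pi * (t * r / (t + r)))"
    using t r by (simp flip: real_sqrt_mult)
  have "gauss t (x - y) * gauss r y =
      1 / (sqrt (2 * pi * t) * sqrt (2 * pi * r)) * exp (- (x - y)\<^sup>2 / (2 * t) + - y\<^sup>2 / (2 * r))"
    using t r by (simp add: gauss_eq_normal_density normal_density_def) (simp flip: exp_add)
  also have "\<dots> = gauss (t + r) x * normal_density (x * r / (t + r)) (sqrt (t * r / (t + r))) y"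
    unfolding e c exp_add using t r by (simp add: gauss_eq_normal_density normal_density_def)
  finally show ?thesis .
qed

text \<open>Since k_r(y) = y g_r(y)/r, the convolution with k_r is a first moment: the mean x
  r/(t+r) divided by r, times g_(t+r)(x), which is k_(t+r)(x).\<close>

lemma
  assumes t: "0 < t" and r: "0 < r"
  shows integrable_gauss_conv: "integrable lborel (\<lambda>y. gauss t (x - y) * gauss r y)"
    and integral_gauss_conv: "(LINT y|lborel. gauss t (x - y) * gauss r y) = gauss (t + r) x"
    and integrable_gauss_conv_moment: "integrable lborel (\<lambda>y. gauss t (x - y) * kfun r y)"
    and integral_gauss_conv_moment: "(LINT y|lborel. gauss t (x - y) * kfun r y) = kfun (t + r) x"
proof -
  have s: "0 < sqrt (t * r / (t + r))" using t r by simp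
  show "integrable lborel (\<lambda>y. gauss t (x - y) * gauss r y)"
    "(LINT y|lborel. gauss t (x - y) * gauss r y) = gauss (t + r) x"
    using s by (simp_all add: gauss_mult_gauss[OF t r] integrable_normal_density integral_normal_density del: real_sqrt_gt_0_iff)
  have eq: "gauss t (x - y) * kfun r y = (gauss (t + r) x / r) *
     (normal_density (x * r / (t + r)) (sqrt (t * r / (t + r))) y * y)" for y
    using gauss_mult_gauss[OF t r, of x y] r by (simp add: kfun_def field_simps)
  show "integrable lborel (\<lambda>y. gauss t (x - y) * kfun r y)"
    unfolding eq using integrable_normal_moment_nz_1[OF s] by simp
  show "(LINT y|lborel. gauss t (x - y) * kfun r y) = kfun (t + r) x"
  proof -
    have "(LINT y|lborel. gauss t (x - y) * kfun r y) = (gauss (t + r) x / r) * (x * r / (t + r))"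
      unfolding eq using integral_normal_moment_nz_1[OF s] by (simp del: times_divide_eq_left)
    then show ?thesis using t r by (simp add: kfun_def)
  qed
qed

lemma kfun_minus: "kfun r (- y) = - kfun r y"
  by (simp add: kfun_def gauss_minus)

lemma kfun_0 [simp]: "kfun 0 y = 0"
  by (simp add: kfun_def)

text \<open>k_r is odd, so that p_t(x,y) k_r(y) has the form F(y) + F(-y) and the integral unfolds
  to the line. The case r = 0 is a genuine exception: \<open>kfun 0\<close> is zero, whereas
  \<open>kfun t\<close> is not for t > 0.\<close>

lemma abs_semigroup_kfun:
  assumes t: "0 \<le> t" and r: "0 < r"
  shows "abs_semigroup t (kfun r) x = kfun (t + r) x"
proof (cases "t = 0")
  case False
  with t have t: "0 < t" by simp
  have "abs_kernel t x y * kfun r y = gauss t (x - y) * kfun r y + gauss t (x - (- y)) * kfun r (- y)" for y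
    by (simp add: abs_kernel_def kfun_minus algebra_simps)
  then show ?thesis
    using integral_leb_D_fold[OF integrable_gauss_conv_moment[OF t r, of x]] integral_gauss_conv_moment[OF t r, of x] t
    by (simp add: abs_semigroup_def)
qed (simp add: abs_semigroup_def)

lemma abs_kernel_minus: "abs_kernel s (- z) y = - abs_kernel s z y"
  using gauss_minus[of s "z + y"] gauss_minus[of s "z - y"] by (simp add: abs_kernel_def)

lemma abs_kernel_commute: "abs_kernel t x y = abs_kernel t y x"
  using gauss_minus[of t "x - y"] by (simp add: abs_kernel_def add.commute)

lemma
  assumes t: "0 < t" and s: "0 < s"
  shows integrable_gauss_conv_shift: "integrable lborel (\<lambda>z. gauss t (x - z) * gauss s (z - y))"
    and integral_gauss_conv_shift: "(LINT z|lborel. gauss t (x - z) * gauss s (z - y)) = gauss (t + s) (x - y)"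
proof -
  let ?f = "\<lambda>w. gauss t ((x - y) - w) * gauss s w"
  have eq: "gauss t (x - z) * gauss s (z - y) = ?f (- y + 1 * z)" for z by (simp add: algebra_simps)
  show "integrable lborel (\<lambda>z. gauss t (x - z) * gauss s (z - y))"
    unfolding eq by (rule lborel_integrable_real_affine[OF integrable_gauss_conv[OF t s]]) simp
  show "(LINT z|lborel. gauss t (x - z) * gauss s (z - y)) = gauss (t + s) (x - y)"
    unfolding eq using lborel_integral_real_affine[of 1 ?f "-y"] integral_gauss_conv[OF t s, of "x - y"] by simp
qed

text \<open>The second kernel is odd in the integration variable, which again unfolds the half-line
  integral; the two Gaussians in it then convolve separately to the Gaussians at x - y and x +
  y.\<close>

lemma abs_kernel_Chapman_Kolmogorov:
  assumes t: "0 < t" and s: "0 < s"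
  shows "(LINT z|leb_D. abs_kernel t x z * abs_kernel s z y) = abs_kernel (t + s) x y"
proof -
  let ?F = "\<lambda>z. gauss t (x - z) * abs_kernel s z y"
  have eq: "?F z = gauss t (x - z) * gauss s (z - y) - gauss t (x - z) * gauss s (z - (- y))" for z
    by (simp add: abs_kernel_def algebra_simps)
  have i: "integrable lborel ?F"
    unfolding eq by (intro Bochner_Integration.integrable_diff integrable_gauss_conv_shift t s)
  have "abs_kernel t x z * abs_kernel s z y = ?F z + ?F (- z)" for z
    by (simp add: abs_kernel_minus) (simp add: abs_kernel_def[of t] algebra_simps)
  then have "(LINT z|leb_D. abs_kernel t x z * abs_kernel s z y) = (LINT z|lborel. ?F z)"
    using integral_leb_D_fold[OF i] by simp
  also have "\<dots> = abs_kernel (t + s) x y"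
    unfolding eq
    using integrable_gauss_conv_shift[OF t s, of x y] integrable_gauss_conv_shift[OF t s, of x "-y"]
      integral_gauss_conv_shift[OF t s, of x y] integral_gauss_conv_shift[OF t s, of x "-y"]
    by (simp add: abs_kernel_def)
  finally show ?thesis .
qed

section \<open>Contraction, symmetry and the semigroup property on L2\<close>

lemma abs_kernel_le: "abs_kernel t x y \<le> gauss t (x - y)"
  by (simp add: abs_kernel_def gauss_nonneg)

lemma abs_kernel_nonneg:
  assumes "0 \<le> t" "0 \<le> x" "0 \<le> y"
  shows "0 \<le> abs_kernel t x y"
proof -
  have "(x - y)\<^sup>2 \<le> (x + y)\<^sup>2" using assms by (simp add: power2_sum power2_diff)
  then have "- (x + y)\<^sup>2 / (2 * t) \<le> - (x - y)\<^sup>2 / (2 * t)" using assms by (intro divide_right_mono) auto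
  then show ?thesis unfolding abs_kernel_def gauss_def by (simp add: mult_left_mono)
qed

lemma nn_integral_abs_kernel_le:
  assumes t: "0 < t"
  shows "(\<integral>\<^sup>+y. ennreal (abs_kernel t x y) \<partial>leb_D) \<le> 1"
proof -
  have "(\<integral>\<^sup>+y. ennreal (abs_kernel t x y) \<partial>leb_D) \<le> (\<integral>\<^sup>+y. ennreal (normal_density x (sqrt t) y) \<partial>leb_D)"
    using abs_kernel_le[of t x] t by (intro nn_integral_mono ennreal_leI) (simp add: gauss_diff_eq_normal_density)
  also have "\<dots> \<le> (\<integral>\<^sup>+y. ennreal (normal_density x (sqrt t) y) \<partial>lborel)" by (rule nn_integral_leb_D_le)
  also have "\<dots> = 1"
    using t by (subst nn_integral_eq_integral) (auto simp: integrable_normal_density integral_normal_density)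
  finally show ?thesis .
qed

text \<open>Tonelli lets x be integrated first, and by symmetry the kernel has mass at most 1 in x
  as well as in y. This is one half of the Schur test for the operator P_t.\<close>

lemma nn_integral_abs_kernel_sq_le:
  assumes t: "0 < t" and f [measurable]: "f \<in> borel_measurable leb_D"
  shows "(\<integral>\<^sup>+x. \<integral>\<^sup>+y. ennreal (abs_kernel t x y * (f y)\<^sup>2) \<partial>leb_D \<partial>leb_D) \<le> (\<integral>\<^sup>+y. ennreal ((f y)\<^sup>2) \<partial>leb_D)"
proof -
  have [measurable]: "(\<lambda>(x, y). abs_kernel t x y) \<in> borel_measurable (leb_D \<Otimes>\<^sub>M leb_D)"
    by (rule measurable_pair_leb_D) measurable
  have "(\<integral>\<^sup>+x. \<integral>\<^sup>+y. ennreal (abs_kernel t x y * (f y)\<^sup>2) \<partial>leb_D \<partial>leb_D)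
      = (\<integral>\<^sup>+y. \<integral>\<^sup>+x. ennreal (abs_kernel t x y * (f y)\<^sup>2) \<partial>leb_D \<partial>leb_D)"
    by (rule leb_DD.Fubini'[symmetric]) measurable
  also have "\<dots> \<le> (\<integral>\<^sup>+y. ennreal ((f y)\<^sup>2) \<partial>leb_D)"
  proof (rule nn_integral_mono)
    fix y assume y: "y \<in> space leb_D"
    have "(\<integral>\<^sup>+x. ennreal (abs_kernel t x y * (f y)\<^sup>2) \<partial>leb_D) = (\<integral>\<^sup>+x. ennreal (abs_kernel t y x) * ennreal ((f y)\<^sup>2) \<partial>leb_D)"
      by (intro nn_integral_cong) (simp add: ennreal_mult'' abs_kernel_commute)
    also have "\<dots> = (\<integral>\<^sup>+x. ennreal (abs_kernel t y x) \<partial>leb_D) * ennreal ((f y)\<^sup>2)"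
      by (rule nn_integral_multc) (intro measurable_compose[OF _ measurable_ennreal] borel_measurable_abs_kernel measurable_ident_leb_D borel_measurable_const)
    also have "\<dots> \<le> 1 * ennreal ((f y)\<^sup>2)"
      by (intro mult_right_mono nn_integral_abs_kernel_le t) auto
    finally show "(\<integral>\<^sup>+x. ennreal (abs_kernel t x y * (f y)\<^sup>2) \<partial>leb_D) \<le> ennreal ((f y)\<^sup>2)" by simp
  qed
  finally show ?thesis .
qed

lemma square_integrable_D_nn_integral:
  assumes "square_integrable_D f"
  shows "(\<integral>\<^sup>+y. ennreal ((f y)\<^sup>2) \<partial>leb_D) = ennreal (LINT y|leb_D. (f y)\<^sup>2)"
  using assms by (intro nn_integral_eq_integral) (auto simp: square_integrable_D_def)

lemma square_integrable_D_nn_integralI: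
  assumes f: "f \<in> borel_measurable leb_D" and le: "(\<integral>\<^sup>+y. ennreal ((f y)\<^sup>2) \<partial>leb_D) \<le> ennreal c" and c: "0 \<le> c"
  shows "square_integrable_D f" "(LINT y|leb_D. (f y)\<^sup>2) \<le> c"
proof -
  have i: "integrable leb_D (\<lambda>y. (f y)\<^sup>2)"
    using f le_less_trans[OF le ennreal_less_top] by (intro integrableI_bounded) auto
  then show sq: "square_integrable_D f" using f by (simp add: square_integrable_D_def)
  show "(LINT y|leb_D. (f y)\<^sup>2) \<le> c"
    using le c by (simp add: square_integrable_D_nn_integral[OF sq])
qed

text \<open>Schur test: the kernel is written as the product of its two square roots, one of which
  stays with f. Cauchy-Schwarz bounds |P_t f(x)|^2 by the total mass in y, at most 1, times the
  integral of the kernel against f^2.\<close>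

lemma abs_semigroup_contraction:
  assumes t: "0 \<le> t" and f: "square_integrable_D f"
  shows "square_integrable_D (abs_semigroup t f)"
    "(LINT y|leb_D. (abs_semigroup t f y)\<^sup>2) \<le> (LINT y|leb_D. (f y)\<^sup>2)"
proof -
  have "square_integrable_D (abs_semigroup t f) \<and> (LINT y|leb_D. (abs_semigroup t f y)\<^sup>2) \<le> (LINT y|leb_D. (f y)\<^sup>2)"
  proof (cases "t = 0")
    case True
    then have "abs_semigroup t f = f" by (simp add: abs_semigroup_def fun_eq_iff)
    then show ?thesis using f by simp
  next
    case False
    with t have t: "0 < t" by simp
    have fm [measurable]: "f \<in> borel_measurable leb_D" using f by (simp add: square_integrable_D_def)
    have pm [measurable]: "(\<lambda>(x, y). abs_kernel t x y) \<in> borel_measurable (leb_D \<Otimes>\<^sub>M leb_D)"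
      by (rule measurable_pair_leb_D) measurable
    have pm1 [measurable]: "abs_kernel t x \<in> borel_measurable leb_D" for x
      by (intro borel_measurable_abs_kernel measurable_ident_leb_D borel_measurable_const)
    have m: "abs_semigroup t f \<in> borel_measurable leb_D"
    proof -
      have "(\<lambda>x. LINT y|leb_D. abs_kernel t x y * f y) \<in> borel_measurable leb_D"
        by (rule leb_D.borel_measurable_lebesgue_integral) measurable
      then show ?thesis using t by (simp add: abs_semigroup_def[abs_def])
    qed
    have pt: "ennreal ((abs_semigroup t f x)\<^sup>2) \<le> (\<integral>\<^sup>+y. ennreal (abs_kernel t x y * (f y)\<^sup>2) \<partial>leb_D)"
      if "x \<in> space leb_D" for x
    proof -
      have p0: "0 \<le> abs_kernel t x y" if "y \<in> space leb_D" for y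
        using that \<open>x \<in> space leb_D\<close> t by (intro abs_kernel_nonneg) auto
      \<comment> \<open>Integrability at the given x need not be settled beforehand: where it fails,
        the Bochner integral has the default value 0 and the bound is trivial.\<close>
      have "ennreal \<bar>abs_semigroup t f x\<bar> \<le> (\<integral>\<^sup>+y. ennreal \<bar>abs_kernel t x y * f y\<bar> \<partial>leb_D)"
      proof (cases "integrable leb_D (\<lambda>y. abs_kernel t x y * f y)")
        case True
        then show ?thesis using integral_norm_bound_ennreal[OF True] t by (simp add: abs_semigroup_def)
      next
        case False
        then show ?thesis using t by (simp add: abs_semigroup_def not_integrable_integral_eq)
      qed
      also have "\<dots> = (\<integral>\<^sup>+y. ennreal (sqrt (abs_kernel t x y)) * ennreal (sqrt (abs_kernel t x y) * \<bar>f y\<bar>) \<partial>leb_D)"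
        using p0 by (intro nn_integral_cong) (simp add: abs_mult flip: ennreal_mult mult.assoc)
      finally have "(ennreal \<bar>abs_semigroup t f x\<bar>)\<^sup>2 \<le>
          (\<integral>\<^sup>+y. ennreal (sqrt (abs_kernel t x y)) * ennreal (sqrt (abs_kernel t x y) * \<bar>f y\<bar>) \<partial>leb_D)\<^sup>2"
        by (intro power_mono) auto
      also have "\<dots> \<le> (\<integral>\<^sup>+y. (ennreal (sqrt (abs_kernel t x y)))\<^sup>2 \<partial>leb_D) * (\<integral>\<^sup>+y. (ennreal (sqrt (abs_kernel t x y) * \<bar>f y\<bar>))\<^sup>2 \<partial>leb_D)"
        by (rule Cauchy_Schwarz_nn_integral) measurable
      also have "(\<integral>\<^sup>+y. (ennreal (sqrt (abs_kernel t x y)))\<^sup>2 \<partial>leb_D) = (\<integral>\<^sup>+y. ennreal (abs_kernel t x y) \<partial>leb_D)"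
        using p0 by (intro nn_integral_cong) (simp add: ennreal_power)
      also have "(\<integral>\<^sup>+y. (ennreal (sqrt (abs_kernel t x y) * \<bar>f y\<bar>))\<^sup>2 \<partial>leb_D) = (\<integral>\<^sup>+y. ennreal (abs_kernel t x y * (f y)\<^sup>2) \<partial>leb_D)"
        using p0 by (intro nn_integral_cong) (simp add: ennreal_power power_mult_distrib)
      also have "(\<integral>\<^sup>+y. ennreal (abs_kernel t x y) \<partial>leb_D) * (\<integral>\<^sup>+y. ennreal (abs_kernel t x y * (f y)\<^sup>2) \<partial>leb_D)
          \<le> 1 * (\<integral>\<^sup>+y. ennreal (abs_kernel t x y * (f y)\<^sup>2) \<partial>leb_D)"
        by (intro mult_right_mono nn_integral_abs_kernel_le t) auto
      finally show ?thesis by (simp add: ennreal_power)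
    qed
    have "(\<integral>\<^sup>+x. ennreal ((abs_semigroup t f x)\<^sup>2) \<partial>leb_D) \<le> (\<integral>\<^sup>+x. \<integral>\<^sup>+y. ennreal (abs_kernel t x y * (f y)\<^sup>2) \<partial>leb_D \<partial>leb_D)"
      using pt by (rule nn_integral_mono)
    also have "\<dots> \<le> (\<integral>\<^sup>+y. ennreal ((f y)\<^sup>2) \<partial>leb_D)" by (rule nn_integral_abs_kernel_sq_le[OF t fm])
    also have "\<dots> = ennreal (LINT y|leb_D. (f y)\<^sup>2)" by (rule square_integrable_D_nn_integral[OF f])
    finally show ?thesis using square_integrable_D_nn_integralI[OF m] by simp
  qed
  then show "square_integrable_D (abs_semigroup t f)"
    "(LINT y|leb_D. (abs_semigroup t f y)\<^sup>2) \<le> (LINT y|leb_D. (f y)\<^sup>2)" by auto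
qed

text \<open>The bound |f(y) g(x)| \<le> f(y)^2 + g(x)^2 reduces absolute integrability to the Schur
  estimate in either variable. It licenses Fubini twice: for symmetry, and, with g a section of the
  kernel, for the semigroup property.\<close>

lemma integrable_abs_kernel_product:
  assumes t: "0 < t" and f: "square_integrable_D f" and g: "square_integrable_D g"
  shows "integrable (leb_D \<Otimes>\<^sub>M leb_D) (\<lambda>(x, y). abs_kernel t x y * f y * g x)"
proof (rule integrableI_bounded)
  have fm [measurable]: "f \<in> borel_measurable leb_D" and gm [measurable]: "g \<in> borel_measurable leb_D"
    using f g by (auto simp: square_integrable_D_def)
  have pm [measurable]: "(\<lambda>(x, y). abs_kernel t x y) \<in> borel_measurable (leb_D \<Otimes>\<^sub>M leb_D)"
    by (rule measurable_pair_leb_D) measurable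
  have pm' [measurable]: "(\<lambda>(x, y). abs_kernel t y x) \<in> borel_measurable (leb_D \<Otimes>\<^sub>M leb_D)"
    by (rule measurable_pair_leb_D) measurable
  show "(\<lambda>(x, y). abs_kernel t x y * f y * g x) \<in> borel_measurable (leb_D \<Otimes>\<^sub>M leb_D)" by measurable
  have "(\<integral>\<^sup>+p. ennreal (norm (case p of (x, y) \<Rightarrow> abs_kernel t x y * f y * g x)) \<partial>(leb_D \<Otimes>\<^sub>M leb_D))
    \<le> (\<integral>\<^sup>+p. (case p of (x, y) \<Rightarrow> ennreal (abs_kernel t x y * (f y)\<^sup>2)) + (case p of (x, y) \<Rightarrow> ennreal (abs_kernel t y x * (g x)\<^sup>2)) \<partial>(leb_D \<Otimes>\<^sub>M leb_D))"
  proof (rule nn_integral_mono)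
    fix p assume "p \<in> space (leb_D \<Otimes>\<^sub>M leb_D)"
    then obtain x y where p: "p = (x, y)" "0 < x" "0 < y" by (auto simp: space_pair_measure)
    have p0: "0 \<le> abs_kernel t x y" using t p by (intro abs_kernel_nonneg) auto
    have "0 \<le> (\<bar>f y\<bar> - \<bar>g x\<bar>)\<^sup>2" by simp
    then have "2 * (\<bar>f y\<bar> * \<bar>g x\<bar>) \<le> (f y)\<^sup>2 + (g x)\<^sup>2" by (simp add: power2_diff)
    moreover have "0 \<le> \<bar>f y\<bar> * \<bar>g x\<bar>" by simp
    ultimately have "\<bar>f y\<bar> * \<bar>g x\<bar> \<le> (f y)\<^sup>2 + (g x)\<^sup>2" by linarith
    then have "abs_kernel t x y * (\<bar>f y\<bar> * \<bar>g x\<bar>) \<le> abs_kernel t x y * ((f y)\<^sup>2 + (g x)\<^sup>2)"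
      using p0 by (rule mult_left_mono)
    then show "ennreal (norm (case p of (x, y) \<Rightarrow> abs_kernel t x y * f y * g x)) \<le>
      (case p of (x, y) \<Rightarrow> ennreal (abs_kernel t x y * (f y)\<^sup>2)) + (case p of (x, y) \<Rightarrow> ennreal (abs_kernel t y x * (g x)\<^sup>2))"
      using p0 by (simp add: p(1) abs_mult abs_kernel_commute[of t y x] distrib_left mult.assoc flip: ennreal_plus)
  qed
  also have "\<dots> = (\<integral>\<^sup>+p. (case p of (x, y) \<Rightarrow> ennreal (abs_kernel t x y * (f y)\<^sup>2)) \<partial>(leb_D \<Otimes>\<^sub>M leb_D))
    + (\<integral>\<^sup>+p. (case p of (x, y) \<Rightarrow> ennreal (abs_kernel t y x * (g x)\<^sup>2)) \<partial>(leb_D \<Otimes>\<^sub>M leb_D))"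
    by (rule nn_integral_add) (simp_all add: pm' split_beta')
  also have "(\<integral>\<^sup>+p. (case p of (x, y) \<Rightarrow> ennreal (abs_kernel t x y * (f y)\<^sup>2)) \<partial>(leb_D \<Otimes>\<^sub>M leb_D))
      = (\<integral>\<^sup>+x. \<integral>\<^sup>+y. ennreal (abs_kernel t x y * (f y)\<^sup>2) \<partial>leb_D \<partial>leb_D)"
    by (subst leb_D.nn_integral_fst[symmetric]) simp_all
  also have "(\<integral>\<^sup>+p. (case p of (x, y) \<Rightarrow> ennreal (abs_kernel t y x * (g x)\<^sup>2)) \<partial>(leb_D \<Otimes>\<^sub>M leb_D))
      = (\<integral>\<^sup>+y. \<integral>\<^sup>+x. ennreal (abs_kernel t y x * (g x)\<^sup>2) \<partial>leb_D \<partial>leb_D)"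
    by (subst leb_DD.nn_integral_snd[symmetric]) (simp_all add: pm' split_beta')
  also have "(\<integral>\<^sup>+x. \<integral>\<^sup>+y. ennreal (abs_kernel t x y * (f y)\<^sup>2) \<partial>leb_D \<partial>leb_D)
      + (\<integral>\<^sup>+y. \<integral>\<^sup>+x. ennreal (abs_kernel t y x * (g x)\<^sup>2) \<partial>leb_D \<partial>leb_D)
      \<le> (\<integral>\<^sup>+y. ennreal ((f y)\<^sup>2) \<partial>leb_D) + (\<integral>\<^sup>+y. ennreal ((g y)\<^sup>2) \<partial>leb_D)"
    by (intro add_mono nn_integral_abs_kernel_sq_le t) measurable
  also have "\<dots> < \<infinity>" by (simp add: square_integrable_D_nn_integral f g)
  finally show "(\<integral>\<^sup>+p. ennreal (norm (case p of (x, y) \<Rightarrow> abs_kernel t x y * f y * g x)) \<partial>(leb_D \<Otimes>\<^sub>M leb_D)) < \<infinity>" .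
qed

lemma abs_semigroup_symmetric:
  assumes t: "0 \<le> t" and f: "square_integrable_D f" and g: "square_integrable_D g"
  shows "(LINT x|leb_D. abs_semigroup t f x * g x) = (LINT x|leb_D. f x * abs_semigroup t g x)"
proof (cases "t = 0")
  case False
  with t have t: "0 < t" by simp
  have "(LINT x|leb_D. abs_semigroup t f x * g x) = (LINT x|leb_D. LINT y|leb_D. abs_kernel t x y * f y * g x)"
    using t by (simp add: abs_semigroup_def)
  also have "\<dots> = (LINT y|leb_D. LINT x|leb_D. abs_kernel t x y * f y * g x)"
    by (rule leb_DD.Fubini_integral[symmetric]) (rule integrable_abs_kernel_product[OF t f g])
  also have "\<dots> = (LINT y|leb_D. LINT x|leb_D. f y * (abs_kernel t y x * g x))"
    by (simp add: abs_kernel_commute[of t] mult_ac)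
  also have "\<dots> = (LINT x|leb_D. f x * abs_semigroup t g x)"
    using t by (simp add: abs_semigroup_def)
  finally show ?thesis .
qed (simp add: abs_semigroup_def)

text \<open>One factor of the square is bounded by the maximum of the Gaussian, at most 1/sqrt t,
  and the other integrates to at most 1.\<close>

lemma square_integrable_D_abs_kernel:
  assumes t: "0 < t" and x: "0 < x"
  shows "square_integrable_D (abs_kernel t x)"
proof (rule square_integrable_D_nn_integralI)
  show "abs_kernel t x \<in> borel_measurable leb_D"
    by (intro borel_measurable_abs_kernel measurable_ident_leb_D borel_measurable_const)
  have "(\<integral>\<^sup>+y. ennreal ((abs_kernel t x y)\<^sup>2) \<partial>leb_D) \<le> (\<integral>\<^sup>+y. ennreal (1 / sqrt t) * ennreal (normal_density x (sqrt t) y) \<partial>leb_D)"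
  proof (rule nn_integral_mono)
    fix y assume "y \<in> space leb_D"
    then have p0: "0 \<le> abs_kernel t x y" using t x by (intro abs_kernel_nonneg) auto
    have "(abs_kernel t x y)\<^sup>2 \<le> (1 / sqrt t) * gauss t (x - y)"
      unfolding power2_eq_square
      using p0 abs_kernel_le[of t x y] gauss_le[OF t, of "x - y"] t by (intro mult_mono) auto
    then show "ennreal ((abs_kernel t x y)\<^sup>2) \<le> ennreal (1 / sqrt t) * ennreal (normal_density x (sqrt t) y)"
      using t by (simp add: gauss_diff_eq_normal_density ennreal_leI flip: ennreal_mult)
  qed
  also have "\<dots> \<le> (\<integral>\<^sup>+y. ennreal (1 / sqrt t) * ennreal (normal_density x (sqrt t) y) \<partial>lborel)"
    by (rule nn_integral_leb_D_le)
  also have "\<dots> = ennreal (1 / sqrt t)"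
    using t by (subst nn_integral_cmult) (auto simp: nn_integral_eq_integral integrable_normal_density integral_normal_density)
  finally show "(\<integral>\<^sup>+y. ennreal ((abs_kernel t x y)\<^sup>2) \<partial>leb_D) \<le> ennreal (1 / sqrt t)" .
qed (use t in auto)

lemma abs_semigroup_add:
  assumes t: "0 \<le> t" and s: "0 \<le> s" and f: "square_integrable_D f" and x: "0 < x"
  shows "abs_semigroup t (abs_semigroup s f) x = abs_semigroup (t + s) f x"
proof (cases "t = 0 \<or> s = 0")
  case True
  have "abs_semigroup 0 h = h" for h by (simp add: abs_semigroup_def fun_eq_iff)
  then show ?thesis using True by auto
next
  case False
  with t s have t: "0 < t" and s: "0 < s" by auto
  have "abs_semigroup t (abs_semigroup s f) x
      = (LINT z|leb_D. LINT y|leb_D. abs_kernel s z y * f y * abs_kernel t x z)"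
    using t s by (simp add: abs_semigroup_def mult.commute)
  also have "\<dots> = (LINT y|leb_D. LINT z|leb_D. abs_kernel s z y * f y * abs_kernel t x z)"
    by (rule leb_DD.Fubini_integral[symmetric])
      (rule integrable_abs_kernel_product[OF s f square_integrable_D_abs_kernel[OF t x]])
  also have "\<dots> = (LINT y|leb_D. LINT z|leb_D. f y * (abs_kernel t x z * abs_kernel s z y))"
    by (simp add: mult_ac)
  also have "\<dots> = abs_semigroup (t + s) f x"
  proof -
    have CK: "(LINT z|leb_D. f y * (abs_kernel t x z * abs_kernel s z y)) = abs_kernel (t + s) x y * f y" for y
      by (subst integral_mult_right_zero) (simp add: abs_kernel_Chapman_Kolmogorov[OF t s])
    show ?thesis unfolding CK abs_semigroup_def using t s by simp
  qed
  finally show ?thesis .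
qed

section \<open>The semigroup as operators on classes\<close>

text \<open>A representative is chosen because \<open>abs_semigroup\<close> acts on functions. The
  choice is immaterial: for t > 0 an integral operator does not see null sets, and for t = 0 the
  class is returned unchanged.\<close>

definition abs_op :: "real \<Rightarrow> L2D \<Rightarrow> L2D" where
  "abs_op t F = L2_of (abs_semigroup t (SOME f. square_integrable_D f \<and> L2_of f = F))"

lemma L2_of_eqD:
  assumes "square_integrable_D f" "square_integrable_D g" "L2_of f = L2_of g"
  shows "AE x in leb_D. f x = g x"
  using Quotient_rel[OF Quotient_L2D, of f g] assms by (simp add: L2_of_def L2_rel_def)

lemma abs_op_L2_of:
  assumes t: "0 \<le> t" and f: "square_integrable_D f"
  shows "abs_op t (L2_of f) = L2_of (abs_semigroup t f)"
proof -
  define g where "g = (SOME g. square_integrable_D g \<and> L2_of g = L2_of f)"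
  have g: "square_integrable_D g \<and> L2_of g = L2_of f"
    unfolding g_def by (rule someI[of _ f]) (use f in simp)
  then have ae: "AE x in leb_D. g x = f x" using L2_of_eqD f by blast
  have [measurable]: "f \<in> borel_measurable leb_D" "g \<in> borel_measurable leb_D"
    using f g by (auto simp: square_integrable_D_def)
  have "L2_of (abs_semigroup t g) = L2_of (abs_semigroup t f)"
  proof (cases "t = 0")
    case True
    then have "abs_semigroup t h = h" for h by (simp add: abs_semigroup_def fun_eq_iff)
    then show ?thesis using g by simp
  next
    case False
    have [measurable]: "abs_kernel t x \<in> borel_measurable leb_D" for x
      by (intro borel_measurable_abs_kernel measurable_ident_leb_D borel_measurable_const)
    have "abs_semigroup t g x = abs_semigroup t f x" for x
      unfolding abs_semigroup_def using False ae by (auto intro!: integral_cong_AE)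
    then show ?thesis by (intro arg_cong[of _ _ L2_of] ext)
  qed
  then show ?thesis by (simp add: abs_op_def g_def)
qed

lemma inner_abs_op:
  assumes t: "0 \<le> t"
  shows "inner (abs_op t F) G = inner F (abs_op t G)"
proof -
  obtain f g where f: "square_integrable_D f" "F = L2_of f" and g: "square_integrable_D g" "G = L2_of g"
    using L2_of_cases[of F] L2_of_cases[of G] by metis
  then show ?thesis
    using abs_semigroup_symmetric[OF t f(1) g(1)] t
    by (simp add: abs_op_L2_of inner_L2_of abs_semigroup_contraction)
qed

lemma norm_abs_op_le:
  assumes t: "0 \<le> t"
  shows "norm (abs_op t F) \<le> norm F"
proof -
  obtain f where f: "square_integrable_D f" "F = L2_of f" by (rule L2_of_cases)
  have "(norm (abs_op t F))\<^sup>2 \<le> (norm F)\<^sup>2"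
    using abs_semigroup_contraction[OF t f(1)] f t by (simp add: abs_op_L2_of norm_L2_of)
  then show ?thesis by (rule power2_le_imp_le) simp
qed

text \<open>Linearity follows from self-adjointness: an element is determined by its inner products
  with all G, and there the operator can be moved onto G. No representative has to be
  handled.\<close>

lemma bounded_linear_abs_op:
  assumes t: "0 \<le> t"
  shows "bounded_linear (abs_op t)"
proof (rule bounded_linear_intro[where K=1])
  have eqI: "a = b" if "\<And>G. inner a G = inner b G" for a b :: L2D
  proof -
    have "inner (a - b) (a - b) = 0" using that[of "a - b"] by (simp add: inner_diff_left)
    then show ?thesis by simp
  qed
  show "abs_op t (F + G) = abs_op t F + abs_op t G" for F G
    by (rule eqI) (simp add: inner_abs_op[OF t] inner_add_left)
  show "abs_op t (r *\<^sub>R F) = r *\<^sub>R abs_op t F" for r F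
    by (rule eqI) (simp add: inner_abs_op[OF t])
  show "norm (abs_op t F) \<le> norm F * 1" for F using norm_abs_op_le[OF t] by simp
qed

lemma abs_op_add_time:
  assumes t: "0 \<le> t" and s: "0 \<le> s"
  shows "abs_op t (abs_op s F) = abs_op (t + s) F"
proof -
  obtain f where f: "square_integrable_D f" "F = L2_of f" by (rule L2_of_cases)
  have "L2_of (abs_semigroup t (abs_semigroup s f)) = L2_of (abs_semigroup (t + s) f)"
    using t s f(1) by (intro L2_of_eqI abs_semigroup_contraction AE_I2) (auto simp: abs_semigroup_add)
  then show ?thesis using t s f by (simp add: abs_op_L2_of abs_semigroup_contraction)
qed

lemma abs_op_0 [simp]: "abs_op 0 F = F"
proof -
  obtain f where f: "square_integrable_D f" "F = L2_of f" by (rule L2_of_cases)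
  have "abs_semigroup 0 f = f" by (simp add: abs_semigroup_def fun_eq_iff)
  then show ?thesis using f by (simp add: abs_op_L2_of)
qed

section \<open>Size of the kernel k\<close>

text \<open>In k_r^2 = y^2 g_r^2 / r^2 one Gaussian is bounded by 1/sqrt r, and the other
  contributes its second moment r over the whole line. This gives r^(-3/2), the origin of the
  exponent -3/4 in the norm bounds. At r = 0 both sides are 0, by the conventions for division and
  \<open>powr\<close>.\<close>

lemma nn_integral_kfun_sq_le:
  assumes r: "0 \<le> r"
  shows "(\<integral>\<^sup>+y. ennreal ((kfun r y)\<^sup>2) \<partial>leb_D) \<le> ennreal ((r powr (-3/4))\<^sup>2)"
proof (cases "r = 0")
  case False
  with r have r: "0 < r" by simp
  have m: "has_bochner_integral lborel (\<lambda>y. normal_density 0 (sqrt r) y * y\<^sup>2) r"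
    using normal_moment_even[of "sqrt r" 0 1] r by simp
  let ?c = "1 / (r\<^sup>2 * sqrt r)"
  have "(\<integral>\<^sup>+y. ennreal ((kfun r y)\<^sup>2) \<partial>leb_D) \<le> (\<integral>\<^sup>+y. ennreal ?c * ennreal (normal_density 0 (sqrt r) y * y\<^sup>2) \<partial>leb_D)"
  proof (rule nn_integral_mono)
    fix y
    have "(kfun r y)\<^sup>2 = gauss r y * (gauss r y * y\<^sup>2 / r\<^sup>2)"
      by (simp add: kfun_def power2_eq_square)
    also have "\<dots> \<le> (1 / sqrt r) * (gauss r y * y\<^sup>2 / r\<^sup>2)"
      by (intro mult_right_mono gauss_le r) (simp add: gauss_nonneg)
    also have "\<dots> = ?c * (normal_density 0 (sqrt r) y * y\<^sup>2)"
      by (simp add: gauss_eq_normal_density[OF r])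
    finally show "ennreal ((kfun r y)\<^sup>2) \<le> ennreal ?c * ennreal (normal_density 0 (sqrt r) y * y\<^sup>2)"
      using r by (subst ennreal_mult[symmetric]) (auto intro: ennreal_leI)
  qed
  also have "\<dots> \<le> (\<integral>\<^sup>+y. ennreal ?c * ennreal (normal_density 0 (sqrt r) y * y\<^sup>2) \<partial>lborel)"
    by (rule nn_integral_leb_D_le)
  also have "\<dots> = ennreal ?c * ennreal r"
    using m by (subst nn_integral_cmult) (auto simp: nn_integral_eq_integral has_bochner_integral_iff)
  also have "\<dots> = ennreal (?c * r)" using r by (simp flip: ennreal_mult)
  also have "?c * r = (r powr (-3/4))\<^sup>2"
  proof -
    have "(r powr (-3/4))\<^sup>2 = r powr (-3/2)"
      using r by (simp add: power2_eq_square flip: powr_add)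
    also have "\<dots> = 1 / r powr (1 + 1/2)" by (simp add: powr_minus_divide)
    also have "\<dots> = 1 / (r * sqrt r)" using r by (subst powr_add) (simp add: powr_half_sqrt)
    finally show ?thesis using r by (simp add: power2_eq_square)
  qed
  finally show ?thesis .
qed simp

lemma
  assumes r: "0 \<le> r"
  shows square_integrable_D_kfun: "square_integrable_D (kfun r)"
    and norm_kfun_le: "norm (L2_of (kfun r)) \<le> r powr (-3/4)"
proof -
  have m: "kfun r \<in> borel_measurable leb_D"
    by (intro borel_measurable_kfun measurable_ident_leb_D borel_measurable_const)
  note k = square_integrable_D_nn_integralI[OF m nn_integral_kfun_sq_le[OF r]]
  show sq: "square_integrable_D (kfun r)" using k(1) by simp
  have "(norm (L2_of (kfun r)))\<^sup>2 \<le> (r powr (-3/4))\<^sup>2"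
    using k(2) by (simp add: norm_L2_of[OF sq])
  then show "norm (L2_of (kfun r)) \<le> r powr (-3/4)" by (rule power2_le_imp_le) simp
qed

lemma abs_op_kfun:
  assumes t: "0 \<le> t" and r: "0 < r"
  shows "abs_op t (L2_of (kfun r)) = L2_of (kfun (t + r))"
proof -
  have "abs_semigroup t (kfun r) = kfun (t + r)" using abs_semigroup_kfun[OF t r] by (rule ext)
  then show ?thesis using r by (simp add: abs_op_L2_of[OF t square_integrable_D_kfun])
qed

lemma kfun_nonneg: "0 \<le> r \<Longrightarrow> 0 \<le> y \<Longrightarrow> 0 \<le> kfun r y"
  by (simp add: kfun_def gauss_nonneg)

text \<open>Away from y = 0 the singularity in r is illusory. With z = y^2/(2r), the estimate
  exp(-z) \<le> 2/z^2 gains r^2, which turns r^(-3/2) into r^(1/2); collecting constants gives 8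
  sqrt r / y^3. The bound is uniform over times in [0,T] and makes the defining integral of the
  process converge for every y > 0.\<close>

lemma kfun_bound:
  assumes r: "0 \<le> r" "r \<le> T" and y: "0 < y"
  shows "kfun r y \<le> 8 * sqrt T / y ^ 3"
proof (cases "r = 0")
  case True
  then show ?thesis using r y by simp
next
  case False
  with r have r0: "0 < r" by simp
  let ?z = "y\<^sup>2 / (2 * r)"
  have z: "0 < ?z" using r0 y by simp
  have "?z\<^sup>2 / 2 \<le> exp ?z"
    using exp_lower_Taylor_quadratic[of ?z] z by (simp add: add_increasing)
  then have e: "exp (- ?z) \<le> 2 / ?z\<^sup>2"
  proof -
    have "1 / exp ?z \<le> 1 / (?z\<^sup>2 / 2)"
      using \<open>?z\<^sup>2 / 2 \<le> exp ?z\<close> z by (intro divide_left_mono mult_pos_pos) auto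
    then show ?thesis by (simp add: exp_minus inverse_eq_divide)
  qed
  have c: "(2 * pi * r) powr (- 1 / 2) \<le> 1 / sqrt r"
    using gauss_le[OF r0, of 0] by (simp add: gauss_def)
  have "gauss r y \<le> 1 / sqrt r * (2 / ?z\<^sup>2)"
    unfolding gauss_def using e c r0 by (intro mult_mono) auto
  then have "kfun r y \<le> y * (1 / sqrt r * (2 / ?z\<^sup>2)) / r"
    unfolding kfun_def using y r0 by (intro divide_right_mono mult_left_mono) auto
  also have "\<dots> = 8 * (r / sqrt r) / y ^ 3"
    using y r0 by (simp add: field_simps power2_eq_square power3_eq_cube)
  also have "\<dots> = 8 * sqrt r / y ^ 3" using r0 by (simp add: real_div_sqrt)
  also have "\<dots> \<le> 8 * sqrt T / y ^ 3"
    using r y by (intro divide_right_mono mult_left_mono) auto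
  finally show ?thesis .
qed

section \<open>Characteristic functionals of Poisson random measures\<close>

lemma exp_sums_real: "(\<lambda>n. x ^ n / fact n) sums exp (x::real)"
  using exp_converges[of x] by (simp add: divide_inverse mult.commute)

lemma norm_iexp_minus_1_le: "norm (iexp x - 1) \<le> \<bar>x\<bar>"
  using iexp_approx1[of x 0] by simp

locale poisson_measure = prob_space M
  for M :: "'w measure" +
  fixes \<mu> :: "'a measure" and N :: "'w \<Rightarrow> 'a measure"
  assumes prm: "poisson_random_measure M \<mu> N"
begin

lemma sets_N: "\<omega> \<in> space M \<Longrightarrow> sets (N \<omega>) = sets \<mu>"
  using prm by (simp add: poisson_random_measure_def)

lemma space_N: "\<omega> \<in> space M \<Longrightarrow> space (N \<omega>) = space \<mu>"
  using sets_N sets_eq_imp_space_eq by blast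

lemma measurable_N: "\<omega> \<in> space M \<Longrightarrow> f \<in> \<mu> \<rightarrow>\<^sub>M K \<Longrightarrow> f \<in> N \<omega> \<rightarrow>\<^sub>M K"
  using sets_N measurable_cong_sets by blast

lemma measurable_emeasure_N [measurable]:
  "A \<in> sets \<mu> \<Longrightarrow> (\<lambda>\<omega>. emeasure (N \<omega>) A) \<in> borel_measurable M"
  using prm by (simp add: poisson_random_measure_def)

lemma prob_N:
  "A \<in> sets \<mu> \<Longrightarrow> emeasure \<mu> A < \<infinity> \<Longrightarrow>
    prob {\<omega>\<in>space M. emeasure (N \<omega>) A = of_nat n} = measure \<mu> A ^ n / fact n * exp (- measure \<mu> A)"
  using prm unfolding poisson_random_measure_def by blast

lemma indep_N:
  fixes n :: nat
  assumes "\<And>i. i < n \<Longrightarrow> A i \<in> sets \<mu>" "disjoint_family_on A {..<n}"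
  shows "indep_vars (\<lambda>_. borel) (\<lambda>i \<omega>. emeasure (N \<omega>) (A i)) {..<n}"
proof -
  have "A ` {..<n} \<subseteq> sets \<mu>" using assms(1) by auto
  then show ?thesis using prm assms(2) unfolding poisson_random_measure_def by blast
qed

lemma sets_emeasure_N_eq:
  assumes A: "A \<in> sets \<mu>"
  shows "{\<omega>\<in>space M. emeasure (N \<omega>) A = c} \<in> sets M"
proof -
  have "{\<omega>\<in>space M. emeasure (N \<omega>) A = c} = (\<lambda>\<omega>. emeasure (N \<omega>) A) -` {c} \<inter> space M" by auto
  also have "\<dots> \<in> sets M" by (rule measurable_sets[OF measurable_emeasure_N[OF A]]) simp
  finally show ?thesis .
qed

text \<open>That the values are almost surely natural numbers is not part of the definition. It
  follows because the Poisson probabilities already sum to exp(l) exp(-l) = 1.\<close>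

lemma AE_N_nat:
  assumes A: "A \<in> sets \<mu>" "emeasure \<mu> A < \<infinity>"
  shows "AE \<omega> in M. \<exists>n::nat. emeasure (N \<omega>) A = of_nat n"
proof -
  define E where "E n = {\<omega>\<in>space M. emeasure (N \<omega>) A = of_nat n}" for n :: nat
  have [measurable]: "E n \<in> sets M" for n
    unfolding E_def by (rule sets_emeasure_N_eq[OF A(1)])
  have "(\<lambda>n. prob (E n)) sums prob (\<Union>n. E n)"
  proof (rule finite_measure_UNION)
    show "range E \<subseteq> sets M" by auto
    show "disjoint_family E"
      by (auto simp: disjoint_family_on_def E_def)
  qed
  moreover have "(\<lambda>n. prob (E n)) sums (exp (measure \<mu> A) * exp (- measure \<mu> A))"
    unfolding E_def prob_N[OF A] by (intro sums_mult2 exp_sums_real)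
  ultimately have "prob (\<Union>n. E n) = exp (measure \<mu> A) * exp (- measure \<mu> A)"
    by (rule sums_unique2)
  then have "prob (\<Union>n. E n) = 1" by (simp add: exp_minus)
  then have "AE \<omega> in M. \<omega> \<in> (\<Union>n. E n)" by (rule AE_prob_1)
  then show ?thesis by eventually_elim (auto simp: E_def)
qed

text \<open>The mean of the Poisson law, computed through the events on which the count equals n.
  Sets of infinite intensity are covered as well, since there the count is almost surely
  infinite.\<close>

lemma nn_integral_emeasure_N:
  assumes A: "A \<in> sets \<mu>"
  shows "(\<integral>\<^sup>+\<omega>. emeasure (N \<omega>) A \<partial>M) = emeasure \<mu> A"
proof (cases "emeasure \<mu> A < \<infinity>")
  case False
  then have "AE \<omega> in M. emeasure (N \<omega>) A = \<infinity>"
    using prm A unfolding poisson_random_measure_def by (metis top.not_eq_extremum infinity_ennreal_def)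
  then have "(\<integral>\<^sup>+\<omega>. emeasure (N \<omega>) A \<partial>M) = (\<integral>\<^sup>+\<omega>. \<infinity> \<partial>M)" by (rule nn_integral_cong_AE)
  moreover have "emeasure \<mu> A = \<infinity>" using False by (metis infinity_ennreal_def less_top)
  ultimately show ?thesis by (simp add: emeasure_space_1)
next
  case True
  define l where "l = measure \<mu> A"
  define E where "E n = {\<omega>\<in>space M. emeasure (N \<omega>) A = of_nat n}" for n :: nat
  have [measurable]: "E n \<in> sets M" for n
    unfolding E_def by (rule sets_emeasure_N_eq[OF A])
  have "(\<integral>\<^sup>+\<omega>. emeasure (N \<omega>) A \<partial>M) = (\<integral>\<^sup>+\<omega>. (\<Sum>n. of_nat n * indicator (E n) \<omega>) \<partial>M)"
  proof (rule nn_integral_cong_AE)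
    show "AE \<omega> in M. emeasure (N \<omega>) A = (\<Sum>n. of_nat n * indicator (E n) \<omega>)"
      using AE_N_nat[OF A True] AE_space
    proof eventually_elim
      case (elim \<omega>)
      then obtain k :: nat where k: "emeasure (N \<omega>) A = of_nat k" by blast
      have "(\<Sum>n. of_nat n * indicator (E n) \<omega> :: ennreal) = (\<Sum>n. if n = k then of_nat k else 0)"
        using elim(2) k by (intro suminf_cong) (auto simp: E_def indicator_def)
      also have "\<dots> = of_nat k"
        using sums_single[of k "\<lambda>_. of_nat k :: ennreal"] by (simp add: sums_iff)
      finally show ?case using k by simp
    qed
  qed
  also have "\<dots> = (\<Sum>n. \<integral>\<^sup>+\<omega>. of_nat n * indicator (E n) \<omega> \<partial>M)"
    by (rule nn_integral_suminf) measurable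
  also have "\<dots> = (\<Sum>n. ennreal (real n * (l ^ n / fact n * exp (- l))))"
  proof (rule suminf_cong)
    fix n
    have "(\<integral>\<^sup>+\<omega>. of_nat n * indicator (E n) \<omega> \<partial>M) = of_nat n * emeasure M (E n)"
      by (rule nn_integral_cmult_indicator) measurable
    also have "\<dots> = ennreal (real n * prob (E n))"
      by (simp add: emeasure_eq_measure ennreal_mult flip: ennreal_of_nat_eq_real_of_nat)
    finally show "(\<integral>\<^sup>+\<omega>. of_nat n * indicator (E n) \<omega> \<partial>M) = ennreal (real n * (l ^ n / fact n * exp (- l)))"
      unfolding E_def prob_N[OF A True] l_def .
  qed
  also have "\<dots> = ennreal l"
  proof -
    have l0: "0 \<le> l" by (simp add: l_def)
    then have nonneg: "0 \<le> real n * (l ^ n / fact n * exp (- l))" for n by simp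
    have "(\<lambda>n. l * exp (- l) * (l ^ n / fact n)) sums (l * exp (- l) * exp l)"
      by (intro sums_mult exp_sums_real)
    \<comment> \<open>The weight n cancels one factor of the factorial, so the series for the mean
      is l times the exponential series shifted by one; its term n = 0 vanishes.\<close>
    moreover have *: "l * exp (- l) * (l ^ n / fact n) = real (Suc n) * (l ^ Suc n / fact (Suc n) * exp (- l))" for n
      by (simp add: field_simps del: of_nat_Suc)
    ultimately have "(\<lambda>n. real (Suc n) * (l ^ Suc n / fact (Suc n) * exp (- l))) sums (l * exp (- l) * exp l)"
      unfolding * by blast
    then have s0: "(\<lambda>n. real n * (l ^ n / fact n * exp (- l))) sums (l * exp (- l) * exp l)"
      by (subst (asm) sums_Suc_iff) simp
    then have s: "(\<lambda>n. real n * (l ^ n / fact n * exp (- l))) sums l"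
    proof -
      have "l * exp (- l) * exp l = l" by (simp add: exp_minus)
      then show ?thesis using s0 by (simp only:)
    qed
    show ?thesis
      unfolding suminf_ennreal2[OF nonneg sums_summable[OF s]] sums_unique[OF s, symmetric] ..
  qed
  also have "\<dots> = emeasure \<mu> A"
    using True by (simp add: l_def emeasure_eq_ennreal_measure)
  finally show ?thesis .
qed

text \<open>Campbell's formula, by monotone approximation from the case of indicators. Measurability
  in \<omega> is carried through the same induction, because interchanging the expectation with
  suprema and sums requires it.\<close>

lemma
  assumes "f \<in> borel_measurable \<mu>"
  shows measurable_nn_integral_N [measurable]: "(\<lambda>\<omega>. \<integral>\<^sup>+x. f x \<partial>N \<omega>) \<in> borel_measurable M"
    and nn_integral_N: "(\<integral>\<^sup>+\<omega>. \<integral>\<^sup>+x. f x \<partial>N \<omega> \<partial>M) = (\<integral>\<^sup>+x. f x \<partial>\<mu>)"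
proof -
  have "(\<lambda>\<omega>. \<integral>\<^sup>+x. f x \<partial>N \<omega>) \<in> borel_measurable M \<and> (\<integral>\<^sup>+\<omega>. \<integral>\<^sup>+x. f x \<partial>N \<omega> \<partial>M) = (\<integral>\<^sup>+x. f x \<partial>\<mu>)"
    using assms
  proof (induct rule: borel_measurable_induct)
    case (cong f g)
    have "(\<integral>\<^sup>+x. f x \<partial>N \<omega>) = (\<integral>\<^sup>+x. g x \<partial>N \<omega>)" if "\<omega> \<in> space M" for \<omega>
      using cong(3) space_N[OF that] by (intro nn_integral_cong) auto
    moreover have "(\<integral>\<^sup>+x. f x \<partial>\<mu>) = (\<integral>\<^sup>+x. g x \<partial>\<mu>)" using cong(3) by (intro nn_integral_cong)
    ultimately show ?case using cong(4) by (simp cong: measurable_cong nn_integral_cong)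
  next
    case (set A)
    have "(\<integral>\<^sup>+x. indicator A x \<partial>N \<omega>) = emeasure (N \<omega>) A" if "\<omega> \<in> space M" for \<omega>
      using set sets_N[OF that] by simp
    then show ?case using set nn_integral_emeasure_N[OF set] measurable_emeasure_N[OF set]
      by (simp cong: measurable_cong nn_integral_cong)
  next
    case (mult u c)
    have "(\<integral>\<^sup>+x. c * u x \<partial>N \<omega>) = c * (\<integral>\<^sup>+x. u x \<partial>N \<omega>)" if "\<omega> \<in> space M" for \<omega>
      using mult(2) measurable_N[OF that] by (intro nn_integral_cmult) auto
    moreover have m: "(\<lambda>\<omega>. \<integral>\<^sup>+x. u x \<partial>N \<omega>) \<in> borel_measurable M" using mult by blast
    moreover have "(\<lambda>\<omega>. c * (\<integral>\<^sup>+x. u x \<partial>N \<omega>)) \<in> borel_measurable M" using m by measurable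
    ultimately show ?case using mult by (simp add: nn_integral_cmult cong: measurable_cong nn_integral_cong)
  next
    case (add u v)
    have "(\<integral>\<^sup>+x. v x + u x \<partial>N \<omega>) = (\<integral>\<^sup>+x. v x \<partial>N \<omega>) + (\<integral>\<^sup>+x. u x \<partial>N \<omega>)" if "\<omega> \<in> space M" for \<omega>
      using add(1,4) measurable_N[OF that] by (intro nn_integral_add) auto
    moreover have m: "(\<lambda>\<omega>. \<integral>\<^sup>+x. u x \<partial>N \<omega>) \<in> borel_measurable M" "(\<lambda>\<omega>. \<integral>\<^sup>+x. v x \<partial>N \<omega>) \<in> borel_measurable M"
      using add by blast+
    moreover have "(\<lambda>\<omega>. (\<integral>\<^sup>+x. v x \<partial>N \<omega>) + (\<integral>\<^sup>+x. u x \<partial>N \<omega>)) \<in> borel_measurable M" using m by measurable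
    ultimately show ?case using add by (simp add: nn_integral_add cong: measurable_cong nn_integral_cong)
  next
    case (seq U)
    have eq: "(\<integral>\<^sup>+x. (SUP i. U i) x \<partial>N \<omega>) = (SUP i. \<integral>\<^sup>+x. U i x \<partial>N \<omega>)" if "\<omega> \<in> space M" for \<omega>
    proof -
      have "(\<integral>\<^sup>+x. (SUP i. U i) x \<partial>N \<omega>) = (\<integral>\<^sup>+x. (SUP i. U i x) \<partial>N \<omega>)" by (simp add: image_comp)
      also have "\<dots> = (SUP i. \<integral>\<^sup>+x. U i x \<partial>N \<omega>)"
        by (rule nn_integral_monotone_convergence_SUP[OF seq(4) measurable_N[OF that seq(1)]])
      finally show ?thesis .
    qed
    have eq': "(\<integral>\<^sup>+x. (SUP i. U i) x \<partial>\<mu>) = (SUP i. \<integral>\<^sup>+x. U i x \<partial>\<mu>)"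
    proof -
      have "(\<integral>\<^sup>+x. (SUP i. U i) x \<partial>\<mu>) = (\<integral>\<^sup>+x. (SUP i. U i x) \<partial>\<mu>)" by (simp add: image_comp)
      also have "\<dots> = (SUP i. \<integral>\<^sup>+x. U i x \<partial>\<mu>)"
        by (rule nn_integral_monotone_convergence_SUP[OF seq(4) seq(1)])
      finally show ?thesis .
    qed
    have m: "(\<lambda>\<omega>. \<integral>\<^sup>+x. U i x \<partial>N \<omega>) \<in> borel_measurable M" for i using seq(3) by blast
    have "(\<integral>\<^sup>+\<omega>. (SUP i. \<integral>\<^sup>+x. U i x \<partial>N \<omega>) \<partial>M) = (SUP i. \<integral>\<^sup>+\<omega>. \<integral>\<^sup>+x. U i x \<partial>N \<omega> \<partial>M)"
    proof (rule nn_integral_monotone_convergence_SUP)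
      show "incseq (\<lambda>i \<omega>. \<integral>\<^sup>+x. U i x \<partial>N \<omega>)"
        using seq(4) by (auto simp: incseq_def le_fun_def intro!: nn_integral_mono)
    qed (rule m)
    moreover have "(\<lambda>\<omega>. SUP i. \<integral>\<^sup>+x. U i x \<partial>N \<omega>) \<in> borel_measurable M" using m by measurable
    moreover have "(\<integral>\<^sup>+\<omega>. \<integral>\<^sup>+x. U i x \<partial>N \<omega> \<partial>M) = (\<integral>\<^sup>+x. U i x \<partial>\<mu>)" for i using seq(3) by blast
    moreover have "(\<integral>\<^sup>+\<omega>. \<integral>\<^sup>+x. (SUP i. U i) x \<partial>N \<omega> \<partial>M) = (\<integral>\<^sup>+\<omega>. (SUP i. \<integral>\<^sup>+x. U i x \<partial>N \<omega>) \<partial>M)"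
      by (intro nn_integral_cong eq)
    moreover have "(\<lambda>\<omega>. \<integral>\<^sup>+x. (SUP i. U i) x \<partial>N \<omega>) \<in> borel_measurable M \<longleftrightarrow>
        (\<lambda>\<omega>. SUP i. \<integral>\<^sup>+x. U i x \<partial>N \<omega>) \<in> borel_measurable M"
      by (intro measurable_cong eq)
    ultimately show ?case by (simp only: eq')
  qed
  then show "(\<lambda>\<omega>. \<integral>\<^sup>+x. f x \<partial>N \<omega>) \<in> borel_measurable M"
    "(\<integral>\<^sup>+\<omega>. \<integral>\<^sup>+x. f x \<partial>N \<omega> \<partial>M) = (\<integral>\<^sup>+x. f x \<partial>\<mu>)" by auto
qed

lemma AE_nn_integral_N_finite:
  assumes f: "f \<in> borel_measurable \<mu>" and "(\<integral>\<^sup>+x. f x \<partial>\<mu>) < \<infinity>"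
  shows "AE \<omega> in M. (\<integral>\<^sup>+x. f x \<partial>N \<omega>) < \<infinity>"
proof -
  have "AE \<omega> in M. (\<integral>\<^sup>+x. f x \<partial>N \<omega>) \<noteq> \<infinity>"
    using assms nn_integral_N[OF f] by (intro nn_integral_PInf_AE measurable_nn_integral_N) auto
  then show ?thesis by (simp add: less_top)
qed

text \<open>A \<mu>-null set has expected count 0, hence almost surely count 0. This transfers
  almost everywhere identities between integrands to the random measure.\<close>

lemma AE_AE_N:
  assumes "AE x in \<mu>. P x"
  shows "AE \<omega> in M. AE x in N \<omega>. P x"
proof -
  obtain A where A: "{x\<in>space \<mu>. \<not> P x} \<subseteq> A" "A \<in> sets \<mu>" "emeasure \<mu> A = 0"
    using AE_E[OF assms] by metis
  have "AE \<omega> in M. emeasure (N \<omega>) A = 0"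
    using nn_integral_emeasure_N[OF A(2)] A measurable_emeasure_N[OF A(2)] by (simp add: nn_integral_0_iff_AE)
  then show ?thesis using AE_space
  proof eventually_elim
    case (elim \<omega>)
    show ?case
      by (rule AE_I[of _ _ A]) (use A elim sets_N space_N in auto)
  qed
qed

lemma AE_integrable_N:
  fixes f :: "'a \<Rightarrow> real"
  assumes f: "integrable \<mu> f"
  shows "AE \<omega> in M. integrable (N \<omega>) f"
proof -
  have fm: "f \<in> borel_measurable \<mu>" using f by simp
  have "AE \<omega> in M. (\<integral>\<^sup>+x. ennreal (norm (f x)) \<partial>N \<omega>) < \<infinity>"
    using f by (intro AE_nn_integral_N_finite) (auto simp: integrable_iff_bounded)
  then show ?thesis using AE_space
    by eventually_elim (use measurable_N[OF _ fm] in \<open>auto simp: integrable_iff_bounded\<close>)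
qed

text \<open>The Bochner integral is 0 where the absolute integral is infinite and a difference of
  two nonnegative integrals elsewhere; each piece is measurable in \<omega> by the nonnegative
  case.\<close>

lemma measurable_integral_N [measurable]:
  fixes f :: "'a \<Rightarrow> real"
  assumes f [measurable]: "f \<in> borel_measurable \<mu>"
  shows "(\<lambda>\<omega>. LINT x|N \<omega>. f x) \<in> borel_measurable M"
proof -
  have "(LINT x|N \<omega>. f x) = (if (\<integral>\<^sup>+x. ennreal (norm (f x)) \<partial>N \<omega>) < \<infinity>
      then enn2real (\<integral>\<^sup>+x. ennreal (f x) \<partial>N \<omega>) - enn2real (\<integral>\<^sup>+x. ennreal (- f x) \<partial>N \<omega>) else 0)"
    if "\<omega> \<in> space M" for \<omega>
    using measurable_N[OF that f]
    by (auto simp: integrable_iff_bounded real_lebesgue_integral_def not_integrable_integral_eq)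
  moreover have "(\<lambda>\<omega>. (if (\<integral>\<^sup>+x. ennreal (norm (f x)) \<partial>N \<omega>) < \<infinity>
      then enn2real (\<integral>\<^sup>+x. ennreal (f x) \<partial>N \<omega>) - enn2real (\<integral>\<^sup>+x. ennreal (- f x) \<partial>N \<omega>) else 0)) \<in> borel_measurable M"
    by measurable
  ultimately show ?thesis by (subst measurable_cong) auto
qed

section \<open>Exponential formula for Poisson integrals\<close>

text \<open>The expectation is split over the events E n; for a given \<omega> at most one summand
  is nonzero, and the norms integrate to the Poisson probabilities, so that sum and expectation may
  be exchanged. What remains is the exponential series at l iexp(c).\<close>

lemma char_emeasure_N:
  assumes A: "A \<in> sets \<mu>" "emeasure \<mu> A < \<infinity>"
  shows "(CLINT \<omega>|M. iexp (c * enn2real (emeasure (N \<omega>) A))) = exp (of_real (measure \<mu> A) * (iexp c - 1))"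
proof -
  define l where "l = measure \<mu> A"
  define E where "E n = {\<omega>\<in>space M. emeasure (N \<omega>) A = of_nat n}" for n :: nat
  have [measurable]: "E n \<in> sets M" for n
    unfolding E_def by (rule sets_emeasure_N_eq[OF A(1)])
  define F where "F n \<omega> = iexp (c * real n) * indicator (E n) \<omega>" for n \<omega>
  have F: "(\<lambda>n. F n \<omega>) sums iexp (c * enn2real (emeasure (N \<omega>) A)) \<and> summable (\<lambda>n. norm (F n \<omega>))"
    if "\<omega> \<in> space M" "emeasure (N \<omega>) A = of_nat k" for \<omega> k
  proof -
    have Fk: "F n \<omega> = (if n = k then iexp (c * enn2real (emeasure (N \<omega>) A)) else 0)" for n
      using that by (auto simp: F_def E_def)
    show ?thesis
      unfolding Fk using sums_single[of k "\<lambda>_. iexp (c * enn2real (emeasure (N \<omega>) A))"]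
        sums_summable[OF sums_single[of k "\<lambda>_. norm (iexp (c * enn2real (emeasure (N \<omega>) A)))"]]
      by (simp add: if_distrib[of norm] cong: if_cong)
  qed
  have ae: "AE \<omega> in M. (\<lambda>n. F n \<omega>) sums iexp (c * enn2real (emeasure (N \<omega>) A)) \<and> summable (\<lambda>n. norm (F n \<omega>))"
    using AE_N_nat[OF A] AE_space by eventually_elim (use F in blast)
  have Fint: "integrable M (F n)" for n
    unfolding F_def by (rule integrable_const_bound[where B=1]) (auto simp: norm_mult indicator_def)
  have F1: "(CLINT \<omega>|M. F n \<omega>) = iexp (c * real n) * of_real (l ^ n / fact n * exp (- l))" for n
  proof -
    have "(CLINT \<omega>|M. F n \<omega>) = iexp (c * real n) * (CLINT \<omega>|M. indicator (E n) \<omega>)"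
      unfolding F_def by simp
    also have "(CLINT \<omega>|M. indicator (E n) \<omega>) = of_real (prob (E n))"
    proof -
      have "(CLINT \<omega>|M. indicator (E n) \<omega>) = (CLINT \<omega>|M. of_real (indicator (E n) \<omega>))"
        by (intro Bochner_Integration.integral_cong) (auto simp: indicator_def)
      also have "\<dots> = of_real (prob (E n))" by (subst integral_complex_of_real) simp
      finally show ?thesis .
    qed
    finally show ?thesis unfolding E_def prob_N[OF A] l_def .
  qed
  have F2: "(LINT \<omega>|M. norm (F n \<omega>)) = l ^ n / fact n * exp (- l)" for n
  proof -
    have "(LINT \<omega>|M. norm (F n \<omega>)) = prob (E n)"
    proof -
      have "norm (F n \<omega>) = indicator (E n) \<omega>" for \<omega> by (simp add: F_def norm_mult indicator_def)
      then show ?thesis by simp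
    qed
    then show ?thesis unfolding E_def prob_N[OF A] l_def .
  qed
  have "(\<lambda>n. CLINT \<omega>|M. F n \<omega>) sums (CLINT \<omega>|M. (\<Sum>n. F n \<omega>))"
  proof (rule sums_integral[OF Fint])
    show "AE \<omega> in M. summable (\<lambda>n. norm (F n \<omega>))" using ae by eventually_elim blast
    show "summable (\<lambda>n. LINT \<omega>|M. norm (F n \<omega>))"
      unfolding F2 by (intro summable_mult2 sums_summable[OF exp_sums_real])
  qed
  also have "(CLINT \<omega>|M. (\<Sum>n. F n \<omega>)) = (CLINT \<omega>|M. iexp (c * enn2real (emeasure (N \<omega>) A)))"
  proof (rule integral_cong_AE)
    show "AE \<omega> in M. (\<Sum>n. F n \<omega>) = iexp (c * enn2real (emeasure (N \<omega>) A))"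
      using ae by eventually_elim (auto simp: sums_iff)
  qed (use A Fint in \<open>auto intro!: borel_measurable_suminf\<close>)
  finally have s1: "(\<lambda>n. iexp (c * real n) * of_real (l ^ n / fact n * exp (- l))) sums (CLINT \<omega>|M. iexp (c * enn2real (emeasure (N \<omega>) A)))"
    unfolding F1 .
  have "(\<lambda>n. (of_real l * iexp c) ^ n /\<^sub>R fact n * of_real (exp (- l))) sums (exp (of_real l * iexp c) * of_real (exp (- l)))"
    by (intro sums_mult2 exp_converges)
  moreover have "(of_real l * iexp c) ^ n /\<^sub>R fact n * of_real (exp (- l)) = iexp (c * real n) * of_real (l ^ n / fact n * exp (- l))" for n
  proof -
    have "iexp (c * real n) = iexp c ^ n"
      by (simp add: exp_of_nat_mult[symmetric] mult_ac)
    then show ?thesis by (simp add: power_mult_distrib scaleR_conv_of_real field_simps)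
  qed
  ultimately have "(\<lambda>n. iexp (c * real n) * of_real (l ^ n / fact n * exp (- l))) sums (exp (of_real l * iexp c) * of_real (exp (- l)))"
    by simp
  then have "(CLINT \<omega>|M. iexp (c * enn2real (emeasure (N \<omega>) A))) = exp (of_real l * iexp c) * of_real (exp (- l))"
    using s1 sums_unique2 by blast
  also have "\<dots> = exp (of_real l * (iexp c - 1))"
    by (simp add: right_diff_distrib exp_diff exp_minus exp_of_real divide_inverse)
  finally show ?thesis by (simp add: l_def)
qed

text \<open>The integral of a simple function is a linear combination of counts of disjoint level
  sets. Independence turns the expectation into a product of Poisson characteristic functions, whose
  exponents add up to the integral of iexp(s) - 1.\<close>

lemma char_integral_N_simple:
  fixes s :: "'a \<Rightarrow> real"
  assumes s: "simple_function \<mu> s" and i: "integrable \<mu> s"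
  shows "(CLINT \<omega>|M. iexp (LINT x|N \<omega>. s x)) = exp (CLINT x|\<mu>. iexp (s x) - 1)"
proof -
  \<comment> \<open>The value 0 is left out because its level set may have infinite intensity.
    Nothing is lost: \<open>sum_eq\<close> is applied only to the identity and to iexp - 1, which
    vanish at 0. The enumeration of T by an initial segment of the naturals matches the form of the
    independence clause for N.\<close>
  define T where "T = s ` space \<mu> - {0}"
  have finT: "finite T" using s by (simp add: T_def simple_function_def)
  obtain h where h: "bij_betw h {..<card T} T"
    using ex_bij_betw_nat_finite[OF finT] by (auto simp: atLeast0LessThan)
  define n where "n = card T"
  define A where "A j = s -` {h j} \<inter> space \<mu>" for j
  have sm [measurable]: "s \<in> borel_measurable \<mu>" using i by simp
  have A [measurable]: "A j \<in> sets \<mu>" for j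
    unfolding A_def using measurable_sets[OF sm, of "{h j}"] by simp
  have hT: "h j \<in> T" if "j < n" for j using h that by (auto simp: bij_betw_def n_def)
  have hinj: "h j = h k \<longleftrightarrow> j = k" if "j < n" "k < n" for j k
    using h that by (auto simp: bij_betw_def n_def inj_on_def)
  have Afin: "emeasure \<mu> (A j) < \<infinity>" if "j < n" for j
  proof -
    have h0: "h j \<noteq> 0" using hT[OF that] by (simp add: T_def)
    have "integrable \<mu> (\<lambda>x. inverse (h j) * (indicator (A j) x * s x))"
      using integrable_mult_indicator[OF A i, of j] by simp
    moreover have "inverse (h j) * (indicator (A j) x * s x) = indicator (A j) x" for x
      using h0 by (simp add: A_def indicator_def)
    ultimately have "integrable \<mu> (indicator (A j) :: 'a \<Rightarrow> real)" by simp
    then show ?thesis by (simp add: integrable_indicator_iff)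
  qed
  have disj: "disjoint_family_on A {..<n}"
    using hinj by (auto simp: disjoint_family_on_def A_def)
  have sum_eq: "g (s x) = (\<Sum>j<n. g (h j) * indicator (A j) x)" if x: "x \<in> space \<mu>" and g0: "g 0 = 0"
    for x and g :: "real \<Rightarrow> 'c :: real_normed_algebra_1"
  proof (cases "s x = 0")
    case True
    then have "x \<notin> A j" if "j < n" for j using hT[OF that] by (auto simp: A_def T_def)
    then show ?thesis using True g0 by simp
  next
    case False
    then have "s x \<in> T" using x by (simp add: T_def)
    then obtain k where k: "k < n" "h k = s x"
      using bij_betw_imp_surj_on[OF h] unfolding n_def by (metis imageE lessThan_iff)
    have "(\<Sum>j<n. g (h j) * indicator (A j) x) = (\<Sum>j<n. if j = k then g (s x) else 0)"
    proof (rule sum.cong)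
      fix j assume "j \<in> {..<n}"
      then show "g (h j) * indicator (A j) x = (if j = k then g (s x) else 0)"
        using k x hinj[of j k] by (auto simp: A_def indicator_def)
    qed simp
    also have "\<dots> = g (s x)" using k by simp
    finally show ?thesis by simp
  qed
  have N_int: "AE \<omega> in M. (LINT x|N \<omega>. s x) = (\<Sum>j<n. h j * enn2real (emeasure (N \<omega>) (A j)))"
  proof -
    have "AE \<omega> in M. \<forall>j\<in>{..<n}. \<exists>k::nat. emeasure (N \<omega>) (A j) = of_nat k"
      using AE_N_nat[OF A Afin] by (intro AE_finite_allI) auto
    then show ?thesis using AE_space
    proof eventually_elim
      case (elim \<omega>)
      have fin: "emeasure (N \<omega>) (A j) < \<infinity>" if "j < n" for j
        using elim(1) that by (metis ennreal_of_nat_eq_real_of_nat ennreal_less_top infinity_ennreal_def lessThan_iff)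
      have "(LINT x|N \<omega>. s x) = (LINT x|N \<omega>. (\<Sum>j<n. h j * indicator (A j) x))"
        using sum_eq[of _ "\<lambda>x. x"] space_N[OF elim(2)] by (intro Bochner_Integration.integral_cong) auto
      also have "\<dots> = (\<Sum>j<n. LINT x|N \<omega>. h j * indicator (A j) x)"
        using fin sets_N[OF elim(2)] by (intro Bochner_Integration.integral_sum integrable_mult_right) (auto simp: integrable_indicator_iff)
      also have "\<dots> = (\<Sum>j<n. h j * enn2real (emeasure (N \<omega>) (A j)))"
        using sets.sets_into_space[OF A] space_N[OF elim(2)]
        by (intro sum.cong refl) (simp add: measure_def Int_absorb2)
      finally show ?case .
    qed
  qed
  have "(CLINT \<omega>|M. iexp (LINT x|N \<omega>. s x)) = (CLINT \<omega>|M. (\<Prod>j<n. iexp (h j * enn2real (emeasure (N \<omega>) (A j)))))"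
  proof (rule integral_cong_AE)
    show "AE \<omega> in M. iexp (LINT x|N \<omega>. s x) = (\<Prod>j<n. iexp (h j * enn2real (emeasure (N \<omega>) (A j))))"
      using N_int by eventually_elim (simp add: exp_sum sum_distrib_left)
  qed measurable
  also have "\<dots> = (\<Prod>j<n. CLINT \<omega>|M. iexp (h j * enn2real (emeasure (N \<omega>) (A j))))"
  proof (rule indep_vars_lebesgue_integral)
    have "indep_vars (\<lambda>_. borel) (\<lambda>j \<omega>. emeasure (N \<omega>) (A j)) {..<n}"
      using disj by (intro indep_N) auto
    then show "indep_vars (\<lambda>_. borel) (\<lambda>j \<omega>. iexp (h j * enn2real (emeasure (N \<omega>) (A j)))) {..<n}"
      by (rule indep_vars_compose2[where Y="\<lambda>j x. iexp (h j * enn2real x)"]) measurable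
    show "integrable M (\<lambda>\<omega>. iexp (h j * enn2real (emeasure (N \<omega>) (A j))))" for j
      by (rule integrable_const_bound[where B=1]) auto
  qed simp
  also have "\<dots> = (\<Prod>j<n. exp (of_real (measure \<mu> (A j)) * (iexp (h j) - 1)))"
    using Afin by (intro prod.cong refl char_emeasure_N) auto
  also have "\<dots> = exp (\<Sum>j<n. of_real (measure \<mu> (A j)) * (iexp (h j) - 1))"
    by (simp add: exp_sum)
  also have "(\<Sum>j<n. of_real (measure \<mu> (A j)) * (iexp (h j) - 1)) = (\<Sum>j<n. CLINT x|\<mu>. (iexp (h j) - 1) * of_real (indicator (A j) x))"
    using sets.sets_into_space[OF A] by (intro sum.cong refl) (simp add: Int_absorb2)
  also have "\<dots> = (CLINT x|\<mu>. (\<Sum>j<n. (iexp (h j) - 1) * of_real (indicator (A j) x)))"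
    using Afin by (intro Bochner_Integration.integral_sum[symmetric] integrable_mult_right integrable_of_real)
      (auto simp: integrable_indicator_iff)
  also have "\<dots> = (CLINT x|\<mu>. iexp (s x) - 1)"
  proof (rule Bochner_Integration.integral_cong)
    fix x assume "x \<in> space \<mu>"
    then show "(\<Sum>j<n. (iexp (h j) - 1) * of_real (indicator (A j) x)) = iexp (s x) - 1"
    proof -
      have "complex_of_real (indicator (A j) x) = indicator (A j) x" for j by (simp add: indicator_def)
      then show ?thesis using sum_eq[OF \<open>x \<in> space \<mu>\<close>, of "\<lambda>x. iexp x - 1"] by (simp only:) simp
    qed
  qed simp
  finally show ?thesis .
qed

text \<open>Approximation by simple functions bounded by 2 |f|. Dominated convergence is applied at
  three levels: pathwise under N, under M with the bound 1, and under \<mu>, where |iexp(a) - 1|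
  \<le> |a| makes plain integrability of f sufficient.\<close>

theorem char_integral_N:
  fixes f :: "'a \<Rightarrow> real"
  assumes f: "integrable \<mu> f"
  shows "(CLINT \<omega>|M. iexp (LINT x|N \<omega>. f x)) = exp (CLINT x|\<mu>. iexp (f x) - 1)"
proof -
  have fm [measurable]: "f \<in> borel_measurable \<mu>" using f by simp
  obtain s where "\<forall>i. simple_function \<mu> (s i)" "\<forall>x\<in>space \<mu>. (\<lambda>i. s i x) \<longlonglongrightarrow> f x"
    "\<forall>i. \<forall>x\<in>space \<mu>. dist (s i x) 0 \<le> 2 * dist (f x) 0"
    using borel_measurable_implies_sequence_metric[OF fm, of 0] by blast
  then have s: "\<And>i. simple_function \<mu> (s i)" "\<And>x. x \<in> space \<mu> \<Longrightarrow> (\<lambda>i. s i x) \<longlonglongrightarrow> f x"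
    "\<And>i x. x \<in> space \<mu> \<Longrightarrow> dist (s i x) 0 \<le> 2 * dist (f x) 0"
    by simp_all
  have sm [measurable]: "s i \<in> borel_measurable \<mu>" for i
    using s(1) by (rule borel_measurable_simple_function)
  have f2: "integrable \<mu> (\<lambda>x. 2 * \<bar>f x\<bar>)" using f by simp
  have si: "integrable \<mu> (s i)" for i
    using s(3)[of _ i] by (intro Bochner_Integration.integrable_bound[OF f2]) auto
  have "(\<lambda>i. CLINT \<omega>|M. iexp (LINT x|N \<omega>. s i x)) \<longlonglongrightarrow> (CLINT \<omega>|M. iexp (LINT x|N \<omega>. f x))"
  proof (rule integral_dominated_convergence[where w="\<lambda>_. 1"])
    show "AE \<omega> in M. (\<lambda>i. iexp (LINT x|N \<omega>. s i x)) \<longlonglongrightarrow> iexp (LINT x|N \<omega>. f x)"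
      using AE_integrable_N[OF f] AE_space
    proof eventually_elim
      case (elim \<omega>)
      have "(\<lambda>i. LINT x|N \<omega>. s i x) \<longlonglongrightarrow> (LINT x|N \<omega>. f x)"
      proof (rule integral_dominated_convergence[where w="\<lambda>x. 2 * \<bar>f x\<bar>"])
        show "integrable (N \<omega>) (\<lambda>x. 2 * \<bar>f x\<bar>)" using elim by simp
        show "f \<in> borel_measurable (N \<omega>)" "s i \<in> borel_measurable (N \<omega>)" for i
          using measurable_N[OF elim(2)] fm sm by blast+
      qed (use s space_N[OF elim(2)] in auto)
      then show ?case by (intro tendsto_intros)
    qed
  qed auto
  moreover have "(\<lambda>i. CLINT \<omega>|M. iexp (LINT x|N \<omega>. s i x)) \<longlonglongrightarrow> exp (CLINT x|\<mu>. iexp (f x) - 1)"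
    unfolding char_integral_N_simple[OF s(1) si]
  proof (intro tendsto_exp integral_dominated_convergence[where w="\<lambda>x. 2 * \<bar>f x\<bar>"] f2)
    show "AE x in \<mu>. (\<lambda>i. iexp (s i x) - 1) \<longlonglongrightarrow> iexp (f x) - 1"
      using s(2) by (intro AE_I2 tendsto_intros) auto
    show "AE x in \<mu>. norm (iexp (s i x) - 1) \<le> 2 * \<bar>f x\<bar>" for i
      using s(3)[of _ i] by (intro AE_I2 order_trans[OF norm_iexp_minus_1_le]) auto
  qed measurable
  ultimately show ?thesis by (rule LIMSEQ_unique)
qed

end

section \<open>Integrals of the kernel against a jump measure\<close>

text \<open>Negative times are cut off because \<open>kfun r\<close> is known to be square
  integrable only for 0 \<le> r. The cut-off gives a measurable function on the whole line that can
  be written as an integral.\<close>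

definition kappa :: "L2D \<Rightarrow> real \<Rightarrow> real" where
  "kappa F r = (if 0 \<le> r then inner (L2_of (kfun r)) F else 0)"

definition kappa_lift :: "real \<Rightarrow> L2D \<Rightarrow> real \<times> real \<Rightarrow> real" where
  "kappa_lift t F p = indicator {0..t} (fst p) * (snd p * kappa F (t - fst p))"

definition k_lift :: "real \<Rightarrow> real \<Rightarrow> real \<times> real \<Rightarrow> real" where
  "k_lift t y p = indicator {0..t} (fst p) * (snd p * kfun (t - fst p) y)"

text \<open>A common majorant: max 1 |u| is the weight whose m-integral is finite, and (t-s)^(-3/4)
  bounds the norm of k_(t-s). Because of the extra 1 the function is at least 1 on the strip of
  times in [0,t], so its integral also bounds the mass of the strip.\<close>

definition jump_bound :: "real \<Rightarrow> real \<times> real \<Rightarrow> real" where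
  "jump_bound t p = indicator {0..t} (fst p) * (max 1 \<bar>snd p\<bar> * (1 + (t - fst p) powr (-3/4)))"

lemma kappa_measurable [measurable]: "kappa F \<in> borel_measurable borel"
proof -
  obtain f where f: "square_integrable_D f" "F = L2_of f" by (rule L2_of_cases)
  have fm [measurable]: "f \<in> borel_measurable leb_D" using f by (simp add: square_integrable_D_def)
  have [measurable]: "(\<lambda>q. snd q) \<in> borel_measurable (borel \<Otimes>\<^sub>M leb_D)"
    by (rule measurable_compose[OF measurable_snd measurable_ident_leb_D])
  have "(\<lambda>r. LINT y|leb_D. kfun r y * f y) \<in> borel_measurable borel"
    by (rule leb_D.borel_measurable_lebesgue_integral) (simp add: split_beta')
  then have "(\<lambda>r. if 0 \<le> r then LINT y|leb_D. kfun r y * f y else 0) \<in> borel_measurable borel" by measurable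
  moreover have "kappa F = (\<lambda>r. if 0 \<le> r then LINT y|leb_D. kfun r y * f y else 0)"
    by (auto simp: kappa_def f inner_L2_of square_integrable_D_kfun)
  ultimately show ?thesis by simp
qed

lemma abs_kappa_le: "\<bar>kappa F r\<bar> \<le> r powr (-3/4) * norm F"
proof (cases "0 \<le> r")
  case True
  have "\<bar>kappa F r\<bar> \<le> norm (L2_of (kfun r)) * norm F"
    using True Cauchy_Schwarz_ineq2[of "L2_of (kfun r)" F] by (simp add: kappa_def)
  also have "\<dots> \<le> r powr (-3/4) * norm F" by (intro mult_right_mono norm_kfun_le True) simp
  finally show ?thesis .
qed (simp add: kappa_def)

lemma abs_kappa_lift_le: "\<bar>kappa_lift t F p\<bar> \<le> norm F * jump_bound t p"
proof -
  have "\<bar>snd p\<bar> * \<bar>kappa F (t - fst p)\<bar> \<le> max 1 \<bar>snd p\<bar> * ((1 + (t - fst p) powr (-3/4)) * norm F)"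
  proof (intro mult_mono)
    have "\<bar>kappa F (t - fst p)\<bar> \<le> (t - fst p) powr (-3/4) * norm F" by (rule abs_kappa_le)
    also have "\<dots> \<le> (1 + (t - fst p) powr (-3/4)) * norm F" by (intro mult_right_mono) auto
    finally show "\<bar>kappa F (t - fst p)\<bar> \<le> (1 + (t - fst p) powr (-3/4)) * norm F" .
  qed auto
  then show ?thesis by (simp add: kappa_lift_def jump_bound_def abs_mult indicator_def mult_ac)
qed

lemma jump_bound_nonneg: "0 \<le> jump_bound t p"
  by (simp add: jump_bound_def)

locale jump_measure =
  fixes m :: "real measure"
  assumes m_sets: "sets m = sets (restrict_space borel (- {0}))"
    and m_finite: "finite_measure (density m (\<lambda>u. ennreal (max 1 \<bar>u\<bar>)))"
begin

lemma space_m: "space m = - {0}"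
  using sets_eq_imp_space_eq[OF m_sets] by (simp add: space_restrict_space)

lemma measurable_m: "(\<lambda>u. u) \<in> borel_measurable m"
proof -
  have "(\<lambda>u. u) \<in> borel_measurable (restrict_space borel (- {0::real}))"
    by (rule measurable_restrict_space1) simp
  then show ?thesis using m_sets measurable_cong_sets by blast
qed

lemma measurable_mI:
  assumes "f \<in> borel \<rightarrow>\<^sub>M K"
  shows "f \<in> m \<rightarrow>\<^sub>M K"
  using measurable_compose[OF measurable_m assms] .

lemma nn_integral_m_finite: "(\<integral>\<^sup>+u. ennreal (max 1 \<bar>u\<bar>) \<partial>m) < \<infinity>"
proof -
  interpret d: finite_measure "density m (\<lambda>u. ennreal (max 1 \<bar>u\<bar>))" by (rule m_finite)
  have "emeasure (density m (\<lambda>u. ennreal (max 1 \<bar>u\<bar>))) (space m) = (\<integral>\<^sup>+u. ennreal (max 1 \<bar>u\<bar>) * indicator (space m) u \<partial>m)"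
    by (rule emeasure_density) (auto intro: measurable_mI)
  also have "\<dots> = (\<integral>\<^sup>+u. ennreal (max 1 \<bar>u\<bar>) \<partial>m)" by (intro nn_integral_cong) simp
  finally show ?thesis using d.emeasure_finite[of "space m"] by (simp add: less_top)
qed

lemma finite_measure_m: "finite_measure m"
proof (rule finite_measureI)
  have "emeasure m (space m) = (\<integral>\<^sup>+u. 1 \<partial>m)" by simp
  also have "\<dots> \<le> (\<integral>\<^sup>+u. ennreal (max 1 \<bar>u\<bar>) \<partial>m)"
    by (intro nn_integral_mono) (simp add: ennreal_leI flip: ennreal_1)
  finally show "emeasure m (space m) \<noteq> \<infinity>" using nn_integral_m_finite by auto
qed

sublocale m: finite_measure m by (rule finite_measure_m)

lemma space_intensity: "space (intensity m) = {0..} \<times> - {0}"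
  by (simp add: intensity_def space_pair_measure space_restrict_space space_m)

lemma measurable_intensity_fst: "fst \<in> borel_measurable (intensity m)"
proof -
  have "(\<lambda>s. s) \<in> borel_measurable (restrict_space lborel {0::real..})"
    by (rule measurable_restrict_space1) simp
  from measurable_compose[OF measurable_fst this] show ?thesis unfolding intensity_def .
qed

lemma measurable_intensity_snd: "snd \<in> borel_measurable (intensity m)"
  unfolding intensity_def using measurable_compose[OF measurable_snd measurable_m] .

lemma measurable_intensityI:
  assumes "f \<in> borel \<Otimes>\<^sub>M borel \<rightarrow>\<^sub>M K"
  shows "f \<in> intensity m \<rightarrow>\<^sub>M K"
  using measurable_compose[OF measurable_Pair[OF measurable_intensity_fst measurable_intensity_snd] assms] by simp

lemma sigma_finite_nonneg: "sigma_finite_measure (restrict_space lborel {0::real..})"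
  by (rule sigma_finite_measure_restrict_space) (auto intro: sigma_finite_lborel)

lemma nn_integral_intensity:
  assumes f: "f \<in> borel_measurable (intensity m)"
  shows "(\<integral>\<^sup>+p. f p \<partial>intensity m) = (\<integral>\<^sup>+s. (\<integral>\<^sup>+u. f (s, u) \<partial>m) * indicator {0..} s \<partial>lborel)"
proof -
  have "(\<integral>\<^sup>+p. f p \<partial>intensity m) = (\<integral>\<^sup>+s. \<integral>\<^sup>+u. f (s, u) \<partial>m \<partial>restrict_space lborel {0..})"
    unfolding intensity_def by (rule m.nn_integral_fst[symmetric]) (use f in \<open>simp add: intensity_def\<close>)
  then show ?thesis by (subst (asm) nn_integral_restrict_space) auto
qed

lemma integral_intensity:
  fixes f :: "real \<times> real \<Rightarrow> 'b::{banach, second_countable_topology}"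
  assumes f: "integrable (intensity m) f"
  shows "(\<integral>p. f p \<partial>intensity m) = (\<integral>s. indicator {0..} s *\<^sub>R (\<integral>u. f (s, u) \<partial>m) \<partial>lborel)"
proof -
  interpret nonneg: sigma_finite_measure "restrict_space lborel {0::real..}" by (rule sigma_finite_nonneg)
  interpret p: pair_sigma_finite "restrict_space lborel {0::real..}" m ..
  have "(\<integral>p. f p \<partial>intensity m) = (\<integral>s. \<integral>u. f (s, u) \<partial>m \<partial>restrict_space lborel {0..})"
    unfolding intensity_def by (rule p.integral_fst'[symmetric]) (use f in \<open>simp add: intensity_def\<close>)
  then show ?thesis by (subst (asm) integral_restrict_space) auto
qed

lemma borel_measurable_kappa_lift [measurable]: "kappa_lift t F \<in> borel_measurable (intensity m)"
  unfolding kappa_lift_def[abs_def] by (rule measurable_intensityI) measurable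

lemma borel_measurable_k_lift [measurable]: "k_lift t y \<in> borel_measurable (intensity m)"
  unfolding k_lift_def[abs_def] by (rule measurable_intensityI) measurable

lemma borel_measurable_jump_bound [measurable]: "jump_bound t \<in> borel_measurable (intensity m)"
  unfolding jump_bound_def[abs_def] by (rule measurable_intensityI) measurable

text \<open>The exponent -3/4 exceeds -1. After the reflection s to t - s, the primitive gives the
  value t + 4 t^(1/4).\<close>

lemma nn_integral_powr_finite: "(\<integral>\<^sup>+s. ennreal (indicator {0..t} s * (1 + (t - s) powr (-3/4))) \<partial>lborel) < \<infinity>"
proof (cases "0 \<le> t")
  case True
  let ?f = "\<lambda>s. ennreal (indicator {0..t} s * (1 + (t - s) powr (-3/4)))"
  have "(\<integral>\<^sup>+s. ?f s \<partial>lborel) = (\<integral>\<^sup>+s. ?f (t + -1 * s) \<partial>lborel)"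
    using nn_integral_real_affine[of ?f "-1" t] by simp
  also have "\<dots> = (\<integral>\<^sup>+s. ennreal (1 + s powr (-3/4)) * indicator {0..t} s \<partial>lborel)"
    by (intro nn_integral_cong) (auto simp: indicator_def)
  also have "\<dots> = ennreal (t + t powr (1/4) / (1/4))"
  proof (rule nn_integral_has_integral_lebesgue')
    have pw: "((\<lambda>s. s powr (-3/4)) has_integral (t powr (-3/4 + 1) / (-3/4 + 1))) {0..t}"
      using True by (intro has_integral_powr_from_0) auto
    have one: "((\<lambda>s. 1::real) has_integral t) {0..t}"
      using has_integral_const_real[of "1::real" 0 t] True by simp
    have "- 3 / 4 + 1 = (1 / 4 :: real)" by simp
    with has_integral_add[OF one pw] show "((\<lambda>s. 1 + s powr (-3/4)) has_integral (t + t powr (1/4) / (1/4))) {0..t}"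
      by (simp only:)
  qed simp
  finally show ?thesis by simp
qed simp

lemma nn_integral_jump_bound_finite: "(\<integral>\<^sup>+p. ennreal (jump_bound t p) \<partial>intensity m) < \<infinity>"
proof -
  let ?g = "\<lambda>s. ennreal (indicator {0..t} s * (1 + (t - s) powr (-3/4)))"
  have "(\<integral>\<^sup>+p. ennreal (jump_bound t p) \<partial>intensity m)
     = (\<integral>\<^sup>+s. (\<integral>\<^sup>+u. ennreal (jump_bound t (s, u)) \<partial>m) * indicator {0..} s \<partial>lborel)"
    by (rule nn_integral_intensity) measurable
  also have "\<dots> \<le> (\<integral>\<^sup>+s. ?g s * (\<integral>\<^sup>+u. ennreal (max 1 \<bar>u\<bar>) \<partial>m) \<partial>lborel)"
  proof (rule nn_integral_mono)
    fix s :: real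
    have "(\<integral>\<^sup>+u. ennreal (jump_bound t (s, u)) \<partial>m) = (\<integral>\<^sup>+u. ?g s * ennreal (max 1 \<bar>u\<bar>) \<partial>m)"
      by (intro nn_integral_cong) (simp add: jump_bound_def indicator_def mult.commute flip: ennreal_mult)
    also have "\<dots> = ?g s * (\<integral>\<^sup>+u. ennreal (max 1 \<bar>u\<bar>) \<partial>m)"
      by (rule nn_integral_cmult) (auto intro: measurable_mI)
    finally show "(\<integral>\<^sup>+u. ennreal (jump_bound t (s, u)) \<partial>m) * indicator {0..} s \<le> ?g s * (\<integral>\<^sup>+u. ennreal (max 1 \<bar>u\<bar>) \<partial>m)"
      by (simp add: indicator_def)
  qed
  also have "\<dots> = (\<integral>\<^sup>+s. ?g s \<partial>lborel) * (\<integral>\<^sup>+u. ennreal (max 1 \<bar>u\<bar>) \<partial>m)"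
    by (rule nn_integral_multc) measurable
  also have "\<dots> < \<infinity>" using nn_integral_powr_finite[of t] nn_integral_m_finite by (simp add: ennreal_mult_less_top)
  finally show ?thesis .
qed

lemma integrable_kappa_lift_measure:
  assumes \<nu>: "sets \<nu> = sets (intensity m)" and fin: "(\<integral>\<^sup>+p. ennreal (jump_bound t p) \<partial>\<nu>) < \<infinity>"
  shows "integrable \<nu> (kappa_lift t F)"
proof (rule Bochner_Integration.integrable_bound)
  have m: "measurable \<nu> borel = measurable (intensity m) borel" using \<nu> by (rule measurable_cong_sets) simp
  show "integrable \<nu> (\<lambda>p. norm F * jump_bound t p)"
    using fin borel_measurable_jump_bound[of t] by (intro integrable_mult_right integrableI_bounded) (auto simp: m jump_bound_nonneg)
  show "kappa_lift t F \<in> borel_measurable \<nu>" by (simp add: m)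
  show "AE p in \<nu>. norm (kappa_lift t F p) \<le> norm (norm F * jump_bound t p)"
    using abs_kappa_lift_le[of t F] by (intro AE_I2) (simp add: jump_bound_nonneg)
qed

text \<open>The following facts are applied both to a realisation of the Poisson random measure and to
  its intensity.\<close>

lemma
  assumes \<nu>: "sets \<nu> = sets (intensity m)" and fin: "(\<integral>\<^sup>+p. ennreal (jump_bound t p) \<partial>\<nu>) < \<infinity>" and t: "0 \<le> t"
  shows integrable_k_lift_measure: "0 < y \<Longrightarrow> integrable \<nu> (k_lift t y)"
    and square_integrable_D_k_lift: "square_integrable_D (\<lambda>y. LINT p|\<nu>. k_lift t y p)"
    and inner_integral_k_lift: "inner (L2_of (\<lambda>y. LINT p|\<nu>. k_lift t y p)) F = (LINT p|\<nu>. kappa_lift t F p)"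
proof -
  have m: "measurable \<nu> borel = measurable (intensity m) borel" using \<nu> by (rule measurable_cong_sets) simp
  have bm [measurable]: "jump_bound t \<in> borel_measurable \<nu>" "k_lift t y \<in> borel_measurable \<nu>" "kappa_lift t F \<in> borel_measurable \<nu>"
    "fst \<in> borel_measurable \<nu>" "snd \<in> borel_measurable \<nu>" for t y F
    using measurable_intensity_fst measurable_intensity_snd by (simp_all add: m)
  show "integrable \<nu> (k_lift t y)" if y: "0 < y"
  proof (rule Bochner_Integration.integrable_bound)
    show "integrable \<nu> (\<lambda>p. (8 * sqrt t / y ^ 3) * jump_bound t p)"
      using fin by (intro integrable_mult_right integrableI_bounded) (auto simp: jump_bound_nonneg)
    show "AE p in \<nu>. norm (k_lift t y p) \<le> norm ((8 * sqrt t / y ^ 3) * jump_bound t p)"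
    proof (rule AE_I2)
      fix p
      show "norm (k_lift t y p) \<le> norm ((8 * sqrt t / y ^ 3) * jump_bound t p)"
      proof (cases "fst p \<in> {0..t}")
        case True
        then have k: "0 \<le> kfun (t - fst p) y" "kfun (t - fst p) y \<le> 8 * sqrt t / y ^ 3"
          using y by (auto intro: kfun_nonneg kfun_bound)
        have "\<bar>snd p\<bar> * kfun (t - fst p) y \<le> max 1 \<bar>snd p\<bar> * (1 + (t - fst p) powr (-3/4)) * (8 * sqrt t / y ^ 3)"
        proof (intro mult_mono k)
          have "\<bar>snd p\<bar> \<le> max 1 \<bar>snd p\<bar> * 1" by simp
          also have "\<dots> \<le> max 1 \<bar>snd p\<bar> * (1 + (t - fst p) powr (-3/4))" by (intro mult_left_mono) auto
          finally show "\<bar>snd p\<bar> \<le> max 1 \<bar>snd p\<bar> * (1 + (t - fst p) powr (-3/4))" .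
        qed (use k in auto)
        then show ?thesis using True k t y by (simp add: k_lift_def jump_bound_def abs_mult mult_ac)
      qed (simp add: k_lift_def)
    qed
  qed simp
  \<comment> \<open>Nothing makes \<nu> sigma-finite, so Fubini cannot be applied to it directly.
    Its restriction to the strip is finite, being dominated by the integral of
    \<open>jump_bound\<close>, and the integrands live on the strip.\<close>
  define S where "S = {0..t} \<times> UNIV \<inter> space \<nu>"
  have S [measurable]: "S \<in> sets \<nu>"
  proof -
    have "S = fst -` {0..t} \<inter> space \<nu>" by (auto simp: S_def)
    then show ?thesis using measurable_sets[OF bm(4), of "{0..t}"] by simp
  qed
  define \<nu>' where "\<nu>' = density \<nu> (indicator S)"
  have \<nu>'_sets [measurable_cong]: "sets \<nu>' = sets \<nu>" by (simp add: \<nu>'_def)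
  have bm' [measurable]: "fst \<in> borel_measurable \<nu>'" "snd \<in> borel_measurable \<nu>'" by measurable
  have "finite_measure \<nu>'"
  proof (rule finite_measureI)
    have "emeasure \<nu>' (space \<nu>') = (\<integral>\<^sup>+p. indicator S p * indicator (space \<nu>) p \<partial>\<nu>)"
      unfolding \<nu>'_def by (subst emeasure_density) auto
    also have "\<dots> \<le> (\<integral>\<^sup>+p. ennreal (jump_bound t p) \<partial>\<nu>)"
    proof (rule nn_integral_mono)
      fix p
      have "1 * 1 \<le> max 1 \<bar>snd p\<bar> * (1 + (t - fst p) powr (-3/4))" by (intro mult_mono) auto
      then show "indicator S p * indicator (space \<nu>) p \<le> ennreal (jump_bound t p)"
        by (auto simp: S_def jump_bound_def indicator_def mem_Times_iff split: if_splits)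
    qed
    finally show "emeasure \<nu>' (space \<nu>') \<noteq> \<infinity>" using fin by auto
  qed
  then interpret \<nu>': finite_measure \<nu>' .
  interpret pr: pair_sigma_finite leb_D \<nu>' ..
  have pm [measurable]: "(\<lambda>q. fst q) \<in> borel_measurable (leb_D \<Otimes>\<^sub>M \<nu>')"
    "(\<lambda>q. fst (snd q)) \<in> borel_measurable (leb_D \<Otimes>\<^sub>M \<nu>')"
    "(\<lambda>q. snd (snd q)) \<in> borel_measurable (leb_D \<Otimes>\<^sub>M \<nu>')"
    using measurable_compose[OF measurable_fst measurable_ident_leb_D]
      measurable_compose[OF measurable_snd bm'(1)] measurable_compose[OF measurable_snd bm'(2)] by auto
  have km [measurable]: "(\<lambda>q. k_lift t (fst q) (snd q)) \<in> borel_measurable (leb_D \<Otimes>\<^sub>M \<nu>')"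
    unfolding k_lift_def by measurable
  have km1 [measurable]: "(\<lambda>y. k_lift t y p) \<in> borel_measurable leb_D" for p
    unfolding k_lift_def using measurable_ident_leb_D by measurable
  have int_eq: "(LINT p|\<nu>'. h p) = (LINT p|\<nu>. h p)"
    if "h \<in> borel_measurable \<nu>" "\<And>p. fst p \<notin> {0..t} \<Longrightarrow> h p = 0" for h :: "real \<times> real \<Rightarrow> real"
  proof -
    have "(LINT p|\<nu>'. h p) = (LINT p|density \<nu> (\<lambda>p. ennreal (indicator S p)). h p)"
      by (simp add: \<nu>'_def ennreal_indicator)
    also have "\<dots> = (LINT p|\<nu>. indicator S p *\<^sub>R h p)"
      using that by (subst integral_density) auto
    also have "\<dots> = (LINT p|\<nu>. h p)"
      using that(2) by (intro Bochner_Integration.integral_cong) (auto simp: S_def indicator_def mem_Times_iff)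
    finally show ?thesis .
  qed
  have nn_le: "(\<integral>\<^sup>+p. h p \<partial>\<nu>') \<le> (\<integral>\<^sup>+p. h p \<partial>\<nu>)" if [measurable]: "h \<in> borel_measurable \<nu>" for h
    unfolding \<nu>'_def by (subst nn_integral_density) (auto intro!: nn_integral_mono simp: indicator_def)
  define w where "w p = (t - fst p) powr (-3/4)" for p :: "real \<times> real"
  have w0: "0 \<le> w p" for p by (simp add: w_def)
  have wm [measurable]: "w \<in> borel_measurable \<nu>'" "w \<in> borel_measurable \<nu>" unfolding w_def[abs_def] by measurable
  \<comment> \<open>Weighted Cauchy-Schwarz in p, with |k_lift| = sqrt a sqrt b. The factor a has
    finite integral A by \<open>jump_bound\<close>. The y-integral of b is at most |u| w^2 / w = a,
    again with p-integral A. Hence the squared L2 norm of Z is at most A^2.\<close>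
  define a where "a p = indicator {0..t} (fst p) * (\<bar>snd p\<bar> * w p)" for p
  have am [measurable]: "a \<in> borel_measurable \<nu>'" "a \<in> borel_measurable \<nu>" unfolding a_def[abs_def] by measurable
  have a0: "0 \<le> a p" for p using w0 by (simp add: a_def)
  have afin: "(\<integral>\<^sup>+p. ennreal (a p) \<partial>\<nu>') < \<infinity>"
  proof -
    have "a p \<le> jump_bound t p" for p
    proof -
      have "\<bar>snd p\<bar> * w p \<le> max 1 \<bar>snd p\<bar> * (1 + w p)" by (intro mult_mono) (auto simp: w0)
      then show ?thesis by (simp add: a_def jump_bound_def w_def indicator_def)
    qed
    then have "(\<integral>\<^sup>+p. ennreal (a p) \<partial>\<nu>') \<le> (\<integral>\<^sup>+p. ennreal (jump_bound t p) \<partial>\<nu>')"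
      by (intro nn_integral_mono ennreal_leI)
    also have "\<dots> \<le> (\<integral>\<^sup>+p. ennreal (jump_bound t p) \<partial>\<nu>)" by (rule nn_le) simp
    finally show ?thesis using fin by (rule le_less_trans)
  qed
  define A where "A = enn2real (\<integral>\<^sup>+p. ennreal (a p) \<partial>\<nu>')"
  have A: "ennreal A = (\<integral>\<^sup>+p. ennreal (a p) \<partial>\<nu>')" "0 \<le> A"
    using afin by (simp_all add: A_def less_top)
  define b where "b y p = indicator {0..t} (fst p) * (\<bar>snd p\<bar> * ((kfun (t - fst p) y)\<^sup>2 / w p))" for y p
  have b0: "0 \<le> b y p" for y p using w0 by (simp add: b_def)
  have bmeas [measurable]: "(\<lambda>q. b (fst q) (snd q)) \<in> borel_measurable (leb_D \<Otimes>\<^sub>M \<nu>')"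
    unfolding b_def w_def by measurable
  have bm1 [measurable]: "b y \<in> borel_measurable \<nu>'" for y
    unfolding b_def[abs_def] w_def by measurable
  \<comment> \<open>At time s = t the weight w is 0 and the quotient in b is 0 by convention; the
    identity persists since \<open>kfun 0\<close> vanishes.\<close>
  have k_eq: "\<bar>k_lift t y p\<bar> = sqrt (a p) * sqrt (b y p)" for y p
  proof (cases "fst p \<in> {0..t} \<and> fst p \<noteq> t")
    case True
    then have "0 < w p" by (auto simp: w_def)
    then have "a p * b y p = (k_lift t y p)\<^sup>2"
      using True by (simp add: a_def b_def k_lift_def power2_eq_square)
    then show ?thesis by (simp flip: real_sqrt_mult)
  qed (auto simp: k_lift_def a_def b_def w_def)
  define Z where "Z y = (LINT p|\<nu>'. k_lift t y p)" for y
  have Z_eq: "Z y = (LINT p|\<nu>. k_lift t y p)" for y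
    unfolding Z_def by (rule int_eq) (auto simp: k_lift_def)
  have Zm: "Z \<in> borel_measurable leb_D"
    unfolding Z_def[abs_def] by (rule \<nu>'.borel_measurable_lebesgue_integral) (simp add: split_beta')
  have pt: "ennreal ((Z y)\<^sup>2) \<le> ennreal A * (\<integral>\<^sup>+p. ennreal (b y p) \<partial>\<nu>')" for y
  proof -
    have "ennreal \<bar>Z y\<bar> \<le> (\<integral>\<^sup>+p. ennreal \<bar>k_lift t y p\<bar> \<partial>\<nu>')"
    proof (cases "integrable \<nu>' (k_lift t y)")
      case True
      then show ?thesis using integral_norm_bound_ennreal[OF True] by (simp add: Z_def)
    qed (simp add: Z_def not_integrable_integral_eq)
    also have "\<dots> = (\<integral>\<^sup>+p. ennreal (sqrt (a p)) * ennreal (sqrt (b y p)) \<partial>\<nu>')"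
      by (simp add: k_eq a0 b0 flip: ennreal_mult)
    finally have "(ennreal \<bar>Z y\<bar>)\<^sup>2 \<le> (\<integral>\<^sup>+p. ennreal (sqrt (a p)) * ennreal (sqrt (b y p)) \<partial>\<nu>')\<^sup>2"
      by (intro power_mono) auto
    also have "\<dots> \<le> (\<integral>\<^sup>+p. (ennreal (sqrt (a p)))\<^sup>2 \<partial>\<nu>') * (\<integral>\<^sup>+p. (ennreal (sqrt (b y p)))\<^sup>2 \<partial>\<nu>')"
      by (rule Cauchy_Schwarz_nn_integral) measurable
    also have "\<dots> = ennreal A * (\<integral>\<^sup>+p. ennreal (b y p) \<partial>\<nu>')"
      by (simp add: ennreal_power a0 b0 A)
    finally show ?thesis by (simp add: ennreal_power)
  qed
  have "(\<integral>\<^sup>+y. ennreal ((Z y)\<^sup>2) \<partial>leb_D) \<le> (\<integral>\<^sup>+y. ennreal A * (\<integral>\<^sup>+p. ennreal (b y p) \<partial>\<nu>') \<partial>leb_D)"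
    by (rule nn_integral_mono) (rule pt)
  also have "\<dots> = ennreal A * (\<integral>\<^sup>+y. \<integral>\<^sup>+p. ennreal (b y p) \<partial>\<nu>' \<partial>leb_D)"
    by (rule nn_integral_cmult) (rule \<nu>'.borel_measurable_nn_integral, simp add: split_beta')
  also have "(\<integral>\<^sup>+y. \<integral>\<^sup>+p. ennreal (b y p) \<partial>\<nu>' \<partial>leb_D) = (\<integral>\<^sup>+p. \<integral>\<^sup>+y. ennreal (b y p) \<partial>leb_D \<partial>\<nu>')"
    by (rule pr.Fubini'[symmetric]) (simp add: split_beta')
  also have "\<dots> \<le> (\<integral>\<^sup>+p. ennreal (a p) \<partial>\<nu>')"
  proof (rule nn_integral_mono)
    fix p :: "real \<times> real"
    show "(\<integral>\<^sup>+y. ennreal (b y p) \<partial>leb_D) \<le> ennreal (a p)"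
    proof (cases "fst p \<in> {0..t}")
      case True
      let ?c = "\<bar>snd p\<bar> / w p"
      have km2: "kfun (t - fst p) \<in> borel_measurable leb_D"
        by (intro borel_measurable_kfun measurable_ident_leb_D borel_measurable_const)
      have "(\<integral>\<^sup>+y. ennreal (b y p) \<partial>leb_D) = (\<integral>\<^sup>+y. ennreal ?c * ennreal ((kfun (t - fst p) y)\<^sup>2) \<partial>leb_D)"
        using True w0 by (intro nn_integral_cong) (simp add: b_def flip: ennreal_mult)
      also have "\<dots> = ennreal ?c * (\<integral>\<^sup>+y. ennreal ((kfun (t - fst p) y)\<^sup>2) \<partial>leb_D)"
        by (rule nn_integral_cmult) (rule measurable_compose[OF borel_measurable_power[OF km2] measurable_ennreal])
      also have "\<dots> \<le> ennreal ?c * ennreal ((w p)\<^sup>2)"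
        unfolding w_def using True by (intro mult_left_mono nn_integral_kfun_sq_le) auto
      also have "\<dots> = ennreal (a p)"
        using True w0 by (simp add: a_def power2_eq_square flip: ennreal_mult)
      finally show ?thesis .
    qed (simp add: b_def)
  qed
  also have "\<dots> = ennreal A" by (rule A(1)[symmetric])
  finally have "(\<integral>\<^sup>+y. ennreal ((Z y)\<^sup>2) \<partial>leb_D) \<le> ennreal (A * A)"
    using A(2) by (simp add: ennreal_mult mult_left_mono)
  then have sqZ: "square_integrable_D Z" using A(2) by (intro square_integrable_D_nn_integralI(1)[OF Zm, of "A * A"]) auto
  then show "square_integrable_D (\<lambda>y. LINT p|\<nu>. k_lift t y p)" by (simp add: Z_eq[abs_def])
  obtain f where f: "square_integrable_D f" "F = L2_of f" by (rule L2_of_cases)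
  have fm [measurable]: "f \<in> borel_measurable leb_D" using f by (simp add: square_integrable_D_def)
  \<comment> \<open>The kernel is nonnegative on D, so the absolute double integral equals an
    integral of inner products with |f|, to which the norm bound for k applies.\<close>
  have fabs: "square_integrable_D (\<lambda>y. \<bar>f y\<bar>)" using f(1) by (auto simp: square_integrable_D_def)
  have int: "integrable (leb_D \<Otimes>\<^sub>M \<nu>') (\<lambda>(y, p). k_lift t y p * f y)"
  proof (rule integrableI_bounded)
    show "(\<lambda>(y, p). k_lift t y p * f y) \<in> borel_measurable (leb_D \<Otimes>\<^sub>M \<nu>')"
      by (simp add: split_beta')
    have "(\<integral>\<^sup>+q. ennreal (norm (case q of (y, p) \<Rightarrow> k_lift t y p * f y)) \<partial>(leb_D \<Otimes>\<^sub>M \<nu>'))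
      = (\<integral>\<^sup>+p. \<integral>\<^sup>+y. ennreal \<bar>k_lift t y p * f y\<bar> \<partial>leb_D \<partial>\<nu>')"
      by (subst pr.nn_integral_snd[symmetric]) (simp_all add: split_beta')
    also have "\<dots> \<le> (\<integral>\<^sup>+p. ennreal (a p) * ennreal (norm (L2_of (\<lambda>y. \<bar>f y\<bar>))) \<partial>\<nu>')"
    proof (rule nn_integral_mono)
      fix p :: "real \<times> real"
      show "(\<integral>\<^sup>+y. ennreal \<bar>k_lift t y p * f y\<bar> \<partial>leb_D) \<le> ennreal (a p) * ennreal (norm (L2_of (\<lambda>y. \<bar>f y\<bar>)))"
      proof (cases "fst p \<in> {0..t}")
        case True
        note sq = square_integrable_D_kfun[of "t - fst p"]
        have r: "0 \<le> t - fst p" using True by simp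
        have "(\<integral>\<^sup>+y. ennreal \<bar>k_lift t y p * f y\<bar> \<partial>leb_D) = (\<integral>\<^sup>+y. ennreal (\<bar>snd p\<bar> * (kfun (t - fst p) y * \<bar>f y\<bar>)) \<partial>leb_D)"
          using True r by (intro nn_integral_cong) (auto simp: k_lift_def abs_mult kfun_nonneg)
        also have "\<dots> = ennreal (LINT y|leb_D. \<bar>snd p\<bar> * (kfun (t - fst p) y * \<bar>f y\<bar>))"
          using integrable_mult_D[OF sq[OF r] fabs] r
          by (intro nn_integral_eq_integral) (auto simp: kfun_nonneg intro!: AE_I2)
        also have "(LINT y|leb_D. \<bar>snd p\<bar> * (kfun (t - fst p) y * \<bar>f y\<bar>)) = \<bar>snd p\<bar> * inner (L2_of (kfun (t - fst p))) (L2_of (\<lambda>y. \<bar>f y\<bar>))"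
          using sq[OF r] fabs by (simp add: inner_L2_of)
        also have "ennreal \<dots> \<le> ennreal (\<bar>snd p\<bar> * (w p * norm (L2_of (\<lambda>y. \<bar>f y\<bar>))))"
        proof (intro ennreal_leI mult_left_mono)
          have "inner (L2_of (kfun (t - fst p))) (L2_of (\<lambda>y. \<bar>f y\<bar>)) \<le> norm (L2_of (kfun (t - fst p))) * norm (L2_of (\<lambda>y. \<bar>f y\<bar>))"
            by (rule norm_cauchy_schwarz)
          also have "\<dots> \<le> w p * norm (L2_of (\<lambda>y. \<bar>f y\<bar>))"
            unfolding w_def by (intro mult_right_mono norm_kfun_le r) simp
          finally show "inner (L2_of (kfun (t - fst p))) (L2_of (\<lambda>y. \<bar>f y\<bar>)) \<le> w p * norm (L2_of (\<lambda>y. \<bar>f y\<bar>))" .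
        qed simp
        also have "\<dots> = ennreal (a p) * ennreal (norm (L2_of (\<lambda>y. \<bar>f y\<bar>)))"
          using True w0 by (simp add: a_def mult.assoc flip: ennreal_mult)
        finally show ?thesis .
      qed (simp add: k_lift_def)
    qed
    also have "\<dots> = (\<integral>\<^sup>+p. ennreal (a p) \<partial>\<nu>') * ennreal (norm (L2_of (\<lambda>y. \<bar>f y\<bar>)))"
      by (rule nn_integral_multc) measurable
    also have "\<dots> < \<infinity>" using afin by (simp add: ennreal_mult_less_top)
    finally show "(\<integral>\<^sup>+q. ennreal (norm (case q of (y, p) \<Rightarrow> k_lift t y p * f y)) \<partial>(leb_D \<Otimes>\<^sub>M \<nu>')) < \<infinity>" .
  qed
  have "inner (L2_of Z) F = (LINT y|leb_D. LINT p|\<nu>'. k_lift t y p * f y)"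
    by (simp add: f inner_L2_of sqZ) (simp add: Z_def)
  also have "\<dots> = (LINT p|\<nu>'. LINT y|leb_D. k_lift t y p * f y)"
    by (rule pr.Fubini_integral[symmetric]) (rule int)
  also have "\<dots> = (LINT p|\<nu>'. kappa_lift t F p)"
  proof (rule Bochner_Integration.integral_cong)
    fix p :: "real \<times> real"
    show "(LINT y|leb_D. k_lift t y p * f y) = kappa_lift t F p"
    proof (cases "fst p \<in> {0..t}")
      case True
      then have "(LINT y|leb_D. k_lift t y p * f y) = (LINT y|leb_D. snd p * (kfun (t - fst p) y * f y))"
        by (simp add: k_lift_def mult.assoc)
      then show ?thesis using True f by (simp add: kappa_lift_def kappa_def inner_L2_of square_integrable_D_kfun)
    qed (simp add: k_lift_def kappa_lift_def)
  qed simp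
  also have "\<dots> = (LINT p|\<nu>. kappa_lift t F p)"
    by (rule int_eq) (auto simp: kappa_lift_def)
  finally show "inner (L2_of (\<lambda>y. LINT p|\<nu>. k_lift t y p)) F = (LINT p|\<nu>. kappa_lift t F p)"
    by (simp add: Z_eq[abs_def])
qed

end

section \<open>The Markov property\<close>

text \<open>The inner products of the process are identified with measurable compensated integrals
  only outside a null set, and their values on that set are not controlled. Completeness of the
  probability space closes the gap.\<close>

lemma (in complete_measure) borel_measurable_AE:
  fixes f g :: "'a \<Rightarrow> 'b::topological_space"
  assumes f: "f \<in> borel_measurable M" and ae: "AE x in M. f x = g x"
  shows "g \<in> borel_measurable M"
proof (rule measurableI)
  fix B :: "'b set" assume B: "B \<in> sets borel"
  show "g -` B \<inter> space M \<in> sets M"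
  proof (rule in_sets_AE)
    show "f -` B \<inter> space M \<in> sets M" using f B by (rule measurable_sets)
    show "AE x in M. x \<in> f -` B \<inter> space M \<longleftrightarrow> x \<in> g -` B \<inter> space M"
      using ae by eventually_elim auto
  qed auto
qed auto

text \<open>A linear bound instead of the usual quadratic one, as the integrands in question are
  integrable but need not be square integrable.\<close>

lemma norm_iexp_linear_le: "norm (iexp x - 1 - \<i> * of_real x) \<le> 2 * \<bar>x\<bar>"
proof -
  have "norm (iexp x - 1 - \<i> * of_real x) \<le> norm (iexp x - 1) + norm (\<i> * of_real x)"
    by (rule norm_triangle_ineq4)
  then show ?thesis using norm_iexp_minus_1_le[of x] by (simp add: norm_mult)
qed

lemma measurable_inner_left: "(\<lambda>x::L2D. inner x F) \<in> borel_measurable borel"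
  by (intro borel_measurable_inner borel_measurable_const measurable_ident_sets refl)

lemma measurable_abs_op: "0 \<le> t \<Longrightarrow> abs_op t \<in> borel \<rightarrow>\<^sub>M borel"
  by (intro borel_measurable_continuous_onI linear_continuous_on bounded_linear_abs_op)

text \<open>Self-adjointness moves P_t from the test function onto k_r, where it only advances the
  time. This shifts the kernel of the past to the later observation time.\<close>

lemma kappa_abs_op:
  assumes "0 \<le> t" "0 < r"
  shows "kappa (abs_op t F) r = kappa F (t + r)"
  using assms inner_abs_op[of t "L2_of (kfun r)" F] by (simp add: kappa_def abs_op_kfun)

locale shot_noise = jump_measure m + poisson_measure M "intensity m" N
  for m :: "real measure" and M :: "'w measure" and N +
  assumes M_complete: "complete_measure M"
begin

abbreviation \<mu> :: "(real \<times> real) measure" where "\<mu> \<equiv> intensity m"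

definition X :: "real \<Rightarrow> 'w \<Rightarrow> L2D" where
  "X t \<omega> = L2_of (Z0 m N t \<omega>)"

definition compensated :: "(real \<times> real \<Rightarrow> real) \<Rightarrow> 'w \<Rightarrow> real" where
  "compensated \<phi> \<omega> = (LINT p|N \<omega>. \<phi> p) - (LINT p|\<mu>. \<phi> p)"

definition levy_exponent :: "(real \<times> real \<Rightarrow> real) \<Rightarrow> complex" where
  "levy_exponent \<phi> = (CLINT p|\<mu>. iexp (\<phi> p) - 1 - \<i> * of_real (\<phi> p))"

definition log_char :: "real \<Rightarrow> L2D \<Rightarrow> complex" where
  "log_char t F = (LINT s : {0..t} | lborel. phi m (kappa F s))"

text \<open>The interval is open at s, so that the support in time is disjoint from [0, s], the time
  range of everything observed up to s.\<close>

definition innov :: "real \<Rightarrow> real \<Rightarrow> L2D \<Rightarrow> real \<times> real \<Rightarrow> real" where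
  "innov s t F p = indicator {s<..s+t} (fst p) * (snd p * kappa F (s + t - fst p))"

definition Y :: "real \<Rightarrow> real \<Rightarrow> 'w \<Rightarrow> L2D" where
  "Y s t \<omega> = X (s + t) \<omega> - abs_op t (X s \<omega>)"

lemma Z0_integrand_eq_k_lift:
  assumes "p \<in> space \<mu>"
  shows "indicator ({0..t} \<times> - {0}) p *\<^sub>R Z0_integrand t y p = k_lift t y p"
  using assms by (cases p) (auto simp: space_intensity Z0_integrand_def k_lift_def indicator_def)

lemma set_integrable_Z0_integrand_iff:
  assumes "space \<nu> = space \<mu>"
  shows "set_integrable \<nu> ({0..t} \<times> - {0}) (Z0_integrand t y) \<longleftrightarrow> integrable \<nu> (k_lift t y)"
  unfolding set_integrable_def using assms Z0_integrand_eq_k_lift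
  by (intro Bochner_Integration.integrable_cong) auto

lemma Z0_eq:
  assumes "\<omega> \<in> space M"
  shows "Z0 m N t \<omega> y = (LINT p|N \<omega>. k_lift t y p) - (LINT p|\<mu>. k_lift t y p)"
proof -
  have "set_lebesgue_integral \<nu> ({0..t} \<times> - {0}) (Z0_integrand t y) = (LINT p|\<nu>. k_lift t y p)"
    if "space \<nu> = space \<mu>" for \<nu>
    unfolding set_lebesgue_integral_def using that Z0_integrand_eq_k_lift
    by (intro Bochner_Integration.integral_cong) auto
  from this[of \<mu>] this[OF space_N[OF assms]] show ?thesis by (simp add: Z0_def)
qed

lemma AE_jump_bound_finite: "AE \<omega> in M. (\<integral>\<^sup>+p. ennreal (jump_bound t p) \<partial>N \<omega>) < \<infinity>"
  by (rule AE_nn_integral_N_finite[OF _ nn_integral_jump_bound_finite]) measurable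

lemma integrable_kappa_lift: "integrable \<mu> (kappa_lift t F)"
  by (rule integrable_kappa_lift_measure[OF refl nn_integral_jump_bound_finite])

text \<open>The exceptional set depends on t alone: it is where \<open>jump_bound t\<close> has
  infinite integral under N. Outside it the deterministic facts for a general measure \<nu> apply,
  both to the realisation and to the intensity, for all y and all F together.\<close>

lemma AE_Z0:
  assumes t: "0 \<le> t"
  shows "AE \<omega> in M. (\<forall>y>0. set_integrable (N \<omega>) ({0..t} \<times> - {0}) (Z0_integrand t y)) \<and>
      square_integrable_D (Z0 m N t \<omega>) \<and> (\<forall>F. inner (X t \<omega>) F = compensated (kappa_lift t F) \<omega>)"
  using AE_jump_bound_finite[of t] AE_space
proof eventually_elim
  case (elim \<omega>)
  note N = sets_N[OF elim(2)] elim(1) t and I = refl[of "sets \<mu>"] nn_integral_jump_bound_finite[of t] t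
  note sqN = square_integrable_D_k_lift[OF N] and sqI = square_integrable_D_k_lift[OF I]
  have Z: "Z0 m N t \<omega> = (\<lambda>y. (LINT p|N \<omega>. k_lift t y p) - (LINT p|\<mu>. k_lift t y p))"
    using Z0_eq[OF elim(2)] by (rule ext)
  have "inner (X t \<omega>) F = compensated (kappa_lift t F) \<omega>" for F
    unfolding X_def Z compensated_def L2_of_diff[OF sqN sqI] inner_diff_left
      inner_integral_k_lift[OF N] inner_integral_k_lift[OF I] ..
  moreover have "square_integrable_D (Z0 m N t \<omega>)"
    unfolding Z by (rule square_integrable_D_diff[OF sqN sqI])
  ultimately show ?case
    using integrable_k_lift_measure[OF N] set_integrable_Z0_integrand_iff[OF space_N[OF elim(2)]] by blast
qed

lemma AE_inner_X: "0 \<le> t \<Longrightarrow> AE \<omega> in M. inner (X t \<omega>) F = compensated (kappa_lift t F) \<omega>"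
  using AE_Z0[of t] by (auto elim: eventually_mono)

lemma measurable_compensated [measurable]: "\<phi> \<in> borel_measurable \<mu> \<Longrightarrow> compensated \<phi> \<in> borel_measurable M"
  unfolding compensated_def[abs_def] by (intro borel_measurable_diff measurable_integral_N borel_measurable_const)

lemma measurable_X: "0 \<le> t \<Longrightarrow> X t \<in> M \<rightarrow>\<^sub>M borel"
proof (rule borel_measurable_L2D)
  fix F assume t: "0 \<le> t"
  have "AE \<omega> in M. compensated (kappa_lift t F) \<omega> = inner (X t \<omega>) F"
    using AE_inner_X[OF t, of F] by (rule eventually_mono) simp
  then show "(\<lambda>\<omega>. inner (X t \<omega>) F) \<in> borel_measurable M"
    by (rule complete_measure.borel_measurable_AE[OF M_complete, rotated]) measurable
qed

text \<open>For t = 0 only the time 0 could contribute, and there the convention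
  \<open>kfun 0 y = 0\<close> annihilates the integrand. Hence the initial value is 0 at every
  sample point, which later yields \<open>R_0\<close> as an exact identity.\<close>

lemma X_0: "\<omega> \<in> space M \<Longrightarrow> X 0 \<omega> = 0"
proof -
  assume "\<omega> \<in> space M"
  have "k_lift 0 y p = 0" for y p
    by (simp add: k_lift_def indicator_def)
  then have "Z0 m N 0 \<omega> = (\<lambda>_. 0)" using Z0_eq[OF \<open>\<omega> \<in> space M\<close>] by (auto simp: fun_eq_iff)
  then show ?thesis by (simp add: X_def L2_of_zero)
qed

lemma AE_compensated_add:
  assumes "integrable \<mu> \<phi>" "integrable \<mu> \<psi>"
  shows "AE \<omega> in M. compensated (\<lambda>p. \<phi> p + \<psi> p) \<omega> = compensated \<phi> \<omega> + compensated \<psi> \<omega>"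
  using AE_integrable_N[OF assms(1)] AE_integrable_N[OF assms(2)]
  by eventually_elim (simp add: compensated_def assms)

lemma compensated_scale: "compensated (\<lambda>p. c * \<phi> p) \<omega> = c * compensated \<phi> \<omega>"
  by (simp add: compensated_def right_diff_distrib)

lemma AE_compensated_cong:
  assumes m: "\<phi> \<in> borel_measurable \<mu>" "\<psi> \<in> borel_measurable \<mu>" and ae: "AE p in \<mu>. \<phi> p = \<psi> p"
  shows "AE \<omega> in M. compensated \<phi> \<omega> = compensated \<psi> \<omega>"
  using AE_AE_N[OF ae] AE_space
proof eventually_elim
  case (elim \<omega>)
  have "(LINT p|N \<omega>. \<phi> p) = (LINT p|N \<omega>. \<psi> p)"
    using m elim measurable_N[OF elim(2)] by (intro integral_cong_AE) auto
  moreover have "(LINT p|\<mu>. \<phi> p) = (LINT p|\<mu>. \<psi> p)" using m ae by (rule integral_cong_AE)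
  ultimately show ?case by (simp add: compensated_def)
qed

lemma integrable_levy_exponent:
  assumes \<phi>: "integrable \<mu> \<phi>"
  shows "complex_integrable \<mu> (\<lambda>p. iexp (\<phi> p) - 1 - \<i> * of_real (\<phi> p))"
proof (rule Bochner_Integration.integrable_bound)
  have [measurable]: "\<phi> \<in> borel_measurable \<mu>" using \<phi> by simp
  show "integrable \<mu> (\<lambda>p. 2 * \<bar>\<phi> p\<bar>)" using \<phi> by simp
  show "(\<lambda>p. iexp (\<phi> p) - 1 - \<i> * of_real (\<phi> p)) \<in> borel_measurable \<mu>" by measurable
  show "AE p in \<mu>. norm (iexp (\<phi> p) - 1 - \<i> * of_real (\<phi> p)) \<le> norm (2 * \<bar>\<phi> p\<bar>)"
    using norm_iexp_linear_le by (intro AE_I2) simp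
qed

lemma char_compensated:
  assumes \<phi>: "integrable \<mu> \<phi>"
  shows "(CLINT \<omega>|M. iexp (compensated \<phi> \<omega>)) = exp (levy_exponent \<phi>)"
proof -
  have i: "complex_integrable \<mu> (\<lambda>p. iexp (\<phi> p) - 1)"
  proof -
    have "complex_integrable \<mu> (\<lambda>p. (iexp (\<phi> p) - 1 - \<i> * of_real (\<phi> p)) + \<i> * of_real (\<phi> p))"
      using integrable_levy_exponent[OF \<phi>] \<phi> by (intro Bochner_Integration.integrable_add) auto
    then show ?thesis by simp
  qed
  have "(CLINT \<omega>|M. iexp (compensated \<phi> \<omega>)) = (CLINT \<omega>|M. iexp (- (LINT p|\<mu>. \<phi> p)) * iexp (LINT p|N \<omega>. \<phi> p))"
    by (intro Bochner_Integration.integral_cong refl) (simp add: compensated_def exp_minus exp_diff right_diff_distrib divide_inverse)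
  also have "\<dots> = iexp (- (LINT p|\<mu>. \<phi> p)) * exp (CLINT p|\<mu>. iexp (\<phi> p) - 1)"
    by (simp add: char_integral_N[OF \<phi>])
  also have "\<dots> = exp ((CLINT p|\<mu>. iexp (\<phi> p) - 1) - \<i> * of_real (LINT p|\<mu>. \<phi> p))"
    by (simp add: exp_diff exp_minus divide_inverse mult.commute)
  also have "(CLINT p|\<mu>. iexp (\<phi> p) - 1) - \<i> * of_real (LINT p|\<mu>. \<phi> p) = levy_exponent \<phi>"
    unfolding levy_exponent_def using i \<phi>
    by (subst Bochner_Integration.integral_diff) auto
  finally show ?thesis .
qed

text \<open>Where one of the two integrands vanishes, the function z to iexp(z) - 1 - i z is
  additive, because it is 0 at 0. For characteristic functionals this additivity is the independence
  of compensated integrals with disjoint supports.\<close>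

lemma levy_exponent_add:
  assumes \<phi>: "integrable \<mu> \<phi>" and \<psi>: "integrable \<mu> \<psi>" and disj: "\<And>p. \<phi> p = 0 \<or> \<psi> p = 0"
  shows "levy_exponent (\<lambda>p. \<phi> p + \<psi> p) = levy_exponent \<phi> + levy_exponent \<psi>"
proof -
  have eq: "iexp (\<phi> p + \<psi> p) - 1 - \<i> * of_real (\<phi> p + \<psi> p)
      = (iexp (\<phi> p) - 1 - \<i> * of_real (\<phi> p)) + (iexp (\<psi> p) - 1 - \<i> * of_real (\<psi> p))" for p
    using disj[of p] by auto
  then show ?thesis
    unfolding levy_exponent_def eq
    by (intro Bochner_Integration.integral_add integrable_levy_exponent \<phi> \<psi>)
qed

text \<open>Integrating over the jump size first produces \<open>phi\<close> at each fixed time.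
  Times outside I contribute nothing, as the exponent integrand vanishes at 0.\<close>

lemma levy_exponent_slice:
  assumes I: "I \<subseteq> {0..}" and int: "integrable \<mu> (\<lambda>p. indicator I (fst p) * (snd p * kappa F (c - fst p)))"
  shows "levy_exponent (\<lambda>p. indicator I (fst p) * (snd p * kappa F (c - fst p))) =
    (CLINT s|lborel. indicator I s *\<^sub>R phi m (kappa F (c - s)))"
proof -
  have "levy_exponent (\<lambda>p. indicator I (fst p) * (snd p * kappa F (c - fst p))) =
    (CLINT s|lborel. indicator {0..} s *\<^sub>R (CLINT u|m. iexp (indicator I s * (u * kappa F (c - s))) - 1 - \<i> * of_real (indicator I s * (u * kappa F (c - s)))))"
    unfolding levy_exponent_def by (subst integral_intensity[OF integrable_levy_exponent[OF int]]) simp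
  also have "\<dots> = (CLINT s|lborel. indicator I s *\<^sub>R phi m (kappa F (c - s)))"
    using I by (intro Bochner_Integration.integral_cong refl) (auto simp: indicator_def phi_def)
  finally show ?thesis .
qed

lemma levy_exponent_kappa_lift: "levy_exponent (kappa_lift t F) = log_char t F"
proof -
  have "levy_exponent (kappa_lift t F) = (CLINT s|lborel. indicator {0..t} s *\<^sub>R phi m (kappa F (t - s)))"
    using levy_exponent_slice[of "{0..t}" F t] integrable_kappa_lift[of t F] by (simp add: kappa_lift_def[abs_def])
  also have "\<dots> = (CLINT s|lborel. indicator {0..t} (t + -1 * s) *\<^sub>R phi m (kappa F (t - (t + -1 * s))))"
    using lborel_integral_real_affine[of "-1" "\<lambda>s. indicator {0..t} s *\<^sub>R phi m (kappa F (t - s))" t] by simp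
  also have "\<dots> = log_char t F"
    unfolding log_char_def set_lebesgue_integral_def
    by (intro Bochner_Integration.integral_cong refl) (auto simp: indicator_def)
  finally show ?thesis .
qed

lemma borel_measurable_innov [measurable]: "innov s t F \<in> borel_measurable \<mu>"
  unfolding innov_def[abs_def] by (rule measurable_intensityI) measurable

lemma integrable_innov:
  assumes "0 \<le> s"
  shows "integrable \<mu> (innov s t F)"
  by (rule Bochner_Integration.integrable_bound[OF integrable_kappa_lift[of "s + t" F]])
    (use assms in \<open>auto simp: innov_def kappa_lift_def indicator_def abs_mult\<close>)

text \<open>Reversing time by r to s + t - r carries (s, s+t] to [0, t), which differs from [0, t]
  by a null point. The exponent is therefore that of X t, independently of s: this is the time
  homogeneity of the process.\<close>

lemma levy_exponent_innov:
  assumes s: "0 \<le> s"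
  shows "levy_exponent (innov s t F) = log_char t F"
proof -
  have "levy_exponent (innov s t F) = (CLINT r|lborel. indicator {s<..s+t} r *\<^sub>R phi m (kappa F (s + t - r)))"
    using levy_exponent_slice[of "{s<..s+t}" F "s + t"] integrable_innov[OF s, of t F] s by (simp add: innov_def[abs_def] subset_eq)
  also have "\<dots> = (CLINT r|lborel. indicator {s<..s+t} (s + t + -1 * r) *\<^sub>R phi m (kappa F (s + t - (s + t + -1 * r))))"
    using lborel_integral_real_affine[of "-1" "\<lambda>r. indicator {s<..s+t} r *\<^sub>R phi m (kappa F (s + t - r))" "s + t"] by simp
  also have "\<dots> = (CLINT r|lborel. indicator {0..<t} r *\<^sub>R phi m (kappa F r))"
    by (intro Bochner_Integration.integral_cong refl) (auto simp: indicator_def)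
  also have "\<dots> = (CLINT r|lborel. indicator {0..t} r *\<^sub>R phi m (kappa F r))"
  proof (rule integral_cong_AE)
    have "(\<lambda>r. phi m (kappa F r)) \<in> borel_measurable borel"
    proof -
      have [measurable]: "(\<lambda>q. snd q) \<in> borel_measurable (borel \<Otimes>\<^sub>M m)"
        using measurable_compose[OF measurable_snd measurable_m] .
      show ?thesis unfolding phi_def
        by (rule m.borel_measurable_lebesgue_integral) (simp add: split_beta')
    qed
    then show "(\<lambda>r. indicator {0..<t} r *\<^sub>R phi m (kappa F r)) \<in> borel_measurable lborel"
      "(\<lambda>r. indicator {0..t} r *\<^sub>R phi m (kappa F r)) \<in> borel_measurable lborel" by measurable
    show "AE r in lborel. indicator {0..<t} r *\<^sub>R phi m (kappa F r) = indicator {0..t} r *\<^sub>R phi m (kappa F r)"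
      using AE_lborel_singleton[of t] by eventually_elim (auto simp: indicator_def)
  qed
  finally show ?thesis by (simp add: log_char_def set_lebesgue_integral_def)
qed

text \<open>Almost surely no jump happens at a prescribed time. At time s exactly, P_t k_0 = 0
  differs from k_t, so the decomposition of the process needs this exclusion.\<close>

lemma AE_intensity_fst_neq: "AE p in \<mu>. fst p \<noteq> s"
proof (rule AE_I)
  show "{p \<in> space \<mu>. \<not> fst p \<noteq> s} \<subseteq> fst -` {s} \<inter> space \<mu>" by auto
  show A: "fst -` {s} \<inter> space \<mu> \<in> sets \<mu>"
    using measurable_sets[OF measurable_intensity_fst, of "{s}"] by simp
  have "emeasure \<mu> (fst -` {s} \<inter> space \<mu>) = (\<integral>\<^sup>+p. indicator (fst -` {s} \<inter> space \<mu>) p \<partial>\<mu>)"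
    using A by simp
  also have "\<dots> = (\<integral>\<^sup>+r. (\<integral>\<^sup>+u. indicator (fst -` {s} \<inter> space \<mu>) (r, u) \<partial>m) * indicator {0..} r \<partial>lborel)"
    using A by (intro nn_integral_intensity) simp
  also have "\<dots> = (\<integral>\<^sup>+r. 0 \<partial>(lborel :: real measure))"
  proof (rule nn_integral_cong_AE)
    show "AE r in lborel. (\<integral>\<^sup>+u. indicator (fst -` {s} \<inter> space \<mu>) (r, u) \<partial>m) * indicator {0..} r = (0::ennreal)"
      using AE_lborel_singleton[of s] by eventually_elim simp
  qed
  finally show "emeasure \<mu> (fst -` {s} \<inter> space \<mu>) = 0" by simp
qed

text \<open>Once P_t is moved onto F, jumps before s enter X (s+t) and P_t X s with the same
  coefficient and cancel; jumps after s enter only the former. What is left is \<open>innov\<close>,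
  up to the null time s.\<close>

lemma AE_inner_Y:
  assumes s: "0 \<le> s" and t: "0 \<le> t"
  shows "AE \<omega> in M. inner (Y s t \<omega>) F = compensated (innov s t F) \<omega>"
proof -
  have "AE p in \<mu>. kappa_lift (s + t) F p + (-1) * kappa_lift s (abs_op t F) p = innov s t F p"
    using AE_intensity_fst_neq[of s]
  proof eventually_elim
    case (elim p)
    show ?case
    proof (cases "fst p < s")
      case True
      then have "kappa (abs_op t F) (s - fst p) = kappa F (s + t - fst p)"
        using kappa_abs_op[OF t, of "s - fst p" F] by (simp add: algebra_simps)
      then show ?thesis using True t by (simp add: kappa_lift_def innov_def indicator_def)
    next
      case False
      then have "s < fst p" using elim by simp
      then show ?thesis using s by (simp add: kappa_lift_def innov_def indicator_def)
    qed
  qed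
  then have "AE \<omega> in M. compensated (\<lambda>p. kappa_lift (s + t) F p + (-1) * kappa_lift s (abs_op t F) p) \<omega> = compensated (innov s t F) \<omega>"
    by (intro AE_compensated_cong) measurable
  moreover have "AE \<omega> in M. compensated (\<lambda>p. kappa_lift (s + t) F p + (-1) * kappa_lift s (abs_op t F) p) \<omega> =
      compensated (kappa_lift (s + t) F) \<omega> + compensated (\<lambda>p. (-1) * kappa_lift s (abs_op t F) p) \<omega>"
    by (intro AE_compensated_add integrable_mult_right integrable_kappa_lift)
  moreover note AE_inner_X[OF add_nonneg_nonneg[OF s t], of F] AE_inner_X[OF s, of "abs_op t F"]
  ultimately show ?thesis
  proof (eventually_elim)
    case (elim \<omega>)
    then show ?case
      by (simp add: Y_def inner_diff_left inner_abs_op[OF t] compensated_scale[of "-1", simplified])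
  qed
qed

lemma measurable_Y:
  assumes s: "0 \<le> s" and t: "0 \<le> t"
  shows "Y s t \<in> M \<rightarrow>\<^sub>M borel"
  unfolding Y_def[abs_def]
  using measurable_X[of "s + t"] measurable_compose[OF measurable_X[OF s] measurable_abs_op[OF t]] s t
  by (intro borel_measurable_diff) auto

lemma char_X:
  assumes t: "0 \<le> t"
  shows "(CLINT \<omega>|M. iexp (inner (X t \<omega>) F)) = exp (log_char t F)"
proof -
  note [measurable] = measurable_X[OF t]
  have "(CLINT \<omega>|M. iexp (inner (X t \<omega>) F)) = (CLINT \<omega>|M. iexp (compensated (kappa_lift t F) \<omega>))"
  proof (rule integral_cong_AE)
    show "AE \<omega> in M. iexp (inner (X t \<omega>) F) = iexp (compensated (kappa_lift t F) \<omega>)"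
      using AE_inner_X[OF t, of F] by (rule eventually_mono) simp
  qed measurable
  then show ?thesis by (simp add: char_compensated[OF integrable_kappa_lift] levy_exponent_kappa_lift)
qed

section \<open>Independence of the innovation from the past\<close>

abbreviation \<F> :: "real \<Rightarrow> 'w measure" where
  "\<F> s \<equiv> natural_filtration M X s"

lemma natural_filtration_gen_subset:
  "{X r -` B \<inter> space M | r B. 0 \<le> r \<and> r \<le> s \<and> B \<in> sets borel} \<subseteq> sets M"
proof clarify
  fix r :: real and B :: "L2D set" assume "0 \<le> r" "B \<in> sets borel"
  then show "X r -` B \<inter> space M \<in> sets M" by (intro measurable_sets[OF measurable_X])
qed

lemma sets_\<F>: "sets (\<F> s) = sigma_sets (space M) {X r -` B \<inter> space M | r B. 0 \<le> r \<and> r \<le> s \<and> B \<in> sets borel}"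
  unfolding natural_filtration_def by (rule sets_measure_of) auto

lemma space_\<F>: "space (\<F> s) = space M"
  unfolding natural_filtration_def by (rule space_measure_of) auto

lemma subalgebra_\<F>: "subalgebra M (\<F> s)"
  unfolding subalgebra_def space_\<F> sets_\<F>
  using sets.sigma_sets_subset[OF natural_filtration_gen_subset] by simp

lemma measurable_X_\<F>:
  assumes r: "0 \<le> r" "r \<le> s"
  shows "X r \<in> \<F> s \<rightarrow>\<^sub>M borel"
proof (rule measurableI)
  fix B :: "L2D set" assume "B \<in> sets borel"
  then have "X r -` B \<inter> space M \<in> {X r -` B \<inter> space M | r B. 0 \<le> r \<and> r \<le> s \<and> B \<in> sets borel}"
    using r by blast
  then show "X r -` B \<inter> space (\<F> s) \<in> sets (\<F> s)"
    unfolding sets_\<F> space_\<F> by (rule sigma_sets.Basic)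
qed simp

text \<open>A random variable known at time \<open>s\<close> is a compensated integral supported on \<open>[0, s]\<close>,
  whereas \<open>Y s t\<close> only involves \<open>(s, s + t]\<close>; hence their joint characteristic functional
  factorizes.\<close>

lemma distr_pair_\<F>_Y:
  assumes s: "0 \<le> s" and t: "0 \<le> t"
  shows "distr M (\<F> s \<Otimes>\<^sub>M borel) (\<lambda>\<omega>. (\<omega>, Y s t \<omega>)) = restr_to_subalg M (\<F> s) \<Otimes>\<^sub>M distr M borel (X t)"
proof -
  let ?R = "restr_to_subalg M (\<F> s)" and ?L = "distr M borel (X t)"
  let ?P = "distr M (\<F> s \<Otimes>\<^sub>M borel) (\<lambda>\<omega>. (\<omega>, Y s t \<omega>))"
  interpret R: prob_space ?R by (rule prob_space_restr_to_subalg[OF subalgebra_\<F> prob_space_axioms])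
  interpret L: prob_space ?L by (rule prob_space_distr[OF measurable_X[OF t]])
  interpret RL: pair_prob_space ?R ?L ..
  have id: "(\<lambda>\<omega>. \<omega>) \<in> M \<rightarrow>\<^sub>M \<F> s"
    using measurable_from_subalg[OF subalgebra_\<F>, of "\<lambda>\<omega>. \<omega>" s "\<F> s"] by simp
  have pair: "(\<lambda>\<omega>. (\<omega>, Y s t \<omega>)) \<in> M \<rightarrow>\<^sub>M \<F> s \<Otimes>\<^sub>M borel"
    by (intro measurable_Pair id measurable_Y s t)
  have setsR: "sets ?R = sets (\<F> s)" by (rule sets_restr_to_subalg[OF subalgebra_\<F>])
  have sets_RL: "sets (?R \<Otimes>\<^sub>M ?L) = sets (\<F> s \<Otimes>\<^sub>M borel)"
    by (intro sets_pair_measure_cong setsR) simp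
  have space_FB: "space (\<F> s \<Otimes>\<^sub>M (borel :: L2D measure)) = space M \<times> UNIV"
    by (simp add: space_pair_measure space_\<F>)
  \<comment> \<open>Elements of V0 are exactly measurable for the past, but agree with a compensated
    integral supported in [0, s] only almost surely. Both demands are stable under linear
    combinations, and all inner products of X r with r \<le> s satisfy them.\<close>
  define V0 where "V0 = {v \<in> borel_measurable (\<F> s). \<exists>\<phi>. integrable \<mu> \<phi> \<and> (\<forall>p. s < fst p \<longrightarrow> \<phi> p = 0) \<and> (AE \<omega> in M. v \<omega> = compensated \<phi> \<omega>)}"
  define V where "V = {\<lambda>q. v (fst q) + inner (snd q) F | v (F :: L2D). v \<in> V0}"
  have V_I: "(\<lambda>q. v (fst q) + inner (snd q) F) \<in> V" if "v \<in> V0" for v F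
    using that unfolding V_def by blast
  have V0_zero: "(\<lambda>_. 0) \<in> V0"
    unfolding V0_def by (auto intro!: exI[of _ "\<lambda>_. 0"] simp: compensated_def)
  have V0_X: "(\<lambda>\<omega>. inner (X r \<omega>) F) \<in> V0" if r: "0 \<le> r" "r \<le> s" for r F
    unfolding V0_def mem_Collect_eq
  proof (intro conjI exI[of _ "kappa_lift r F"] allI impI)
    show "(\<lambda>\<omega>. inner (X r \<omega>) F) \<in> borel_measurable (\<F> s)"
      using measurable_X_\<F>[OF r] by (intro borel_measurable_inner borel_measurable_const)
    show "kappa_lift r F p = 0" if "s < fst p" for p using that r by (simp add: kappa_lift_def)
  qed (auto intro: integrable_kappa_lift AE_inner_X r)
  have V0_meas: "v \<in> borel_measurable (\<F> s)" if "v \<in> V0" for v using that by (simp add: V0_def)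
  have V_meas: "v \<in> borel_measurable (\<F> s \<Otimes>\<^sub>M borel)" if v: "v \<in> V" for v
  proof -
    obtain w F where w: "v = (\<lambda>q. w (fst q) + inner (snd q) F)" "w \<in> V0" using v unfolding V_def by blast
    have "w \<in> borel_measurable (\<F> s)" using V0_meas w(2) .
    then show ?thesis unfolding w(1)
      by (intro borel_measurable_add measurable_compose[OF measurable_fst] measurable_compose[OF measurable_snd measurable_inner_left])
  qed
  show "?P = ?R \<Otimes>\<^sub>M ?L"
  proof (rule measure_eqI_char_functional[where V=V])
    show "prob_space ?P" by (rule prob_space_distr[OF pair])
    show "prob_space (?R \<Otimes>\<^sub>M ?L)" by (rule RL.prob_space_axioms)
    show "sets ?P = sets (?R \<Otimes>\<^sub>M ?L)" by (simp only: sets_distr sets_RL)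
    show "v \<in> borel_measurable ?P" if "v \<in> V" for v using V_meas[OF that] by simp
    show "V \<noteq> {}" using V0_zero by (auto simp: V_def)
  next
    fix v w assume "v \<in> V" "w \<in> V"
    then obtain v' w' F G where v: "v = (\<lambda>q. v' (fst q) + inner (snd q) F)" "v' \<in> V0"
      and w: "w = (\<lambda>q. w' (fst q) + inner (snd q) G)" "w' \<in> V0" unfolding V_def by blast
    have "(\<lambda>\<omega>. v' \<omega> + w' \<omega>) \<in> V0"
    proof -
      obtain \<phi> \<psi> where \<phi>: "integrable \<mu> \<phi>" "\<forall>p. s < fst p \<longrightarrow> \<phi> p = 0" "AE \<omega> in M. v' \<omega> = compensated \<phi> \<omega>"
        and \<psi>: "integrable \<mu> \<psi>" "\<forall>p. s < fst p \<longrightarrow> \<psi> p = 0" "AE \<omega> in M. w' \<omega> = compensated \<psi> \<omega>"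
        using v(2) w(2) unfolding V0_def by blast
      have "AE \<omega> in M. v' \<omega> + w' \<omega> = compensated (\<lambda>p. \<phi> p + \<psi> p) \<omega>"
        using \<phi>(3) \<psi>(3) AE_compensated_add[OF \<phi>(1) \<psi>(1)] by eventually_elim simp
      then show ?thesis
        unfolding V0_def mem_Collect_eq using \<phi> \<psi> V0_meas[OF v(2)] V0_meas[OF w(2)]
        by (intro conjI exI[of _ "\<lambda>p. \<phi> p + \<psi> p"]) auto
    qed
    from V_I[OF this, of "F + G"] show "(\<lambda>q. v q + w q) \<in> V"
      by (simp add: v w inner_add_right algebra_simps)
  next
    fix v c assume "v \<in> V"
    then obtain v' F where v: "v = (\<lambda>q. v' (fst q) + inner (snd q) F)" "v' \<in> V0" unfolding V_def by blast
    have "(\<lambda>\<omega>. c * v' \<omega>) \<in> V0"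
    proof -
      obtain \<phi> where \<phi>: "integrable \<mu> \<phi>" "\<forall>p. s < fst p \<longrightarrow> \<phi> p = 0" "AE \<omega> in M. v' \<omega> = compensated \<phi> \<omega>"
        using v(2) unfolding V0_def by blast
      have "AE \<omega> in M. c * v' \<omega> = compensated (\<lambda>p. c * \<phi> p) \<omega>"
        using \<phi>(3) by eventually_elim (simp add: compensated_scale)
      then show ?thesis
        unfolding V0_def mem_Collect_eq using \<phi> V0_meas[OF v(2)]
        by (intro conjI exI[of _ "\<lambda>p. c * \<phi> p"]) auto
    qed
    from V_I[OF this, of "c *\<^sub>R F"] show "(\<lambda>q. c * v q) \<in> V"
      by (simp add: v algebra_simps)
  next
    let ?\<Omega> = "space M \<times> (UNIV :: L2D set)"
    let ?G = "{v -` B \<inter> ?\<Omega> | v B. v \<in> V \<and> B \<in> sets borel}"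
    let ?S = "sigma ?\<Omega> ?G"
    have spS: "space ?S = ?\<Omega>" and setsS: "sets ?S = sigma_sets ?\<Omega> ?G"
      by (auto intro!: space_measure_of sets_measure_of)
    have VS: "v \<in> borel_measurable ?S" if v: "v \<in> V" for v
    proof (rule measurableI)
      fix B :: "real set" assume "B \<in> sets borel"
      then have "v -` B \<inter> ?\<Omega> \<in> ?G" using v by blast
      then show "v -` B \<inter> space ?S \<in> sets ?S" unfolding spS setsS by (rule sigma_sets.Basic)
    qed simp
    \<comment> \<open>To see that V generates the product sigma-algebra it is enough that both
      projections are measurable for the one generated by V. For the Hilbert space factor, and for
      each X r composed with the first projection, this is tested by inner products, all of which
      belong to V.\<close>
    have "(\<lambda>q. snd q) \<in> ?S \<rightarrow>\<^sub>M borel"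
    proof (rule borel_measurable_L2D)
      fix F
      from VS[OF V_I[OF V0_zero, of F]] show "(\<lambda>q. inner (snd q) F) \<in> borel_measurable ?S" by simp
    qed
    moreover have "(\<lambda>q. fst q) \<in> ?S \<rightarrow>\<^sub>M \<F> s"
      unfolding natural_filtration_def
    proof (rule measurable_measure_of)
      show "{X r -` B \<inter> space M | r B. 0 \<le> r \<and> r \<le> s \<and> B \<in> sets borel} \<subseteq> Pow (space M)" by auto
      show "(\<lambda>q. fst q) \<in> space ?S \<rightarrow> space M" unfolding spS by auto
      fix A assume "A \<in> {X r -` B \<inter> space M | r B. 0 \<le> r \<and> r \<le> s \<and> B \<in> sets borel}"
      then obtain r B where r: "0 \<le> r" "r \<le> s" and B: "B \<in> sets borel" and A: "A = X r -` B \<inter> space M" by blast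
      have "(\<lambda>q. X r (fst q)) \<in> ?S \<rightarrow>\<^sub>M borel"
      proof (rule borel_measurable_L2D)
        fix F
        from VS[OF V_I[OF V0_X[OF r, of F], of 0]] show "(\<lambda>q. inner (X r (fst q)) F) \<in> borel_measurable ?S" by simp
      qed
      from measurable_sets[OF this B] show "(\<lambda>q. fst q) -` A \<inter> space ?S \<in> sets ?S"
        unfolding A spS by (simp add: vimage_def Int_def mem_Times_iff conj_ac cong: conj_cong)
    qed
    ultimately have "(\<lambda>q. (fst q, snd q)) \<in> ?S \<rightarrow>\<^sub>M \<F> s \<Otimes>\<^sub>M borel" by (intro measurable_Pair)
    then have "sets (\<F> s \<Otimes>\<^sub>M borel) \<subseteq> sets ?S"
    proof (intro subsetI)
      fix A assume m: "(\<lambda>q. (fst q, snd q)) \<in> ?S \<rightarrow>\<^sub>M \<F> s \<Otimes>\<^sub>M borel" and A: "A \<in> sets (\<F> s \<Otimes>\<^sub>M (borel :: L2D measure))"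
      have "A \<subseteq> ?\<Omega>" using sets.sets_into_space[OF A] by (simp add: space_FB)
      then have "(\<lambda>q. (fst q, snd q)) -` A \<inter> space ?S = A" unfolding spS by auto
      then show "A \<in> sets ?S" using measurable_sets[OF m A] by simp
    qed
    moreover have "sets ?S \<subseteq> sets (\<F> s \<Otimes>\<^sub>M borel)"
    proof -
      have "?G \<subseteq> sets (\<F> s \<Otimes>\<^sub>M borel)"
      proof clarify
        fix v and B :: "real set" assume "v \<in> V" "B \<in> sets borel"
        then show "v -` B \<inter> ?\<Omega> \<in> sets (\<F> s \<Otimes>\<^sub>M borel)"
          using measurable_sets[OF V_meas] unfolding space_FB by blast
      qed
      then show ?thesis
        unfolding setsS using sets.sigma_sets_subset[of ?G "\<F> s \<Otimes>\<^sub>M borel"] by (simp add: space_FB)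
    qed
    ultimately show "sets ?P = sigma_sets (space ?P) {v -` B \<inter> space ?P | v B. v \<in> V \<and> B \<in> sets borel}"
      using setsS by (simp add: space_FB)
  next
    fix v assume v: "v \<in> V"
    then obtain v' F where v': "v = (\<lambda>q. v' (fst q) + inner (snd q) F)" "v' \<in> V0" unfolding V_def by blast
    obtain \<phi> where \<phi>: "integrable \<mu> \<phi>" "\<forall>p. s < fst p \<longrightarrow> \<phi> p = 0" "AE \<omega> in M. v' \<omega> = compensated \<phi> \<omega>"
      using v'(2) unfolding V0_def by blast
    have \<phi>m [measurable]: "\<phi> \<in> borel_measurable \<mu>" using \<phi>(1) by simp
    have vm: "v' \<in> borel_measurable (\<F> s)" by (rule V0_meas[OF v'(2)])
    have vmM [measurable]: "v' \<in> borel_measurable M" by (rule measurable_from_subalg[OF subalgebra_\<F> vm])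
    have vmR [measurable]: "v' \<in> borel_measurable ?R" using vm setsR measurable_cong_sets by blast
    note [measurable] = measurable_Y[OF s t]
    have disj: "\<phi> p = 0 \<or> innov s t F p = 0" for p
    proof (cases "s < fst p")
      case True
      then show ?thesis using \<phi>(2) by blast
    qed (simp add: innov_def)
    note \<iota> = integrable_innov[OF s, of t F]
    have "(CLINT q|?P. iexp (v q)) = (CLINT \<omega>|M. iexp (v (\<omega>, Y s t \<omega>)))"
      by (rule integral_distr[OF pair]) (use V_meas[OF v] in measurable)
    also have "\<dots> = (CLINT \<omega>|M. iexp (compensated (\<lambda>p. \<phi> p + innov s t F p) \<omega>))"
    proof (rule integral_cong_AE)
      show "AE \<omega> in M. iexp (v (\<omega>, Y s t \<omega>)) = iexp (compensated (\<lambda>p. \<phi> p + innov s t F p) \<omega>)"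
        using \<phi>(3) AE_inner_Y[OF s t, of F] AE_compensated_add[OF \<phi>(1) \<iota>]
        by eventually_elim (simp add: v')
      show "(\<lambda>\<omega>. iexp (v (\<omega>, Y s t \<omega>))) \<in> borel_measurable M" unfolding v'(1) fst_conv snd_conv by measurable
    qed measurable
    also have "\<dots> = exp (levy_exponent \<phi>) * exp (log_char t F)"
      by (simp add: char_compensated \<phi>(1) \<iota> levy_exponent_add[OF \<phi>(1) \<iota> disj] levy_exponent_innov[OF s] exp_add)
    also have "exp (levy_exponent \<phi>) = (CLINT \<omega>|M. iexp (v' \<omega>))"
      unfolding char_compensated[OF \<phi>(1), symmetric]
      by (rule integral_cong_AE; measurable?) (use \<phi>(3) in \<open>auto elim: eventually_mono\<close>)
    also have "\<dots> = (CLINT \<omega>|?R. iexp (v' \<omega>))"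
      by (rule integral_subalgebra2[OF subalgebra_\<F>, symmetric]) (use vm in measurable)
    also have "exp (log_char t F) = (CLINT x|?L. iexp (inner x F))"
      by (subst integral_distr[OF measurable_X[OF t]]) (auto simp: char_X[OF t])
    also have "(CLINT \<omega>|?R. iexp (v' \<omega>)) * (CLINT x|?L. iexp (inner x F)) = (CLINT \<omega>|?R. CLINT x|?L. iexp (v (\<omega>, x)))"
      by (simp add: v' distrib_left exp_add)
    also have "\<dots> = (CLINT q|?R \<Otimes>\<^sub>M ?L. iexp (v q))"
    proof (rule RL.integral_fst')
      have "v \<in> borel_measurable (?R \<Otimes>\<^sub>M ?L)" using V_meas[OF v] sets_RL measurable_cong_sets by blast
      then show "complex_integrable (?R \<Otimes>\<^sub>M ?L) (\<lambda>q. iexp (v q))"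
        by (intro RL.integrable_const_bound[where B=1]) auto
    qed
    finally show "(CLINT q|?P. iexp (v q)) = (CLINT q|?R \<Otimes>\<^sub>M ?L. iexp (v q))" .
  qed
qed

text \<open>Independence in the form of Tonelli's theorem: the innovation is integrated out first,
  with the law of X t, for a freely chosen event C in the product. The semigroup law and the Markov
  property arise from two choices of C.\<close>

lemma emeasure_\<F>_Y:
  assumes s: "0 \<le> s" and t: "0 \<le> t" and C: "C \<in> sets (\<F> s \<Otimes>\<^sub>M borel)"
  shows "emeasure M {\<omega> \<in> space M. (\<omega>, Y s t \<omega>) \<in> C} = (\<integral>\<^sup>+\<omega>. emeasure (distr M borel (X t)) (Pair \<omega> -` C) \<partial>M)"
proof -
  let ?R = "restr_to_subalg M (\<F> s)" and ?L = "distr M borel (X t)"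
  interpret L: prob_space ?L by (rule prob_space_distr[OF measurable_X[OF t]])
  have id: "(\<lambda>\<omega>. \<omega>) \<in> M \<rightarrow>\<^sub>M \<F> s"
    using measurable_from_subalg[OF subalgebra_\<F>, of "\<lambda>\<omega>. \<omega>" s "\<F> s"] by simp
  have pair: "(\<lambda>\<omega>. (\<omega>, Y s t \<omega>)) \<in> M \<rightarrow>\<^sub>M \<F> s \<Otimes>\<^sub>M borel"
    by (intro measurable_Pair id measurable_Y s t)
  have setsR: "sets ?R = sets (\<F> s)" by (rule sets_restr_to_subalg[OF subalgebra_\<F>])
  have sets_RL: "sets (?R \<Otimes>\<^sub>M ?L) = sets (\<F> s \<Otimes>\<^sub>M borel)" and sets_FL: "sets (\<F> s \<Otimes>\<^sub>M ?L) = sets (\<F> s \<Otimes>\<^sub>M borel)"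
    by (intro sets_pair_measure_cong setsR refl; simp)+
  have "{\<omega> \<in> space M. (\<omega>, Y s t \<omega>) \<in> C} = (\<lambda>\<omega>. (\<omega>, Y s t \<omega>)) -` C \<inter> space M" by auto
  then have "emeasure M {\<omega> \<in> space M. (\<omega>, Y s t \<omega>) \<in> C} = emeasure (distr M (\<F> s \<Otimes>\<^sub>M borel) (\<lambda>\<omega>. (\<omega>, Y s t \<omega>))) C"
    by (simp add: emeasure_distr[OF pair C])
  also have "\<dots> = emeasure (?R \<Otimes>\<^sub>M ?L) C" by (simp add: distr_pair_\<F>_Y[OF s t])
  also have "\<dots> = (\<integral>\<^sup>+\<omega>. emeasure ?L (Pair \<omega> -` C) \<partial>?R)"
    by (rule L.emeasure_pair_measure_alt) (subst sets_RL, rule C)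
  also have "\<dots> = (\<integral>\<^sup>+\<omega>. emeasure ?L (Pair \<omega> -` C) \<partial>M)"
    by (rule nn_integral_subalgebra2[OF subalgebra_\<F>]) (rule L.measurable_emeasure_Pair, subst sets_FL, rule C)
  finally show ?thesis .
qed

section \<open>Transition kernels and the Markov property\<close>

definition R :: "real \<Rightarrow> L2D \<Rightarrow> L2D measure" where
  "R t g = distr M borel (\<lambda>\<omega>. abs_op t g + X t \<omega>)"

lemma measurable_abs_op_plus_X: "0 \<le> t \<Longrightarrow> (\<lambda>\<omega>. a + X t \<omega>) \<in> M \<rightarrow>\<^sub>M borel"
  using measurable_X by (intro borel_measurable_add borel_measurable_const)

lemma prob_space_R: "0 \<le> t \<Longrightarrow> prob_space (R t g)"
  unfolding R_def by (intro prob_space_distr measurable_abs_op_plus_X)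

lemma emeasure_R:
  assumes t: "0 \<le> t" and B: "B \<in> sets borel"
  shows "emeasure (R t g) B = emeasure (distr M borel (X t)) ((\<lambda>x. abs_op t g + x) -` B)"
proof -
  have "(\<lambda>x. abs_op t g + x) \<in> borel \<rightarrow>\<^sub>M borel" by simp
  from measurable_sets[OF this B] have "(\<lambda>x. abs_op t g + x) -` B \<in> sets borel" by simp
  then show ?thesis
    unfolding R_def using B by (simp add: emeasure_distr measurable_abs_op_plus_X measurable_X t vimage_def)
qed

lemma measurable_R:
  assumes t: "0 \<le> t"
  shows "R t \<in> borel \<rightarrow>\<^sub>M prob_algebra borel"
  unfolding R_def[abs_def]
proof (rule measurable_distr_prob_space2)
  show "(\<lambda>g. M) \<in> borel \<rightarrow>\<^sub>M prob_algebra M"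
    by (intro measurable_const) (simp add: space_prob_algebra prob_space_axioms)
  note [measurable] = measurable_X[OF t] measurable_abs_op[OF t]
  show "(\<lambda>(g, \<omega>). abs_op t g + X t \<omega>) \<in> borel \<Otimes>\<^sub>M M \<rightarrow>\<^sub>M borel" by measurable
qed

lemma X_add: "X (s + t) \<omega> = abs_op t (X s \<omega>) + Y s t \<omega>"
  by (simp add: Y_def)

lemma measurable_shift_\<F>:
  assumes s: "0 \<le> s" and t: "0 \<le> t"
  shows "(\<lambda>q. a + (abs_op t (X s (fst q)) + snd q)) \<in> \<F> s \<Otimes>\<^sub>M borel \<rightarrow>\<^sub>M borel"
proof -
  note [measurable] = measurable_X_\<F>[OF s order_refl] measurable_abs_op[OF t]
  show ?thesis by measurable
qed

text \<open>From X (s+t) = P_t X s + Y and the semigroup property of P one gets P_(s+t) g + X (s+t)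
  = P_t (P_s g + X s) + Y. Integrating out the independent Y, which has the law of X t, leaves the
  kernel R t at a point distributed as R s g.\<close>

lemma R_add:
  assumes s: "0 \<le> s" and t: "0 \<le> t"
  shows "R (s + t) g = R s g \<bind> R t"
proof (rule measure_eqI)
  have Rs: "R s g \<in> space (prob_algebra borel)"
    using prob_space_R[OF s] by (simp add: space_prob_algebra R_def)
  show sets: "sets (R (s + t) g) = sets (R s g \<bind> R t)"
    using sets_bind'[OF Rs measurable_R[OF t]] by (simp add: R_def)
  fix B assume "B \<in> sets (R (s + t) g)"
  then have B: "B \<in> sets borel" by (simp add: R_def)
  let ?f = "\<lambda>q. abs_op (s + t) g + (abs_op t (X s (fst q)) + snd q)"
  let ?C = "?f -` B \<inter> space (\<F> s \<Otimes>\<^sub>M (borel :: L2D measure))"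
  have C: "?C \<in> sets (\<F> s \<Otimes>\<^sub>M borel)" by (rule measurable_sets[OF measurable_shift_\<F>[OF s t] B])
  have "emeasure (R (s + t) g) B = emeasure M {\<omega> \<in> space M. (\<omega>, Y s t \<omega>) \<in> ?C}"
    unfolding R_def emeasure_distr[OF measurable_abs_op_plus_X[OF add_nonneg_nonneg[OF s t]] B]
    by (rule arg_cong2[of _ _ _ _ emeasure]) (auto simp: X_add space_pair_measure space_\<F>)
  also have "\<dots> = (\<integral>\<^sup>+\<omega>. emeasure (distr M borel (X t)) (Pair \<omega> -` ?C) \<partial>M)"
    by (rule emeasure_\<F>_Y[OF s t C])
  also have "\<dots> = (\<integral>\<^sup>+\<omega>. emeasure (R t (abs_op s g + X s \<omega>)) B \<partial>M)"
  proof (rule nn_integral_cong)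
    fix \<omega> assume \<omega>: "\<omega> \<in> space M"
    have eq: "abs_op (s + t) g + (abs_op t (X s \<omega>) + x) = abs_op t (abs_op s g + X s \<omega>) + x" for x
      using bounded_linear_abs_op[OF t] abs_op_add_time[OF t s, of g]
      by (simp add: bounded_linear.linear linear_add add.commute add.assoc)
    have "Pair \<omega> -` ?C = (\<lambda>x. abs_op (s + t) g + (abs_op t (X s \<omega>) + x)) -` B"
      using \<omega> by (auto simp: space_pair_measure space_\<F>)
    then have "Pair \<omega> -` ?C = (\<lambda>x. abs_op t (abs_op s g + X s \<omega>) + x) -` B"
      unfolding eq .
    then show "emeasure (distr M borel (X t)) (Pair \<omega> -` ?C) = emeasure (R t (abs_op s g + X s \<omega>)) B"
      by (simp add: emeasure_R[OF t B])
  qed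
  also have "\<dots> = (\<integral>\<^sup>+h. emeasure (R t h) B \<partial>R s g)"
    unfolding R_def[of s]
    by (rule nn_integral_distr[OF measurable_abs_op_plus_X[OF s], symmetric])
      (unfold measurable_distr_eq1, rule measurable_emeasure_kernel[OF measurable_prob_algebraD[OF measurable_R[OF t]] B])
  also have "\<dots> = emeasure (R s g \<bind> R t) B"
    by (rule emeasure_bind_prob_algebra[OF Rs measurable_R[OF t] B, symmetric])
  finally show "emeasure (R (s + t) g) B = emeasure (R s g \<bind> R t) B" .
qed

lemma R_0: "R 0 x = return borel x"
proof -
  have "R 0 x = distr M borel (\<lambda>_. x)"
    unfolding R_def by (rule distr_cong) (auto simp: X_0)
  then show ?thesis by (simp add: distr_const)
qed

lemma char_R:
  assumes t: "0 \<le> t"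
  shows "(CLINT h|R t g. iexp (inner h F)) = exp (\<i> * of_real (inner (abs_op t g) F) + log_char t F)"
proof -
  have "(CLINT h|R t g. iexp (inner h F)) = (CLINT \<omega>|M. iexp (inner (abs_op t g + X t \<omega>) F))"
    unfolding R_def by (rule integral_distr[OF measurable_abs_op_plus_X[OF t]]) (use measurable_inner_left in measurable)
  also have "\<dots> = iexp (inner (abs_op t g) F) * (CLINT \<omega>|M. iexp (inner (X t \<omega>) F))"
    by (simp add: inner_add_left distrib_left exp_add)
  finally show ?thesis by (simp add: char_X[OF t] exp_add)
qed

text \<open>By uniqueness of conditional expectations it suffices to compare integrals over events A
  of the past. The event that \<omega> lies in A and X (s+t) in B has as section at \<omega> a
  translate of B if \<omega> is in A, and the empty set otherwise; the law of X t gives the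
  translate the mass \<open>measure (R t (X s \<omega>)) B\<close>.\<close>

lemma markov_process_X: "markov_process M X R"
  unfolding markov_process_def
proof (intro conjI allI impI ballI)
  show "X t \<in> M \<rightarrow>\<^sub>M borel" if "0 \<le> t" for t by (rule measurable_X[OF that])
  show "transition_semigroup R"
    unfolding transition_semigroup_def using measurable_R R_0 R_add by blast
  fix s t :: real and B :: "L2D set"
  assume s: "0 \<le> s" and t: "0 \<le> t" and B: "B \<in> sets borel"
  interpret F: finite_measure_subalgebra M "\<F> s"
    by unfold_locales (rule subalgebra_\<F>)
  have gm: "(\<lambda>\<omega>. measure (R t (X s \<omega>)) B) \<in> borel_measurable (\<F> s)"
    by (rule measurable_compose[OF measurable_X_\<F>[OF s order_refl]])
      (rule measure_measurable_prob_algebra2[OF _ measurable_R[OF t]], simp add: B)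
  have gmM [measurable]: "(\<lambda>\<omega>. measure (R t (X s \<omega>)) B) \<in> borel_measurable M"
    by (rule measurable_from_subalg[OF subalgebra_\<F> gm])
  have Xst: "X (s + t) -` B \<inter> space M \<in> sets M"
    using s t by (intro measurable_sets[OF measurable_X B]) auto
  \<comment> \<open>The bare preimage need not be a subset of \<open>space M\<close>; on that space
    its indicator agrees with the one of the measurable set \<open>Xst\<close>.\<close>
  have fm [measurable]: "indicator (X (s + t) -` B) \<in> borel_measurable M"
    using borel_measurable_indicator[OF Xst] by (rule measurable_cong[THEN iffD1, rotated]) (simp add: indicator_def)
  have gint: "integrable M (\<lambda>\<omega>. measure (R t (X s \<omega>)) B)"
    using prob_space.prob_le_1[OF prob_space_R[OF t]] by (intro integrable_const_bound[where B=1]) auto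
  show "AE \<omega> in M. real_cond_exp M (\<F> s) (indicator (X (s + t) -` B)) \<omega> = measure (R t (X s \<omega>)) B"
  proof (rule F.real_cond_exp_charact)
    show "integrable M (indicat_real (X (s + t) -` B))"
      by (intro integrable_const_bound[where B=1]) auto
    show "integrable M (\<lambda>\<omega>. measure (R t (X s \<omega>)) B)" by (rule gint)
    show "(\<lambda>\<omega>. measure (R t (X s \<omega>)) B) \<in> borel_measurable (\<F> s)" by (rule gm)
    fix A assume A: "A \<in> sets (\<F> s)"
    then have AM [measurable]: "A \<in> sets M" using subalgebra_\<F> by (auto simp: subalgebra_def)
    \<comment> \<open>The summand 0 only brings the map into the translated form treated by
      \<open>measurable_shift_\<F>\<close>.\<close>
    let ?f = "\<lambda>q. 0 + (abs_op t (X s (fst q)) + snd q)"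
    let ?C = "(?f -` B \<inter> space (\<F> s \<Otimes>\<^sub>M (borel :: L2D measure))) \<inter> (A \<times> UNIV)"
    have C: "?C \<in> sets (\<F> s \<Otimes>\<^sub>M borel)"
      using A by (intro sets.Int measurable_sets[OF measurable_shift_\<F>[OF s t] B] pair_measureI) auto
    have ASp: "A \<subseteq> space M" using sets.sets_into_space[OF AM] .
    have "(\<integral>\<^sup>+\<omega>. ennreal (indicator A \<omega> * measure (R t (X s \<omega>)) B) \<partial>M) = (\<integral>\<^sup>+\<omega>. emeasure (distr M borel (X t)) (Pair \<omega> -` ?C) \<partial>M)"
    proof (rule nn_integral_cong)
      fix \<omega> assume \<omega>: "\<omega> \<in> space M"
      interpret Rt: prob_space "R t (X s \<omega>)" by (rule prob_space_R[OF t])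
      show "ennreal (indicator A \<omega> * measure (R t (X s \<omega>)) B) = emeasure (distr M borel (X t)) (Pair \<omega> -` ?C)"
      proof (cases "\<omega> \<in> A")
        case True
        then have "Pair \<omega> -` ?C = (\<lambda>x. abs_op t (X s \<omega>) + x) -` B"
          using \<omega> by (auto simp: space_pair_measure space_\<F>)
        then show ?thesis using True emeasure_R[OF t B, of "X s \<omega>"] Rt.emeasure_eq_measure[of B] by simp
      next
        case False
        then have "Pair \<omega> -` ?C = {}" by auto
        then show ?thesis using False by simp
      qed
    qed
    also have "\<dots> = emeasure M {\<omega> \<in> space M. (\<omega>, Y s t \<omega>) \<in> ?C}"
      by (rule emeasure_\<F>_Y[OF s t C, symmetric])
    also have "{\<omega> \<in> space M. (\<omega>, Y s t \<omega>) \<in> ?C} = A \<inter> (X (s + t) -` B \<inter> space M)"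
      using ASp by (auto simp: X_add space_pair_measure space_\<F>)
    finally have eq: "(\<integral>\<^sup>+\<omega>. ennreal (indicator A \<omega> * measure (R t (X s \<omega>)) B) \<partial>M) = emeasure M (A \<inter> (X (s + t) -` B \<inter> space M))" .
    have "(\<integral>\<omega>\<in>A. measure (R t (X s \<omega>)) B \<partial>M) = measure M (A \<inter> (X (s + t) -` B \<inter> space M))"
      unfolding set_lebesgue_integral_def
      using eq by (subst integral_eq_nn_integral) (auto simp: measure_def[of M])
    moreover have "(\<integral>\<omega>\<in>A. indicator (X (s + t) -` B) \<omega> \<partial>M) = measure M (A \<inter> (X (s + t) -` B \<inter> space M))"
    proof -
      have "(\<integral>\<omega>\<in>A. indicator (X (s + t) -` B) \<omega> \<partial>M) = (LINT \<omega>|M. indicator (A \<inter> (X (s + t) -` B \<inter> space M)) \<omega>)"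
        unfolding set_lebesgue_integral_def by (intro Bochner_Integration.integral_cong refl) (auto simp: indicator_def)
      also have "\<dots> = measure M (A \<inter> (X (s + t) -` B \<inter> space M))"
        using ASp by (simp add: Int_absorb2 Int_assoc)
      finally show ?thesis .
    qed
    ultimately show "(\<integral>\<omega>\<in>A. indicator (X (s + t) -` B) \<omega> \<partial>M) = (\<integral>\<omega>\<in>A. measure (R t (X s \<omega>)) B \<partial>M)" by simp
  qed
qed

end

theorem theorem4p3:
  fixes m :: "real measure"
    and M :: "'w measure"
    and N :: "'w \<Rightarrow> (real \<times> real) measure"
  assumes m_sets: "sets m = sets (restrict_space borel (- {0}))"
    and m_finite: "finite_measure (density m (\<lambda>u. ennreal (max 1 \<bar>u\<bar>)))"
    and M_prob: "prob_space M"
    and M_complete: "complete_measure M"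
    and N_prm: "poisson_random_measure M (intensity m) N"
  shows "(\<forall>t\<ge>0.
            (\<forall>y>0. set_integrable (intensity m) ({0..t} \<times> (- {0})) (Z0_integrand t y)) \<and>
            (AE \<omega> in M.
               (\<forall>y>0. set_integrable (N \<omega>) ({0..t} \<times> (- {0})) (Z0_integrand t y)) \<and>
               square_integrable_D (Z0 m N t \<omega>))) \<and>
         (\<exists>R :: real \<Rightarrow> L2D \<Rightarrow> L2D measure.
            (\<forall>t\<ge>0. \<forall>g. \<forall>f. square_integrable_D f \<longrightarrow>
               (\<integral>h. exp (\<i> * of_real (inner h (L2_of f))) \<partial>(R t g))
               = exp (\<i> * of_real (inner g (L2_of (abs_semigroup t f)))
                      + (LINT s : {0..t} | lborel. phi m (inner (L2_of (kfun s)) (L2_of f))))) \<and>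
            markov_process M (\<lambda>t \<omega>. L2_of (Z0 m N t \<omega>)) R \<and>
            (AE \<omega> in M. L2_of (Z0 m N 0 \<omega>) = 0))"
proof -
  interpret shot_noise m M N
    using assms by (simp add: shot_noise_def jump_measure_def poisson_measure_def poisson_measure_axioms_def shot_noise_axioms_def)
  have X: "X = (\<lambda>t \<omega>. L2_of (Z0 m N t \<omega>))" by (simp add: X_def fun_eq_iff)
  show ?thesis
  proof (intro conjI exI[of _ R] allI impI)
    fix t y :: real assume "0 \<le> t" "0 < y"
    then show "set_integrable (intensity m) ({0..t} \<times> - {0}) (Z0_integrand t y)"
      using integrable_k_lift_measure[OF refl nn_integral_jump_bound_finite]
      by (simp add: set_integrable_Z0_integrand_iff)
  next
    fix t :: real assume "0 \<le> t"
    from AE_Z0[OF this] show "AE \<omega> in M. (\<forall>y>0. set_integrable (N \<omega>) ({0..t} \<times> - {0}) (Z0_integrand t y)) \<and>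
        square_integrable_D (Z0 m N t \<omega>)"
      by (auto elim: eventually_mono)
  next
    fix t :: real and g :: L2D and f :: "real \<Rightarrow> real"
    assume t: "0 \<le> t" and f: "square_integrable_D f"
    \<comment> \<open>Times in [0, t] are nonnegative, so the cut-off in \<open>kappa\<close> is
      invisible here. The remaining difference to \<open>char_R\<close> is the place of the
      semigroup, which self-adjointness moves from g to f.\<close>
    have "log_char t (L2_of f) = (LINT s : {0..t} | lborel. phi m (inner (L2_of (kfun s)) (L2_of f)))"
      unfolding log_char_def set_lebesgue_integral_def
      by (intro Bochner_Integration.integral_cong refl) (simp add: kappa_def indicator_def)
    then show "(\<integral>h. exp (\<i> * of_real (inner h (L2_of f))) \<partial>(R t g))
       = exp (\<i> * of_real (inner g (L2_of (abs_semigroup t f)))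
              + (LINT s : {0..t} | lborel. phi m (inner (L2_of (kfun s)) (L2_of f))))"
      using char_R[OF t, of g "L2_of f"] inner_abs_op[OF t, of g "L2_of f"] abs_op_L2_of[OF t f] by simp
  next
    show "markov_process M (\<lambda>t \<omega>. L2_of (Z0 m N t \<omega>)) R" using markov_process_X unfolding X .
    show "AE \<omega> in M. L2_of (Z0 m N 0 \<omega>) = 0" using X_0 by (intro AE_I2) (simp add: X_def)
  qed
qed

end
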